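(* Let $\Omega$ be a bounded domain in $X$ whose boundary is Ahlfors codimension $1$ regular, i.e. there is $C_A\ge 1$ such that for all $x\in\partial\Omega$ and $0<r\le\operatorname{diam}(\Omega)$, $$C_A^{-1}\frac{\mu(B(x,r))}{r}\le \mathcal{H}(B(x,r)\cap\partial\Omega)\le C_A\frac{\mu(B(x,r))}{r}.$$ Then there is a nonlinear bounded extension operator $\operatorname{Ext}:L^1(\partial\Omega)\to BV(\Omega)$, where bounded means that there is a constant $C$ with $\|\operatorname{Ext} f\|_{BV(\Omega)}\le C\|f\|_{L^1(\partial\Omega)}$ for all $f\in L^1(\partial\Omega)$, such that $T\circ\operatorname{Ext}$ is the identity operator on $L^1(\partial\Omega)$; that is, for each $f\in L^1(\partial\Omega)$ the trace $T(\operatorname{Ext}f)(z)$ exists and equals $f(z)$ for $\mathcal{H}$-a.e. $z\in\partial\Omega$.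
   Context: $(X,d,\mu)$ is a complete metric space with a Borel regular (Radon) measure $\mu$ that is doubling: there is $C_D$ with $0<\mu(B(x,2r))\le C_D\,\mu(B(x,r))<\infty$ for all $x\in X$, $r>0$. A domain is a nonempty connected open set. No Poincaré inequality is assumed. Co-dimension $1$ Hausdorff measure: for $A\subset X$, $\mathcal{H}(A)=\lim_{\delta\to0^+}\inf\{\sum_i \mu(B_i)/\operatorname{rad}(B_i): B_i \text{ balls in } X,\ \operatorname{rad}(B_i)<\delta,\ A\subset\bigcup_i B_i\}$, where $\operatorname{rad}(B)$ is the radius of $B$. The boundary $\partial\Omega$ is equipped with the restriction of $\mathcal{H}$, and $L^1(\partial\Omega)$ is taken with respect to it. BV: a Borel function $g:U\to[0,\infty]$ is an upper gradient of $u$ in an open set $U$ if for every rectifiable curve $\gamma$ in $U$ with endpoints $x,y$ we have $|u(x)-u(y)|\le\int_\gamma g\,ds$ whenever $u(x),u(y)$ are both finite, and $\int_\gamma g\,ds=\infty$ otherwise. Let $I(u:U)=\inf\int_U g\,d\mu$ over all upper gradients $g$ of $u$ in $U$, and $\|Du\|(U)=\inf\{\liminf_i I(u_i:U): u_i \text{ locally Lipschitz in } U,\ u_i\to u\text{ in }L^1(U)\}$. $BV(\Omega)$ is the space of $u\in L^1(\Omega)$ with $\|u\|_{BV(\Omega)}=\|u\|_{L^1(\Omega)}+\|Du\|(\Omega)<\infty$. Trace: for $u\in BV(\Omega)$ and $z\in\partial\Omega$, the trace of $u$ at $z$ exists and is the number $Tu(z)\in\mathbb{R}$ if $\limsup_{r\to0^+}\frac{1}{\mu(B(z,r)\cap\Omega)}\int_{B(z,r)\cap\Omega}|u(y)-Tu(z)|\,d\mu(y)=0$.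 *)

theory Defs
  imports "HOL-Analysis.Analysis"
begin

section \<open>Doubling metric measure spaces\<close>

text \<open>
  The ambient space is the whole of a type of class \<open>complete_space\<close>. The measure \<open>M\<close> may live on
  the Borel sets or on a larger sigma-algebra (such as the Caratheodory measurable sets of a Borel
  regular outer measure), as long as it is Borel regular. Balls are open.
\<close>

definition borel_regular :: "'a::metric_space measure \<Rightarrow> bool" where
  "borel_regular M \<longleftrightarrow>
     sets borel \<subseteq> sets M \<and>
     (\<forall>A\<in>sets M. \<exists>B\<in>sets borel. A \<subseteq> B \<and> emeasure M B = emeasure M A)"

definition doubling :: "'a::metric_space measure \<Rightarrow> bool" where
  "doubling M \<longleftrightarrow>
     (\<exists>C::real. \<forall>x r. 0 < r \<longrightarrow>
        0 < emeasure M (ball x (2 * r)) \<and>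
        emeasure M (ball x (2 * r)) \<le> ennreal C * emeasure M (ball x r) \<and>
        ennreal C * emeasure M (ball x r) < \<infinity>)"

section \<open>Codimension one Hausdorff measure\<close>

text \<open>
  In a general metric space a ball does not determine its radius, so a cover by balls is a countable
  set of pairs (centre, radius). Finite covers are included.
\<close>

definition ball_covers :: "real \<Rightarrow> 'a::metric_space set \<Rightarrow> ('a \<times> real) set set" where
  "ball_covers \<delta> A =
     {B. countable B \<and> (\<forall>(x, r)\<in>B. 0 < r \<and> r < \<delta>) \<and> A \<subseteq> (\<Union>(x, r)\<in>B. ball x r)}"

definition codim1_content :: "'a::metric_space measure \<Rightarrow> real \<Rightarrow> 'a set \<Rightarrow> ennreal" where
  "codim1_content M \<delta> A =
     (INF B\<in>ball_covers \<delta> A. \<Sum>\<^sub>\<infinity>(x, r)\<in>B. emeasure M (ball x r) / ennreal r)"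

definition codim1_hausdorff :: "'a::metric_space measure \<Rightarrow> 'a set \<Rightarrow> ennreal" where
  "codim1_hausdorff M A = Lim (at_right 0) (\<lambda>\<delta>. codim1_content M \<delta> A)"

text \<open>
  The restriction of the outer measure to subsets of \<open>S\<close>, as a measure on its Caratheodory
  measurable sets; \<open>emeasure_codim1_measure\<close> below shows that \<open>measure_of\<close> does not
  degenerate to the zero measure here.
\<close>

definition codim1_measure :: "'a::metric_space measure \<Rightarrow> 'a set \<Rightarrow> 'a measure" where
  "codim1_measure M S =
     measure_of S (lambda_system S (Pow S) (codim1_hausdorff M)) (codim1_hausdorff M)"

lemma ball_covers_UN:
  assumes "\<And>n::nat. B n \<in> ball_covers \<delta> (A n)"
  shows "(\<Union>n. B n) \<in> ball_covers \<delta> (\<Union>n. A n)"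
proof -
  have "A n \<subseteq> (\<Union>n. \<Union>(x, r)\<in>B n. ball x r)" for n
    using assms[of n] unfolding ball_covers_def by blast
  then have "(\<Union>n. A n) \<subseteq> (\<Union>(x, r)\<in>(\<Union>n. B n). ball x r)"
    by blast
  moreover have "countable (\<Union>n. B n)"
    using assms by (auto simp: ball_covers_def)
  moreover have "\<forall>(x, r)\<in>(\<Union>n. B n). 0 < r \<and> r < \<delta>"
    using assms unfolding ball_covers_def by blast
  ultimately show ?thesis
    unfolding ball_covers_def by simp
qed

lemma codim1_content_antimono:
  fixes A :: "'a::metric_space set"
  assumes "\<delta> \<le> \<epsilon>"
  shows "codim1_content M \<epsilon> A \<le> codim1_content M \<delta> A"
  unfolding codim1_content_def
proof (intro INF_superset_mono order_refl subsetI)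
  fix B :: "('a \<times> real) set" assume "B \<in> ball_covers \<delta> A"
  with assms show "B \<in> ball_covers \<epsilon> A"
    by (auto simp: ball_covers_def dest!: bspec)
qed

lemma codim1_hausdorff_eq_SUP:
  "codim1_hausdorff M A = (SUP \<delta>\<in>{0<..}. codim1_content M \<delta> A)" (is "_ = ?S")
proof -
  have "((\<lambda>\<delta>. codim1_content M \<delta> A) \<longlongrightarrow> ?S) (at_right 0)"
  proof (rule order_tendstoI)
    fix a assume "a < ?S"
    then obtain \<epsilon> where e: "\<epsilon> > 0" "a < codim1_content M \<epsilon> A"
      by (auto simp: less_SUP_iff)
    have "eventually (\<lambda>\<delta>. \<delta> \<in> {0<..<\<epsilon>}) (at_right (0::real))"
      using e(1) by (simp add: eventually_at_right_field) (use e in blast)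
    then show "eventually (\<lambda>\<delta>. a < codim1_content M \<delta> A) (at_right 0)"
      by eventually_elim (use e codim1_content_antimono[of _ \<epsilon> M A] in \<open>auto intro: less_le_trans\<close>)
  next
    fix a assume a: "?S < a"
    have "eventually (\<lambda>\<delta>. \<delta> \<in> {0<..}) (at_right (0::real))"
      by (auto simp: eventually_at_right_field intro: exI[of _ 1])
    then show "eventually (\<lambda>\<delta>. codim1_content M \<delta> A < a) (at_right 0)"
      by eventually_elim (rule le_less_trans[OF SUP_upper a])
  qed
  then show ?thesis
    unfolding codim1_hausdorff_def by (intro tendsto_Lim) auto
qed

lemma infsum_ennreal_UN_le:
  fixes f :: "'b \<Rightarrow> ennreal"
  shows "infsum f (\<Union>n::nat. B n) \<le> (\<Sum>n. infsum f (B n))"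
proof -
  have "sum f F \<le> (\<Sum>n. infsum f (B n))" if F: "finite F" "F \<subseteq> (\<Union>n. B n)" for F
  proof -
    have "sum f F \<le> (\<Sum>x\<in>F. \<Sum>n. f x * indicator (B n) x)"
    proof (rule sum_mono)
      fix x assume "x \<in> F"
      then obtain m where "x \<in> B m" using F by auto
      then have "f x = (\<Sum>n\<in>{m}. f x * indicator (B n) x)" by simp
      also have "\<dots> \<le> (\<Sum>n. f x * indicator (B n) x)" by (rule sum_le_suminf) auto
      finally show "f x \<le> (\<Sum>n. f x * indicator (B n) x)" .
    qed
    also have "\<dots> = (\<Sum>n. \<Sum>x\<in>F. f x * indicator (B n) x)"
      by (rule suminf_sum[symmetric]) auto
    also have "\<dots> \<le> (\<Sum>n. infsum f (B n))"
    proof (rule suminf_le)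
      fix n
      have "(\<Sum>x\<in>F. f x * indicator (B n) x) = sum f (F \<inter> B n)"
        using F(1) by (simp add: indicator_def sum.inter_restrict if_distrib cong: if_cong)
      also have "\<dots> \<le> infsum f (B n)"
        by (subst nonneg_infsum_complete) (use F(1) in \<open>auto intro!: SUP_upper\<close>)
      finally show "(\<Sum>x\<in>F. f x * indicator (B n) x) \<le> infsum f (B n)" .
    qed auto
    finally show ?thesis .
  qed
  then show ?thesis
    by (subst nonneg_infsum_complete) (auto intro!: SUP_least)
qed

lemma outer_measure_space_codim1_hausdorff:
  "outer_measure_space (Pow S) (codim1_hausdorff M)"
  unfolding outer_measure_space_def
proof (intro conjI)
  have "codim1_content M \<delta> {} = 0" for \<delta>
  proof -
    have "codim1_content M \<delta> {} \<le> 0"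
      unfolding codim1_content_def
      by (rule INF_lower2[of "{}"]) (auto simp: ball_covers_def)
    then show ?thesis by simp
  qed
  then show "positive (Pow S) (codim1_hausdorff M)"
    by (simp add: positive_def codim1_hausdorff_eq_SUP)
  have mono: "codim1_content M \<delta> A \<le> codim1_content M \<delta> A'" if "A \<subseteq> A'" for A A' \<delta>
    unfolding codim1_content_def using that
    by (intro INF_superset_mono) (auto simp: ball_covers_def)
  then show "increasing (Pow S) (codim1_hausdorff M)"
    by (auto simp: increasing_def codim1_hausdorff_eq_SUP intro!: SUP_mono)
  show "countably_subadditive (Pow S) (codim1_hausdorff M)"
    unfolding countably_subadditive_def
  proof (intro allI impI)
    fix A :: "nat \<Rightarrow> 'a set"
    let ?f = "\<lambda>(x, r). emeasure M (ball x r) / ennreal r"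
    have content: "codim1_content M \<delta> (\<Union>n. A n) \<le> (\<Sum>n. codim1_content M \<delta> (A n))" for \<delta>
    proof (cases "\<exists>n. codim1_content M \<delta> (A n) = \<infinity>")
      case True
      then obtain n where "codim1_content M \<delta> (A n) = \<infinity>" by blast
      moreover have "codim1_content M \<delta> (A n) \<le> (\<Sum>n. codim1_content M \<delta> (A n))"
        using sum_le_suminf[of "\<lambda>n. codim1_content M \<delta> (A n)" "{n}"] by simp
      ultimately show ?thesis by (simp add: top_unique)
    next
      case fin: False
      show ?thesis
      proof (rule ennreal_le_epsilon)
        fix e :: real assume e: "0 < e"
        have "\<forall>n. \<exists>B. B \<in> ball_covers \<delta> (A n) \<and>
                infsum ?f B \<le> codim1_content M \<delta> (A n) + ennreal (e * (1/2)^Suc n)"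
        proof
          fix n
          have "0 < ennreal (e * (1/2)^Suc n)"
            using e by (simp only: ennreal_less_zero_iff) simp
          moreover have "codim1_content M \<delta> (A n) \<noteq> \<infinity>"
            using fin by blast
          ultimately have "codim1_content M \<delta> (A n) + 0
              < codim1_content M \<delta> (A n) + ennreal (e * (1/2)^Suc n)"
            by (simp only: ennreal_add_left_cancel_less infinity_ennreal_def) simp
          then have "(INF B\<in>ball_covers \<delta> (A n). infsum ?f B)
              < codim1_content M \<delta> (A n) + ennreal (e * (1/2)^Suc n)"
            by (simp only: codim1_content_def add_0_right)
          then show "\<exists>B. B \<in> ball_covers \<delta> (A n) \<and>
              infsum ?f B \<le> codim1_content M \<delta> (A n) + ennreal (e * (1/2)^Suc n)"
            unfolding INF_less_iff by (blast intro: less_imp_le)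
        qed
        from choice[OF this] obtain B where B: "\<And>n. B n \<in> ball_covers \<delta> (A n)"
          "\<And>n. infsum ?f (B n) \<le> codim1_content M \<delta> (A n) + ennreal (e * (1/2)^Suc n)"
          by blast
        have "(\<Union>n. B n) \<in> ball_covers \<delta> (\<Union>n. A n)"
          using B(1) by (rule ball_covers_UN)
        then have "codim1_content M \<delta> (\<Union>n. A n) \<le> infsum ?f (\<Union>n. B n)"
          unfolding codim1_content_def by (rule INF_lower)
        also have "\<dots> \<le> (\<Sum>n. infsum ?f (B n))" by (rule infsum_ennreal_UN_le)
        also have "\<dots> \<le> (\<Sum>n. codim1_content M \<delta> (A n) + ennreal (e * (1/2)^Suc n))"
          by (intro suminf_le B) auto
        also have "\<dots> = (\<Sum>n. codim1_content M \<delta> (A n)) + (\<Sum>n. ennreal (e * (1/2)^Suc n))"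
          by (intro suminf_add[symmetric]) auto
        also have "(\<Sum>n. ennreal (e * (1/2)^Suc n)) = ennreal e"
          using sums_mult[OF power_half_series, of e] e
          by (intro suminf_ennreal_eq) auto
        finally show "codim1_content M \<delta> (\<Union>n. A n) \<le> (\<Sum>n. codim1_content M \<delta> (A n)) + ennreal e" .
      qed
    qed
    show "codim1_hausdorff M (\<Union>n. A n) \<le> (\<Sum>n. codim1_hausdorff M (A n))"
      unfolding codim1_hausdorff_eq_SUP[of M "\<Union>n. A n"]
    proof (rule SUP_least)
      fix \<delta> :: real assume "\<delta> \<in> {0<..}"
      then have "(\<Sum>n. codim1_content M \<delta> (A n)) \<le> (\<Sum>n. codim1_hausdorff M (A n))"
        by (intro suminf_le) (auto simp: codim1_hausdorff_eq_SUP intro!: SUP_upper)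
      with content show "codim1_content M \<delta> (\<Union>n. A n) \<le> (\<Sum>n. codim1_hausdorff M (A n))"
        by (rule order_trans)
    qed
  qed
qed

lemma
  shows space_codim1_measure: "space (codim1_measure M S) = S"
    and sets_codim1_measure:
      "sets (codim1_measure M S) = lambda_system S (Pow S) (codim1_hausdorff M)"
    and emeasure_codim1_measure:
      "A \<in> lambda_system S (Pow S) (codim1_hausdorff M) \<Longrightarrow>
         emeasure (codim1_measure M S) A = codim1_hausdorff M A"
proof -
  interpret sigma_algebra S "Pow S" by (rule sigma_algebra_Pow)
  have ms: "measure_space S (lambda_system S (Pow S) (codim1_hausdorff M)) (codim1_hausdorff M)"
    by (rule caratheodory_lemma[OF outer_measure_space_codim1_hausdorff])
  then have sa: "sigma_algebra S (lambda_system S (Pow S) (codim1_hausdorff M))"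
    by (simp add: measure_space_def)
  have sub: "lambda_system S (Pow S) (codim1_hausdorff M) \<subseteq> Pow S"
    by (auto simp: lambda_system_def)
  show "space (codim1_measure M S) = S"
    using sub by (simp add: codim1_measure_def)
  show "sets (codim1_measure M S) = lambda_system S (Pow S) (codim1_hausdorff M)"
    using sub sa by (simp add: codim1_measure_def sigma_algebra.sigma_sets_eq)
  show "emeasure (codim1_measure M S) A = codim1_hausdorff M A"
    if "A \<in> lambda_system S (Pow S) (codim1_hausdorff M)"
    using ms sub sa that unfolding codim1_measure_def
    by (intro emeasure_measure_of_sigma) (auto simp: measure_space_def)
qed

definition codim1_ahlfors_regular_boundary :: "'a::metric_space measure \<Rightarrow> 'a set \<Rightarrow> bool" where
  "codim1_ahlfors_regular_boundary M \<Omega> \<longleftrightarrow>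
     (\<exists>C::real. C \<ge> 1 \<and> (\<forall>x\<in>frontier \<Omega>. \<forall>r. 0 < r \<and> r \<le> diameter \<Omega> \<longrightarrow>
        ennreal (1 / C) * (emeasure M (ball x r) / ennreal r)
          \<le> codim1_hausdorff M (ball x r \<inter> frontier \<Omega>) \<and>
        codim1_hausdorff M (ball x r \<inter> frontier \<Omega>)
          \<le> ennreal C * (emeasure M (ball x r) / ennreal r)))"

section \<open>Curves and upper gradients\<close>

definition curve_length :: "(real \<Rightarrow> 'a::metric_space) \<Rightarrow> real \<Rightarrow> real \<Rightarrow> ennreal" where
  "curve_length \<gamma> a b =
     (SUP (t, n)\<in>{(t::nat \<Rightarrow> real, n::nat). mono t \<and> range t \<subseteq> {a..b}}.
        \<Sum>i<n. ennreal (dist (\<gamma> (t i)) (\<gamma> (t (Suc i)))))"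

definition rectifiable_curve_in :: "'a::metric_space set \<Rightarrow> (real \<Rightarrow> 'a) \<Rightarrow> bool" where
  "rectifiable_curve_in U \<gamma> \<longleftrightarrow> path \<gamma> \<and> path_image \<gamma> \<subseteq> U \<and> curve_length \<gamma> 0 1 < \<infinity>"

text \<open>
  The arc-length parametrisation of a rectifiable curve. The length function need not be injective,
  but \<open>\<gamma>\<close> is constant on each of its level sets, so the preimage chosen by \<open>inv_into\<close> is
  irrelevant.
\<close>

definition arclength_param :: "(real \<Rightarrow> 'a::metric_space) \<Rightarrow> real \<Rightarrow> 'a" where
  "arclength_param \<gamma> s = \<gamma> (inv_into {0..1} (\<lambda>t. enn2real (curve_length \<gamma> 0 t)) s)"

definition curve_integral :: "('a::metric_space \<Rightarrow> ennreal) \<Rightarrow> (real \<Rightarrow> 'a) \<Rightarrow> ennreal" where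
  "curve_integral g \<gamma> =
     (\<integral>\<^sup>+s\<in>{0..enn2real (curve_length \<gamma> 0 1)}. g (arclength_param \<gamma> s) \<partial>lborel)"

definition upper_gradient ::
  "'a::metric_space set \<Rightarrow> ('a \<Rightarrow> ennreal) \<Rightarrow> ('a \<Rightarrow> ereal) \<Rightarrow> bool" where
  "upper_gradient U g u \<longleftrightarrow>
     g \<in> borel_measurable (restrict_space borel U) \<and>
     (\<forall>\<gamma>. rectifiable_curve_in U \<gamma> \<longrightarrow>
        (if \<bar>u (pathstart \<gamma>)\<bar> \<noteq> \<infinity> \<and> \<bar>u (pathfinish \<gamma>)\<bar> \<noteq> \<infinity>
         then \<bar>u (pathstart \<gamma>) - u (pathfinish \<gamma>)\<bar> \<le> enn2ereal (curve_integral g \<gamma>)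
         else curve_integral g \<gamma> = \<infinity>))"

section \<open>Functions of bounded variation and traces\<close>

definition upper_gradient_energy ::
  "'a::metric_space measure \<Rightarrow> 'a set \<Rightarrow> ('a \<Rightarrow> ereal) \<Rightarrow> ennreal" where
  "upper_gradient_energy M U u = (INF g\<in>{g. upper_gradient U g u}. \<integral>\<^sup>+x\<in>U. g x \<partial>M)"

definition locally_lipschitz_on :: "'a::metric_space set \<Rightarrow> ('a \<Rightarrow> real) \<Rightarrow> bool" where
  "locally_lipschitz_on U u \<longleftrightarrow> (\<forall>x\<in>U. \<exists>r>0. \<exists>L. L-lipschitz_on (ball x r \<inter> U) u)"

definition L1_norm_on :: "'a measure \<Rightarrow> 'a set \<Rightarrow> ('a \<Rightarrow> real) \<Rightarrow> ennreal" where
  "L1_norm_on M U u = (\<integral>\<^sup>+x\<in>U. ennreal \<bar>u x\<bar> \<partial>M)"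

definition total_variation :: "'a::metric_space measure \<Rightarrow> 'a set \<Rightarrow> ('a \<Rightarrow> real) \<Rightarrow> ennreal" where
  "total_variation M U u =
     (INF v\<in>{v :: nat \<Rightarrow> 'a \<Rightarrow> real.
              (\<forall>i. locally_lipschitz_on U (v i) \<and> set_integrable M U (v i)) \<and>
              (\<lambda>i. L1_norm_on M U (\<lambda>x. v i x - u x)) \<longlonglongrightarrow> 0}.
        liminf (\<lambda>i. upper_gradient_energy M U (\<lambda>x. ereal (v i x))))"

definition BV_norm :: "'a::metric_space measure \<Rightarrow> 'a set \<Rightarrow> ('a \<Rightarrow> real) \<Rightarrow> ennreal" where
  "BV_norm M \<Omega> u = L1_norm_on M \<Omega> u + total_variation M \<Omega> u"

definition BV :: "'a::metric_space measure \<Rightarrow> 'a set \<Rightarrow> ('a \<Rightarrow> real) set" where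
  "BV M \<Omega> = {u. set_integrable M \<Omega> u \<and> BV_norm M \<Omega> u < \<infinity>}"

definition has_trace ::
  "'a::metric_space measure \<Rightarrow> 'a set \<Rightarrow> ('a \<Rightarrow> real) \<Rightarrow> 'a \<Rightarrow> real \<Rightarrow> bool" where
  "has_trace M \<Omega> u z a \<longleftrightarrow>
     Limsup (at_right 0) (\<lambda>r. L1_norm_on M (ball z r \<inter> \<Omega>) (\<lambda>y. u y - a)
                                / emeasure M (ball z r \<inter> \<Omega>)) = 0"

section \<open>Extension operators\<close>

text \<open>
  Elements of \<open>L\<^sup>1(\<partial>\<Omega>)\<close> and \<open>BV(\<Omega>)\<close> are represented by functions. The second condition says that
  \<open>Ext\<close> respects equality almost everywhere, so that it is an operator between the spaces of
  equivalence classes. No linearity is required.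
\<close>

definition bounded_extension_operator ::
  "'a::metric_space measure \<Rightarrow> 'a set \<Rightarrow> (('a \<Rightarrow> real) \<Rightarrow> ('a \<Rightarrow> real)) \<Rightarrow> bool" where
  "bounded_extension_operator M \<Omega> Ext \<longleftrightarrow>
     (\<forall>f. integrable (codim1_measure M (frontier \<Omega>)) f \<longrightarrow> Ext f \<in> BV M \<Omega>) \<and>
     (\<forall>f g. integrable (codim1_measure M (frontier \<Omega>)) f \<longrightarrow>
            integrable (codim1_measure M (frontier \<Omega>)) g \<longrightarrow>
            (AE z in codim1_measure M (frontier \<Omega>). f z = g z) \<longrightarrow>
            (AE y in M. y \<in> \<Omega> \<longrightarrow> Ext f y = Ext g y)) \<and>
     (\<exists>C::real. \<forall>f. integrable (codim1_measure M (frontier \<Omega>)) f \<longrightarrow>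
        BV_norm M \<Omega> (Ext f)
          \<le> ennreal C * L1_norm_on (codim1_measure M (frontier \<Omega>)) (frontier \<Omega>) f)"

end

theory Submission
  imports Defs
begin

text \<open>
  Write \<open>f = \<Sum>k. h k\<close> almost everywhere on the boundary, with bounded Lipschitz functions \<open>h k\<close> on the
  whole space whose \<open>L\<^sup>1\<close> norms decay geometrically, and cut \<open>h k\<close> off at distance \<open>\<rho> k\<close> from the
  boundary. The extension is the sum of the truncated functions. On the strip of width \<open>\<rho>\<close> the
  integral of a Lipschitz function is at most \<open>K * \<rho>\<close> times its integral over the boundary, up to an
  error quadratic in \<open>\<rho>\<close>; this is where codimension one regularity enters, and it cancels the factor
  \<open>1 / \<rho>\<close> in the gradient of the cutoff. All error terms vanish as \<open>\<rho> k\<close> tends to zero, so the radii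
  are chosen recursively, very small.

  The domain may have density zero at boundary points. The trace nevertheless exists because \<open>\<rho> k\<close> is
  chosen after \<open>\<rho> (k - 1)\<close>: the mass of the \<open>k\<close>-th layer is small compared with the infimum over the
  boundary points \<open>z\<close> of the measure of \<open>ball z (\<rho> (k - 1) / 2) \<inter> \<Omega>\<close>, which is positive since the
  boundary is totally bounded.
\<close>

section \<open>Rectifiable curves and upper gradients\<close>

text \<open>The slope of a truncated layer is at most
  \<open>L k + 2 / \<rho> k * \<bar>h k x\<bar>\<close>. The Lipschitz constants \<open>L k\<close>
  of the approximants are beyond control, but they are integrated over a strip of measure about
  \<open>\<rho> k\<close>, so a small radius absorbs them; the second term keeps the size of the
  boundary norm of \<open>h k\<close>. Thus the approximants come from \<open>f\<close> and the
  radii from the approximants, and the construction is not linear in \<open>f\<close>. At a boundary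
  point \<open>z\<close> the scales \<open>r\<close> split into windows from
  \<open>\<rho> (k + 1) / 2\<close> to \<open>\<rho> k / 2\<close>. The layers up to
  \<open>k\<close> are not cut off in the ball and are compared with their values at
  \<open>z\<close>; those from \<open>k + 2\<close> on are small by mass. Layer \<open>k + 1\<close>
  is in transition: its mass is controlled only at scales from \<open>\<rho> k / 2\<close> on, so it
  is bounded pointwise instead, since \<open>h (k + 1) z\<close> tends to zero wherever the series
  converges.\<close>

lemma curve_length_upper:
  assumes "mono t" "range t \<subseteq> {a..b}"
  shows "(\<Sum>i<n. ennreal (dist (\<gamma> (t i)) (\<gamma> (t (Suc i))))) \<le> curve_length \<gamma> a b"
  unfolding curve_length_def by (rule SUP_upper2[of "(t, n)"]) (use assms in auto)

lemma curve_length_ge_dist: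
  assumes "a \<le> b"
  shows "ennreal (dist (\<gamma> a) (\<gamma> b)) \<le> curve_length \<gamma> a b"
proof -
  define t where "t i = (if i = 0 then a else b)" for i :: nat
  have "mono t" "range t \<subseteq> {a..b}"
    using assms by (auto simp: t_def mono_def)
  from curve_length_upper[OF this, of \<gamma> 1] show ?thesis
    by (simp add: t_def)
qed

text \<open>Clamping a partition by \<open>min _ b\<close> and \<open>max _ b\<close> gives
  partitions of the two subarcs. A step that jumps over \<open>b\<close> is split by the triangle
  inequality; any other step survives in one half and is constant in the other.\<close>

lemma curve_length_triangle:
  assumes "a \<le> b" "b \<le> c"
  shows "curve_length \<gamma> a c \<le> curve_length \<gamma> a b + curve_length \<gamma> b c"
  unfolding curve_length_def[of \<gamma> a c]
proof (rule SUP_least, clarify)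
  fix t :: "nat \<Rightarrow> real" and n :: nat
  assume t: "mono t" "range t \<subseteq> {a..c}"
  have "ennreal (dist (\<gamma> (t i)) (\<gamma> (t (Suc i))))
      \<le> ennreal (dist (\<gamma> (min (t i) b)) (\<gamma> (min (t (Suc i)) b)))
        + ennreal (dist (\<gamma> (max (t i) b)) (\<gamma> (max (t (Suc i)) b)))" for i
  proof -
    have "t i \<le> t (Suc i)" using t(1) by (simp add: monoD)
    then have "dist (\<gamma> (t i)) (\<gamma> (t (Suc i)))
      \<le> dist (\<gamma> (min (t i) b)) (\<gamma> (min (t (Suc i)) b))
        + dist (\<gamma> (max (t i) b)) (\<gamma> (max (t (Suc i)) b))"
      by (auto simp: min_def max_def intro: dist_triangle)
    then show ?thesis by (simp flip: ennreal_plus)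
  qed
  then have "(\<Sum>i<n. ennreal (dist (\<gamma> (t i)) (\<gamma> (t (Suc i)))))
     \<le> (\<Sum>i<n. ennreal (dist (\<gamma> (min (t i) b)) (\<gamma> (min (t (Suc i)) b))))
       + (\<Sum>i<n. ennreal (dist (\<gamma> (max (t i) b)) (\<gamma> (max (t (Suc i)) b))))"
    unfolding sum.distrib[symmetric] by (intro sum_mono)
  also have "\<dots> \<le> curve_length \<gamma> a b + curve_length \<gamma> b c"
  proof (intro add_mono)
    have *: "a \<le> t i" "t i \<le> c" for i
      using t(2) by (simp_all add: image_subset_iff)
    show "(\<Sum>i<n. ennreal (dist (\<gamma> (min (t i) b)) (\<gamma> (min (t (Suc i)) b)))) \<le> curve_length \<gamma> a b"
      by (rule curve_length_upper[of "\<lambda>i. min (t i) b"],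
          intro monoI min.mono order_refl monoD[OF t(1)], assumption)
          (use * assms in \<open>auto simp: min_le_iff_disj le_max_iff_disj\<close>)
    show "(\<Sum>i<n. ennreal (dist (\<gamma> (max (t i) b)) (\<gamma> (max (t (Suc i)) b)))) \<le> curve_length \<gamma> b c"
      by (rule curve_length_upper[of "\<lambda>i. max (t i) b"],
          intro monoI max.mono order_refl monoD[OF t(1)], assumption)
          (use * assms in \<open>auto simp: min_le_iff_disj le_max_iff_disj\<close>)
  qed
  finally show "(\<Sum>i<n. ennreal (dist (\<gamma> (t i)) (\<gamma> (t (Suc i)))))
      \<le> curve_length \<gamma> a b + curve_length \<gamma> b c" .
qed

lemma sum_lessThan_add:
  fixes F :: "nat \<Rightarrow> 'b::comm_monoid_add"
  shows "(\<Sum>i<k + m. F i) = (\<Sum>i<k. F i) + (\<Sum>i<m. F (k + i))"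
  by (induction m) (auto simp: ac_simps)

lemma curve_length_superadditive:
  assumes "a \<le> b" "b \<le> c"
  shows "curve_length \<gamma> a b + curve_length \<gamma> b c \<le> curve_length \<gamma> a c"
proof -
  let ?S = "\<lambda>t n. \<Sum>i<n. ennreal (dist (\<gamma> (t i)) (\<gamma> (t (Suc i))))"
  let ?P = "\<lambda>a b. {(t::nat \<Rightarrow> real, n::nat). mono t \<and> range t \<subseteq> {a..b}}"
  have ne: "?P x y \<noteq> {}" if "x \<le> y" for x y
    using that by (auto intro!: exI[of _ "\<lambda>_. x"] simp: mono_def)
  have key: "?S t n + ?S s m \<le> curve_length \<gamma> a c"
    if t: "mono t" "range t \<subseteq> {a..b}" and s: "mono s" "range s \<subseteq> {b..c}" for t s n m
  proof -
    \<comment> \<open>The two partitions are put one after the other; the joining step from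
      \<open>t n\<close> to \<open>s 0\<close> accounts for \<open>Suc n\<close> and can only add to
      the sum.\<close>
    define w where "w i = (if i \<le> n then t i else s (i - Suc n))" for i
    have tb: "a \<le> t i" "t i \<le> b" for i using t(2) by (simp_all add: image_subset_iff)
    have sb: "b \<le> s i" "s i \<le> c" for i using s(2) by (simp_all add: image_subset_iff)
    have "mono w"
      unfolding mono_def
    proof (intro allI impI)
      fix i j :: nat assume "i \<le> j"
      then show "w i \<le> w j"
        using monoD[OF t(1), of i j] monoD[OF s(1), of "i - Suc n" "j - Suc n"]
          order_trans[OF tb(2)[of i] sb(1)[of "j - Suc n"]]
        by (auto simp: w_def)
    qed
    moreover have "range w \<subseteq> {a..c}"
      using order_trans[OF tb(2) assms(2)] order_trans[OF assms(1) sb(1)] tb(1) sb(2)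
      by (auto simp: w_def)
    ultimately have "?S w (Suc n + m) \<le> curve_length \<gamma> a c"
      by (rule curve_length_upper)
    moreover have "?S w (Suc n + m) = ?S w (Suc n) + (\<Sum>i<m. ennreal (dist (\<gamma> (w (Suc n + i))) (\<gamma> (w (Suc (Suc n + i))))))"
      by (rule sum_lessThan_add)
    moreover have "?S t n \<le> ?S w (Suc n)"
    proof -
      have "?S t n = ?S w n" by (intro sum.cong) (auto simp: w_def)
      then show ?thesis by simp
    qed
    moreover have "(\<Sum>i<m. ennreal (dist (\<gamma> (w (Suc n + i))) (\<gamma> (w (Suc (Suc n + i)))))) = ?S s m"
      by (intro sum.cong) (auto simp: w_def)
    ultimately show ?thesis
      by (metis (no_types, lifting) add_right_mono order_trans)
  qed
  have "curve_length \<gamma> a b + curve_length \<gamma> b c =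
     (SUP (t, n)\<in>?P a b. ?S t n + curve_length \<gamma> b c)"
    unfolding curve_length_def[of \<gamma> a b] using ne[OF assms(1)]
    by (subst ennreal_SUP_add_left[symmetric]) (auto simp: case_prod_unfold)
  also have "\<dots> \<le> curve_length \<gamma> a c"
  proof (rule SUP_least, clarify)
    fix t :: "nat \<Rightarrow> real" and n :: nat
    assume t: "mono t" "range t \<subseteq> {a..b}"
    have "?S t n + curve_length \<gamma> b c = (SUP (s, m)\<in>?P b c. ?S t n + ?S s m)"
      unfolding curve_length_def[of \<gamma> b c] using ne[OF assms(2)]
      by (subst ennreal_SUP_add_right) (auto simp: case_prod_unfold)
    also have "\<dots> \<le> curve_length \<gamma> a c"
      by (rule SUP_least) (use key[OF t] in auto)
    finally show "?S t n + curve_length \<gamma> b c \<le> curve_length \<gamma> a c" .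
  qed
  finally show ?thesis .
qed

lemma curve_length_add:
  assumes "a \<le> b" "b \<le> c"
  shows "curve_length \<gamma> a c = curve_length \<gamma> a b + curve_length \<gamma> b c"
  using curve_length_triangle[OF assms] curve_length_superadditive[OF assms] by (rule antisym)

lemma curve_length_mono:
  assumes "a \<le> a'" "a' \<le> b'" "b' \<le> b"
  shows "curve_length \<gamma> a' b' \<le> curve_length \<gamma> a b"
  by (subst curve_length_add[of a a' b], use assms in simp, use assms in simp,
      subst curve_length_add[of a' b' b])
    (use assms in \<open>auto intro: add_increasing add_increasing2\<close>)

text \<open>
  A partition that nearly exhausts the total length nearly exhausts the length of every subarc;
  on a short subarc it has few steps, each of them short by uniform continuity.
\<close>

lemma curve_length_uniformly_small:
  assumes "path \<gamma>" "curve_length \<gamma> 0 1 < \<infinity>" "0 < e"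
  shows "\<exists>d>0. \<forall>a b. 0 \<le> a \<and> a \<le> b \<and> b \<le> 1 \<and> b - a < d \<longrightarrow> curve_length \<gamma> a b \<le> ennreal e"
proof -
  let ?S = "\<lambda>t n. \<Sum>i<n. ennreal (dist (\<gamma> (t i)) (\<gamma> (t (Suc i))))"
  let ?P = "{(t::nat \<Rightarrow> real, n::nat). mono t \<and> range t \<subseteq> {0..1}}"
  have "?P \<noteq> {}"
    by (auto intro!: exI[of _ "\<lambda>_. 0"] simp: mono_def)
  moreover have "(SUP (t, n)\<in>?P. ?S t n) \<noteq> \<infinity>"
    using assms(2) unfolding curve_length_def by (rule less_imp_neq)
  ultimately have "\<exists>p\<in>?P. (SUP (t, n)\<in>?P. ?S t n) < (case p of (t, n) \<Rightarrow> ?S t n) + ennreal (e / 2)"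
    using SUP_approx_ennreal[OF half_gt_zero[OF assms(3)], of ?P _ "\<lambda>(t, n). ?S t n", OF _ refl]
    by blast
  then obtain t n where t: "mono t" "range t \<subseteq> {0..1}"
    and tn: "curve_length \<gamma> 0 1 < ?S t n + ennreal (e / 2)"
    unfolding curve_length_def by auto
  have "uniformly_continuous_on {0..1} \<gamma>"
    using assms(1) by (auto simp: path_def intro!: compact_uniformly_continuous)
  moreover have "0 < e / 2 / (real n + 1)"
    using assms(3) by simp
  ultimately obtain d where d: "d > 0"
    "\<And>x y. x \<in> {0..1} \<Longrightarrow> y \<in> {0..1} \<Longrightarrow> dist x y < d \<Longrightarrow> dist (\<gamma> x) (\<gamma> y) < e / 2 / (real n + 1)"
    unfolding uniformly_continuous_on_def by meson
  have "curve_length \<gamma> a b \<le> ennreal e" if ab: "0 \<le> a" "a \<le> b" "b \<le> 1" "b - a < d" for a b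
  proof -
    \<comment> \<open>\<open>c\<close> clamps to \<open>[a, b]\<close>. Each step of
      \<open>t\<close> splits into its parts before \<open>a\<close>, inside, and after
      \<open>b\<close>; only the inner part is estimated by uniform continuity.\<close>
    define c where "c x = min (max x a) b" for x
    have tb: "0 \<le> t i" "t i \<le> 1" for i using t(2) by (simp_all add: image_subset_iff)
    have "ennreal (dist (\<gamma> (t i)) (\<gamma> (t (Suc i))))
      \<le> ennreal (dist (\<gamma> (min (t i) a)) (\<gamma> (min (t (Suc i)) a)))
        + ennreal (e / 2 / (real n + 1))
        + ennreal (dist (\<gamma> (max (t i) b)) (\<gamma> (max (t (Suc i)) b)))" for i
    proof -
      have le: "t i \<le> t (Suc i)" using t(1) by (simp add: monoD)
      have "dist (\<gamma> (t i)) (\<gamma> (t (Suc i)))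
        \<le> dist (\<gamma> (min (t i) a)) (\<gamma> (min (t (Suc i)) a)) + dist (\<gamma> (max (t i) a)) (\<gamma> (max (t (Suc i)) a))"
        using le by (auto simp: min_def max_def intro: dist_triangle)
      also have "dist (\<gamma> (max (t i) a)) (\<gamma> (max (t (Suc i)) a))
        \<le> dist (\<gamma> (c (t i))) (\<gamma> (c (t (Suc i)))) + dist (\<gamma> (max (t i) b)) (\<gamma> (max (t (Suc i)) b))"
        using le ab by (auto simp: min_def max_def c_def intro: dist_triangle)
      also have "dist (\<gamma> (c (t i))) (\<gamma> (c (t (Suc i)))) \<le> e / 2 / (real n + 1)"
        using ab by (intro less_imp_le d(2)) (auto simp: c_def dist_real_def)
      finally show ?thesis
        using assms(3) by (simp add: add.assoc flip: ennreal_plus)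
    qed
    then have "?S t n \<le> (\<Sum>i<n. ennreal (dist (\<gamma> (min (t i) a)) (\<gamma> (min (t (Suc i)) a))))
        + (\<Sum>i<n. ennreal (e / 2 / (real n + 1)))
        + (\<Sum>i<n. ennreal (dist (\<gamma> (max (t i) b)) (\<gamma> (max (t (Suc i)) b))))"
      unfolding sum.distrib[symmetric] by (intro sum_mono)
    also have "\<dots> \<le> curve_length \<gamma> 0 a + ennreal (e / 2) + curve_length \<gamma> b 1"
    proof (intro add_mono)
      show "(\<Sum>i<n. ennreal (dist (\<gamma> (min (t i) a)) (\<gamma> (min (t (Suc i)) a)))) \<le> curve_length \<gamma> 0 a"
        by (rule curve_length_upper[of "\<lambda>i. min (t i) a"],
          intro monoI min.mono order_refl monoD[OF t(1)], assumption)
          (use tb ab in \<open>auto simp: min_le_iff_disj le_max_iff_disj\<close>)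
      show "(\<Sum>i<n. ennreal (dist (\<gamma> (max (t i) b)) (\<gamma> (max (t (Suc i)) b)))) \<le> curve_length \<gamma> b 1"
        by (rule curve_length_upper[of "\<lambda>i. max (t i) b"],
          intro monoI max.mono order_refl monoD[OF t(1)], assumption)
          (use tb ab in \<open>auto simp: min_le_iff_disj le_max_iff_disj\<close>)
      have "(\<Sum>i<n. ennreal (e / 2 / (real n + 1))) = ennreal (real n * (e / 2 / (real n + 1)))"
        using assms(3) by (simp add: ennreal_of_nat_eq_real_of_nat flip: ennreal_mult)
      also have "\<dots> \<le> ennreal (e / 2)"
        using assms(3) by (intro ennreal_leI) (simp add: field_simps)
      finally show "(\<Sum>i<n. ennreal (e / 2 / (real n + 1))) \<le> ennreal (e / 2)" .
    qed
    \<comment> \<open>All lengths are finite, so those of the outer arcs cancel and the two halves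
      of \<open>e\<close> remain.\<close>
    finally have "curve_length \<gamma> 0 1 \<le> curve_length \<gamma> 0 a + ennreal (e / 2) + curve_length \<gamma> b 1 + ennreal (e / 2)"
      using tn by (meson add_right_mono less_imp_le order_trans)
    moreover have "curve_length \<gamma> 0 1 = curve_length \<gamma> 0 a + curve_length \<gamma> a b + curve_length \<gamma> b 1"
      using ab curve_length_add[of 0 a 1 \<gamma>] curve_length_add[of a b 1 \<gamma>] by (simp add: add.assoc)
    moreover from this assms(2) have "curve_length \<gamma> 0 a < \<infinity>" "curve_length \<gamma> a b < \<infinity>" "curve_length \<gamma> b 1 < \<infinity>"
      by (auto simp: top_unique less_top)
    ultimately show ?thesis
      using assms(3)
      by (cases "curve_length \<gamma> 0 a"; cases "curve_length \<gamma> a b"; cases "curve_length \<gamma> b 1")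
        (auto simp flip: ennreal_plus)
  qed
  with d(1) show ?thesis by blast
qed

text \<open>Short parameter intervals carry little length, so the length function is continuous and
  the intermediate value theorem gives every value in \<open>{0..l}\<close> a preimage. Since
  \<gamma> moves by at most the increment of length, the choice of the preimage does not matter and
  the parametrisation is 1-Lipschitz.\<close>

lemma
  assumes "rectifiable_curve_in U \<gamma>"
  defines "l \<equiv> enn2real (curve_length \<gamma> 0 1)"
  shows arclength_param_dist_le:
      "\<And>s t. 0 \<le> s \<Longrightarrow> s \<le> t \<Longrightarrow> t \<le> l \<Longrightarrow> dist (arclength_param \<gamma> s) (arclength_param \<gamma> t) \<le> t - s"
    and arclength_param_0: "arclength_param \<gamma> 0 = pathstart \<gamma>"
    and arclength_param_length: "arclength_param \<gamma> l = pathfinish \<gamma>"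
proof -
  have p: "path \<gamma>" and fin: "curve_length \<gamma> 0 1 < \<infinity>"
    using assms by (auto simp: rectifiable_curve_in_def)
  define L where "L t = enn2real (curve_length \<gamma> 0 t)" for t
  have fin': "curve_length \<gamma> a b < \<infinity>" if "0 \<le> a" "a \<le> b" "b \<le> 1" for a b
    using curve_length_mono[of 0 a b 1 \<gamma>] that fin by (auto simp: le_less_trans)
  have L_diff: "curve_length \<gamma> a b = ennreal (L b - L a)" "L a \<le> L b" if "0 \<le> a" "a \<le> b" "b \<le> 1" for a b
    using curve_length_add[of 0 a b \<gamma>] that fin'[of 0 a] fin'[of 0 b] fin'[of a b] unfolding L_def
    by (cases "curve_length \<gamma> 0 a"; cases "curve_length \<gamma> 0 b"; cases "curve_length \<gamma> a b";
        auto simp flip: ennreal_plus)+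
  have dist_L: "dist (\<gamma> a) (\<gamma> b) \<le> L b - L a" if "0 \<le> a" "a \<le> b" "b \<le> 1" for a b
    using curve_length_ge_dist[of a b \<gamma>] L_diff[OF that] that by simp
  have dist_L': "dist (\<gamma> a) (\<gamma> b) \<le> \<bar>L b - L a\<bar>" if "a \<in> {0..1}" "b \<in> {0..1}" for a b
    using dist_L[of a b] dist_L[of b a] that by (cases "a \<le> b") (auto simp: dist_commute)
  have cont: "continuous_on {0..1} L"
    unfolding continuous_on_iff
  proof (intro ballI allI impI)
    fix x e :: real assume "x \<in> {0..1}" and e: "0 < e"
    obtain d where d: "d > 0"
      "\<And>a b. 0 \<le> a \<Longrightarrow> a \<le> b \<Longrightarrow> b \<le> 1 \<Longrightarrow> b - a < d \<Longrightarrow> curve_length \<gamma> a b \<le> ennreal (e / 2)"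
      using curve_length_uniformly_small[OF p fin, of "e / 2"] e by auto
    have *: "\<bar>L b - L a\<bar> < e" if "0 \<le> a" "a \<le> b" "b \<le> 1" "b - a < d" for a b
      using d(2)[OF that] L_diff[of a b] that e by auto
    have "dist (L y) (L x) < e" if "y \<in> {0..1}" "dist y x < d" for y
      using *[of x y] *[of y x] that \<open>x \<in> {0..1}\<close>
      by (cases "x \<le> y") (auto simp: dist_real_def abs_minus_commute)
    with d(1) show "\<exists>d>0. \<forall>x'\<in>{0..1}. dist x' x < d \<longrightarrow> dist (L x') (L x) < e" by blast
  qed
  \<comment> \<open>Additivity makes this length equal to its own double, and it is finite.\<close>
  have L0: "L 0 = 0"
  proof -
    have "curve_length \<gamma> 0 0 + curve_length \<gamma> 0 0 = curve_length \<gamma> 0 0"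
      using curve_length_add[of 0 0 0 \<gamma>] by simp
    then show ?thesis unfolding L_def
      using fin'[of 0 0] by (cases "curve_length \<gamma> 0 0") (auto simp flip: ennreal_plus)
  qed
  have L1: "L 1 = l" by (simp add: L_def l_def)
  have img: "s \<in> L ` {0..1}" if "0 \<le> s" "s \<le> l" for s
    using IVT'[of L 0 s 1] that L0 L1 cont by auto
  define T where "T = inv_into {0..1} L"
  have T: "T s \<in> {0..1}" "L (T s) = s" if "0 \<le> s" "s \<le> l" for s
    using inv_into_into[OF img[OF that]] f_inv_into_f[OF img[OF that]] by (simp_all add: T_def)
  have ap: "arclength_param \<gamma> s = \<gamma> (T s)" for s
    unfolding arclength_param_def T_def L_def ..
  have l0: "0 \<le> l" by (simp add: l_def)
  show "dist (arclength_param \<gamma> s) (arclength_param \<gamma> t) \<le> t - s" if "0 \<le> s" "s \<le> t" "t \<le> l" for s t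
    using dist_L'[of "T s" "T t"] T[of s] T[of t] that by (auto simp: ap)
  show "arclength_param \<gamma> 0 = pathstart \<gamma>"
    using dist_L'[of "T 0" 0] T[of 0] L0 l0 by (auto simp: ap pathstart_def)
  show "arclength_param \<gamma> l = pathfinish \<gamma>"
    using dist_L'[of "T l" 1] T[of l] L1 l0 by (auto simp: ap pathfinish_def)
qed

text \<open>
  Since the slope bound only compares \<open>y\<close> with a fixed \<open>x\<close>, the inequality along a curve is
  obtained from Bolzano's bisection principle, up to an error proportional to the length.
\<close>

lemma upper_gradient_continuousI:
  fixes u g :: "'a::metric_space \<Rightarrow> real"
  assumes cont: "continuous_on UNIV g" and nonneg: "\<And>x. 0 \<le> g x"
    and slope: "\<And>x. eventually (\<lambda>y. \<bar>u y - u x\<bar> \<le> g x * dist y x) (nhds x)"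
  shows "upper_gradient U (\<lambda>x. ennreal (g x)) (\<lambda>x. ereal (u x))"
  unfolding upper_gradient_def
proof (intro conjI allI impI)
  have [measurable]: "g \<in> borel_measurable borel"
    using cont by (rule borel_measurable_continuous_onI)
  show "(\<lambda>x. ennreal (g x)) \<in> borel_measurable (restrict_space borel U)"
    by (intro measurable_restrict_space1) measurable
  fix \<gamma> :: "real \<Rightarrow> 'a" assume \<gamma>: "rectifiable_curve_in U \<gamma>"
  define l where "l = enn2real (curve_length \<gamma> 0 1)"
  have l0: "0 \<le> l" by (simp add: l_def)
  \<comment> \<open>Constant continuation beyond \<open>{0..l}\<close> gives a 1-Lipschitz map on
    the whole line.\<close>
  define c where "c s = arclength_param \<gamma> (min (max s 0) l)" for s
  have c_lip: "dist (c s) (c t) \<le> \<bar>t - s\<bar>" for s t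
  proof -
    have *: "dist (c s) (c t) \<le> t - s" if "s \<le> t" for s t
    proof -
      have "dist (c s) (c t) \<le> min (max t 0) l - min (max s 0) l"
        unfolding c_def using that l0
        by (intro arclength_param_dist_le[OF \<gamma>, folded l_def]) auto
      also have "\<dots> \<le> t - s" using that by (auto simp: min_def max_def)
      finally show ?thesis .
    qed
    show ?thesis using *[of s t] *[of t s] by (cases "s \<le> t") (auto simp: dist_commute)
  qed
  have c_cont: "continuous_on UNIV c"
    unfolding continuous_on_iff
    using c_lip by (metis dist_commute dist_real_def le_less_trans)
  have gc_cont: "continuous_on UNIV (\<lambda>s. g (c s))"
    using continuous_on_compose2[OF cont c_cont] by simp
  then have gc[measurable]: "(\<lambda>s. g (c s)) \<in> borel_measurable borel"
    by (rule borel_measurable_continuous_onI)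
  let ?I = "\<lambda>a b. \<integral>\<^sup>+s\<in>{a..b}. ennreal (g (c s)) \<partial>lborel"
  have I_add: "?I a b + ?I b d = ?I a d" if "a \<le> b" "b \<le> d" for a b d
  proof -
    have "AE s in lborel. s \<noteq> b"
      by (rule AE_lborel_singleton)
    then have "AE s in lborel. ennreal (g (c s)) * indicator {a..d} s
        = ennreal (g (c s)) * indicator {a..b} s + ennreal (g (c s)) * indicator {b..d} s"
      by eventually_elim (use that in \<open>auto simp: indicator_def\<close>)
    then have "?I a d = (\<integral>\<^sup>+s. ennreal (g (c s)) * indicator {a..b} s + ennreal (g (c s)) * indicator {b..d} s \<partial>lborel)"
      by (rule nn_integral_cong_AE)
    also have "\<dots> = ?I a b + ?I b d"
      by (rule nn_integral_add) auto
    finally show ?thesis ..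
  qed
  \<comment> \<open>The error has to be additive over adjacent intervals, like
    \<open>e * (b - a)\<close>, for the bisection to preserve the estimate.\<close>
  have main: "ennreal \<bar>u (c l) - u (c 0)\<bar> \<le> ?I 0 l + ennreal (e * (l - 0))" if e: "0 < e" for e
    using l0
  proof (induction rule: Bolzano[where P="\<lambda>a b. ennreal \<bar>u (c b) - u (c a)\<bar> \<le> ?I a b + ennreal (e * (b - a))"])
    case (trans a b d)
    have "ennreal \<bar>u (c d) - u (c a)\<bar> \<le> ennreal \<bar>u (c b) - u (c a)\<bar> + ennreal \<bar>u (c d) - u (c b)\<bar>"
      by (simp flip: ennreal_plus)
    also have "\<dots> \<le> (?I a b + ennreal (e * (b - a))) + (?I b d + ennreal (e * (d - b)))"
      by (intro add_mono trans)
    also have "\<dots> = ?I a d + ennreal (e * (d - a))"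
      using trans e I_add[of a b d, symmetric]
      by (simp add: algebra_simps flip: ennreal_plus)
    finally show ?case .
  next
    case (local x)
    obtain r where r: "0 < r" "\<And>y. dist y (c x) < r \<Longrightarrow> \<bar>u y - u (c x)\<bar> \<le> g (c x) * dist y (c x)"
      using slope[of "c x"] unfolding eventually_nhds_metric by blast
    obtain r' where r': "0 < r'" "\<And>s. dist s x < r' \<Longrightarrow> dist (g (c s)) (g (c x)) < e"
      using gc_cont e unfolding continuous_on_iff by blast
    \<comment> \<open>The slope bound is available only at \<open>x\<close>, so an interval around
      \<open>x\<close> is cut there; both halves have \<open>x\<close> as an end point and are
      treated at once.\<close>
    have half: "ennreal \<bar>u (c t) - u (c x)\<bar> \<le> ?I a b + ennreal (e * (b - a))"
      if ab: "a \<le> b" "t \<in> {a, b}" "x \<in> {a, b}" "b - a < min r r'" for a b t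
    proof -
      have d: "dist (c t) (c x) \<le> b - a" using c_lip[of t x] ab by auto
      then have "\<bar>u (c t) - u (c x)\<bar> \<le> g (c x) * dist (c t) (c x)"
        using ab by (intro r) auto
      also have "\<dots> \<le> g (c x) * (b - a)" using d nonneg by (intro mult_left_mono) auto
      finally have "ennreal \<bar>u (c t) - u (c x)\<bar> \<le> ennreal (g (c x)) * ennreal (b - a)"
        using nonneg ab(1) by (simp flip: ennreal_mult)
      also have "\<dots> = (\<integral>\<^sup>+s\<in>{a..b}. ennreal (g (c x)) \<partial>lborel)"
        using ab(1) by (simp add: nn_integral_cmult_indicator)
      also have "\<dots> \<le> (\<integral>\<^sup>+s. ennreal (g (c s)) * indicator {a..b} s + ennreal e * indicator {a..b} s \<partial>lborel)"
      proof (intro nn_integral_mono)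
        fix s
        show "ennreal (g (c x)) * indicator {a..b} s \<le> ennreal (g (c s)) * indicator {a..b} s + ennreal e * indicator {a..b} s"
        proof (cases "s \<in> {a..b}")
          case True
          then have "dist s x < r'" using ab by (auto simp: dist_real_def)
          from r'(2)[OF this] have "g (c x) \<le> g (c s) + e" by (auto simp: dist_real_def)
          then show ?thesis using True nonneg e by (simp flip: ennreal_plus)
        qed simp
      qed
      also have "\<dots> = ?I a b + ennreal e * ennreal (b - a)"
        using ab(1) by (subst nn_integral_add) (auto simp: nn_integral_cmult_indicator)
      finally show ?thesis using e ab(1) by (simp flip: ennreal_mult)
    qed
    show ?case
    proof (intro exI[of _ "min r r'"] conjI allI impI)
      fix a b assume ab: "a \<le> x \<and> x \<le> b \<and> b - a < min r r'"
      have "ennreal \<bar>u (c b) - u (c a)\<bar> \<le> ennreal \<bar>u (c a) - u (c x)\<bar> + ennreal \<bar>u (c b) - u (c x)\<bar>"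
        by (simp flip: ennreal_plus)
      also have "\<dots> \<le> (?I a x + ennreal (e * (x - a))) + (?I x b + ennreal (e * (b - x)))"
        using ab by (intro add_mono half) auto
      also have "\<dots> = ?I a b + ennreal (e * (b - a))"
        using ab e I_add[of a x b, symmetric]
        by (simp add: algebra_simps flip: ennreal_plus)
      finally show "ennreal \<bar>u (c b) - u (c a)\<bar> \<le> ?I a b + ennreal (e * (b - a))" .
    qed (use r r' in auto)
  qed
  have "ennreal \<bar>u (c l) - u (c 0)\<bar> \<le> ?I 0 l"
  proof (rule ennreal_le_epsilon)
    fix e :: real assume e: "0 < e"
    \<comment> \<open>Dividing by \<open>l + 1\<close> instead of \<open>l\<close> also covers a
      curve of length zero.\<close>
    have "ennreal \<bar>u (c l) - u (c 0)\<bar> \<le> ?I 0 l + ennreal (e / (l + 1) * (l - 0))"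
      using e l0 by (intro main) auto
    also have "\<dots> \<le> ?I 0 l + ennreal e"
      using e l0 by (intro add_left_mono ennreal_leI) (simp add: field_simps)
    finally show "ennreal \<bar>u (c l) - u (c 0)\<bar> \<le> ?I 0 l + ennreal e" .
  qed
  moreover have "?I 0 l = curve_integral (\<lambda>x. ennreal (g x)) \<gamma>"
    unfolding curve_integral_def l_def[symmetric]
    by (intro nn_integral_cong) (auto simp: c_def indicator_def)
  moreover have "c 0 = pathstart \<gamma>" "c l = pathfinish \<gamma>"
    using arclength_param_0[OF \<gamma>] arclength_param_length[OF \<gamma>, folded l_def] l0
    by (auto simp: c_def)
  ultimately have "ennreal \<bar>u (pathstart \<gamma>) - u (pathfinish \<gamma>)\<bar> \<le> curve_integral (\<lambda>x. ennreal (g x)) \<gamma>"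
    by (simp add: abs_minus_commute)
  then show "if \<bar>ereal (u (pathstart \<gamma>))\<bar> \<noteq> \<infinity> \<and> \<bar>ereal (u (pathfinish \<gamma>))\<bar> \<noteq> \<infinity>
     then \<bar>ereal (u (pathstart \<gamma>)) - ereal (u (pathfinish \<gamma>))\<bar> \<le> enn2ereal (curve_integral (\<lambda>x. ennreal (g x)) \<gamma>)
     else curve_integral (\<lambda>x. ennreal (g x)) \<gamma> = \<infinity>"
    by (simp add: less_eq_ennreal.rep_eq)
qed

section \<open>Borel sets and the codimension one Hausdorff measure\<close>

lemma codim1_hausdorff_mono: "A \<subseteq> B \<Longrightarrow> codim1_hausdorff M A \<le> codim1_hausdorff M B"
  using outer_measure_space_codim1_hausdorff[of UNIV M]
  by (auto simp: outer_measure_space_def increasing_def)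

text \<open>\<open>countably_subadditive\<close> speaks only of disjoint sequences, hence the detour
  through \<open>disjointed\<close>.\<close>

lemma codim1_hausdorff_UN_le:
  "codim1_hausdorff M (\<Union>n::nat. A n) \<le> (\<Sum>n. codim1_hausdorff M (A n))"
proof -
  have "codim1_hausdorff M (\<Union>n. disjointed A n) \<le> (\<Sum>n. codim1_hausdorff M (disjointed A n))"
    using outer_measure_space_codim1_hausdorff[of UNIV M]
    unfolding outer_measure_space_def countably_subadditive_def
    by (elim conjE allE[of _ "disjointed A"]) (simp add: disjoint_family_disjointed)
  also have "\<dots> \<le> (\<Sum>n. codim1_hausdorff M (A n))"
    by (intro suminf_le codim1_hausdorff_mono disjointed_subset) auto
  finally show ?thesis by (simp add: UN_disjointed_eq)
qed

lemma codim1_hausdorff_empty [simp]: "codim1_hausdorff M {} = 0"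
  using outer_measure_space_codim1_hausdorff[of UNIV M]
  by (auto simp: outer_measure_space_def positive_def)

lemma codim1_hausdorff_Un_le:
  "codim1_hausdorff M (A \<union> B) \<le> codim1_hausdorff M A + codim1_hausdorff M B"
proof -
  let ?C = "\<lambda>n::nat. if n = 0 then A else if n = 1 then B else {}"
  have "A \<union> B = (\<Union>n. ?C n)" by (auto split: if_splits)
  then have "codim1_hausdorff M (A \<union> B) \<le> (\<Sum>n. codim1_hausdorff M (?C n))"
    using codim1_hausdorff_UN_le[of M ?C] by simp
  also have "\<dots> = (\<Sum>n\<in>{0, 1}. codim1_hausdorff M (?C n))"
    by (rule suminf_finite) auto
  finally show ?thesis by simp
qed

text \<open>A ball of radius below \<delta> cannot meet both sets, so a cover of the union contains
  two disjoint families that cover \<open>A\<close> and \<open>B\<close>.\<close>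

lemma codim1_content_separated:
  assumes "\<And>x y. x \<in> A \<Longrightarrow> y \<in> B \<Longrightarrow> 2 * \<delta> \<le> dist x y"
  shows "codim1_content M \<delta> A + codim1_content M \<delta> B \<le> codim1_content M \<delta> (A \<union> B)"
  unfolding codim1_content_def[of M \<delta> "A \<union> B"]
proof (rule INF_greatest)
  let ?f = "\<lambda>(x, r). emeasure M (ball x r) / ennreal r"
  fix C assume C: "C \<in> ball_covers \<delta> (A \<union> B)"
  define C' where "C' S = {p \<in> C. ball (fst p) (snd p) \<inter> S \<noteq> {}}" for S
  have sub: "C' S \<subseteq> C" for S by (auto simp: C'_def)
  have cov: "C' S \<in> ball_covers \<delta> S" if "S \<subseteq> A \<union> B" for S
  proof -
    have "countable (C' S)"
      using C sub by (auto simp: ball_covers_def intro: countable_subset)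
    moreover have "\<forall>(x, r)\<in>C' S. 0 < r \<and> r < \<delta>"
      using C sub[of S] by (auto simp: ball_covers_def)
    moreover have "S \<subseteq> (\<Union>(x, r)\<in>C' S. ball x r)"
    proof
      fix y assume y: "y \<in> S"
      then have "y \<in> (\<Union>(x, r)\<in>C. ball x r)"
        using C that unfolding ball_covers_def by blast
      then obtain x r where "(x, r) \<in> C" "y \<in> ball x r" by auto
      with y have "(x, r) \<in> C' S" unfolding C'_def by auto
      with \<open>y \<in> ball x r\<close> show "y \<in> (\<Union>(x, r)\<in>C' S. ball x r)" by blast
    qed
    ultimately show ?thesis by (simp add: ball_covers_def)
  qed
  have disj: "C' A \<inter> C' B = {}"
  proof (rule ccontr)
    assume "C' A \<inter> C' B \<noteq> {}"
    then obtain x r a b where *: "(x, r) \<in> C" "dist x a < r" "dist x b < r" "a \<in> A" "b \<in> B"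
      by (auto simp: C'_def)
    have "r < \<delta>" using * C by (auto simp: ball_covers_def)
    moreover have "dist a b \<le> dist x a + dist x b" by (rule dist_triangle3)
    ultimately show False using assms[of a b] * by linarith
  qed
  have "codim1_content M \<delta> A + codim1_content M \<delta> B \<le> infsum ?f (C' A) + infsum ?f (C' B)"
    unfolding codim1_content_def by (intro add_mono INF_lower cov) auto
  also have "\<dots> = infsum ?f (C' A \<union> C' B)"
    using disj by (intro infsum_Un_disjoint[symmetric] nonneg_summable_on_complete) auto
  also have "\<dots> \<le> infsum ?f C"
    using sub by (intro infsum_mono_neutral nonneg_summable_on_complete) auto
  finally show "codim1_content M \<delta> A + codim1_content M \<delta> B \<le> infsum ?f C" .
qed

text \<open>The contents increase as \<delta> decreases, so their suprema can be added along a
  common scale, and scales of at most \<open>d / 2\<close> suffice.\<close>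

lemma codim1_hausdorff_separated:
  assumes "0 < d" "\<And>x y. x \<in> A \<Longrightarrow> y \<in> B \<Longrightarrow> d \<le> dist x y"
  shows "codim1_hausdorff M A + codim1_hausdorff M B \<le> codim1_hausdorff M (A \<union> B)"
proof -
  have anti: "codim1_content M \<delta> S \<le> codim1_content M (min \<delta> \<epsilon>) S"
    "codim1_content M \<delta> S \<le> codim1_content M (min \<epsilon> \<delta>) S" for \<delta> \<epsilon> S
    by (auto intro: codim1_content_antimono)
  have "codim1_hausdorff M A + codim1_hausdorff M B
      = (SUP \<delta>\<in>{0<..}. codim1_content M \<delta> A + codim1_content M \<delta> B)"
    unfolding codim1_hausdorff_eq_SUP
  proof (rule SUP_add_directed_ennreal[symmetric])
    fix \<delta> \<epsilon> :: real assume "\<delta> \<in> {0<..}" "\<epsilon> \<in> {0<..}"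
    then show "\<exists>k\<in>{0<..}. codim1_content M \<delta> A + codim1_content M \<epsilon> B \<le> codim1_content M k A + codim1_content M k B"
      by (intro bexI[of _ "min \<delta> \<epsilon>"] add_mono anti) auto
  qed
  also have "\<dots> \<le> codim1_hausdorff M (A \<union> B)"
  proof (rule SUP_least)
    fix \<delta> :: real assume \<delta>: "\<delta> \<in> {0<..}"
    have "codim1_content M \<delta> A + codim1_content M \<delta> B
        \<le> codim1_content M (min \<delta> (d / 2)) A + codim1_content M (min \<delta> (d / 2)) B"
      by (intro add_mono anti)
    also have "\<dots> \<le> codim1_content M (min \<delta> (d / 2)) (A \<union> B)"
      by (intro codim1_content_separated order_trans[OF _ assms(2)]) auto
    also have "\<dots> \<le> codim1_hausdorff M (A \<union> B)"
      unfolding codim1_hausdorff_eq_SUP using \<delta> assms(1) by (intro SUP_upper) auto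
    finally show "codim1_content M \<delta> A + codim1_content M \<delta> B \<le> codim1_hausdorff M (A \<union> B)" .
  qed
  finally show ?thesis .
qed

text \<open>
  Caratheodory's criterion: away from \<open>F\<close>, cut \<open>A\<close> into shells by the distance to \<open>F\<close>. Shells of
  indices of the same parity are pairwise separated, so the measures of the shells are summable.
\<close>

lemma codim1_hausdorff_closed_split:
  assumes F: "closed F" and A: "codim1_hausdorff M A < \<infinity>"
  shows "codim1_hausdorff M (A \<inter> F) + codim1_hausdorff M (A - F) \<le> codim1_hausdorff M A"
proof (cases "F = {}")
  case True
  then show ?thesis by simp
next
  case ne: False
  let ?H = "codim1_hausdorff M"
  define E where "E n = {x \<in> A. 1 / (real n + 1) \<le> infdist x F}" for n
  define R where "R n = E (Suc n) - E n" for n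
  have E_mono: "E m \<subseteq> E n" if "m \<le> n" for m n
  proof -
    have "1 / (real n + 1) \<le> 1 / (real m + 1)" using that by (simp add: frac_le)
    then show ?thesis by (auto simp: E_def)
  qed
  have RA: "R n \<subseteq> A" for n by (auto simp: R_def E_def)
  have parity: "(\<Sum>k<n. ?H (R (2 * k + c))) \<le> ?H (\<Union>k<n. R (2 * k + c))" for n c
  proof (induction n)
    case (Suc n)
    \<comment> \<open>Points of \<open>R (2 * n + c)\<close> lie outside
      \<open>E (2 * n + c)\<close>, those of earlier shells of the same parity inside
      \<open>E (2 * n + c - 1)\<close>; this gap in the index leaves the positive distance
      \<open>?d\<close>. For \<open>n = 0\<close> there are no earlier shells.\<close>
    let ?d = "1 / (2 * real n + real c) - 1 / (2 * real n + real c + 1)"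
    have "(\<Sum>k<Suc n. ?H (R (2 * k + c))) \<le> ?H (\<Union>k<n. R (2 * k + c)) + ?H (R (2 * n + c))"
      using Suc by (simp add: add_right_mono)
    also have "\<dots> \<le> ?H ((\<Union>k<n. R (2 * k + c)) \<union> R (2 * n + c))"
    proof (cases "n = 0")
      case False
      show ?thesis
      proof (rule codim1_hausdorff_separated[of ?d])
        show "0 < ?d"
          using False frac_less2[of 1 1 "2 * real n + real c" "2 * real n + real c + 1"] by simp
        fix x y assume x: "x \<in> (\<Union>k<n. R (2 * k + c))" and y: "y \<in> R (2 * n + c)"
        from x obtain k where k: "k < n" "x \<in> E (Suc (2 * k + c))" by (auto simp: R_def)
        have "Suc (2 * k + c) \<le> 2 * n + c - 1" using k(1) by linarith
        with k(2) have "x \<in> E (2 * n + c - 1)" using E_mono by blast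
        then have "1 / (2 * real n + real c) \<le> infdist x F"
          using False by (auto simp: E_def of_nat_diff)
        moreover have "infdist y F < 1 / (2 * real n + real c + 1)"
          using y by (auto simp: R_def E_def)
        moreover have "infdist x F \<le> infdist y F + dist x y" by (rule infdist_triangle)
        ultimately show "?d \<le> dist x y" by linarith
      qed
    qed simp
    also have "(\<Union>k<n. R (2 * k + c)) \<union> R (2 * n + c) = (\<Union>k<Suc n. R (2 * k + c))"
      by (auto simp: less_Suc_eq)
    finally show ?case .
  qed simp
  have even_odd: "(\<Sum>k<2 * n. ?H (R k)) = (\<Sum>k<n. ?H (R (2 * k + 0))) + (\<Sum>k<n. ?H (R (2 * k + 1)))" for n
    by (induction n) (auto simp: ac_simps)
  have sum_le: "(\<Sum>k<n. ?H (R k)) \<le> ?H A + ?H A" for n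
  proof -
    have "(\<Sum>k<n. ?H (R k)) \<le> (\<Sum>k<2 * n. ?H (R k))" by (rule sum_mono2) auto
    also have "\<dots> \<le> ?H (\<Union>k<n. R (2 * k + 0)) + ?H (\<Union>k<n. R (2 * k + 1))"
      unfolding even_odd by (intro add_mono parity)
    also have "\<dots> \<le> ?H A + ?H A"
      using RA by (intro add_mono codim1_hausdorff_mono) auto
    finally show ?thesis .
  qed
  define r where "r k = enn2real (?H (R k))" for k
  have r: "?H (R k) = ennreal (r k)" for k
    using codim1_hausdorff_mono[OF RA[of k], of M] A unfolding r_def by (auto simp: top_unique)
  have r0: "0 \<le> r k" for k by (simp add: r_def)
  have "summable r"
  proof (rule summableI_nonneg_bounded)
    show "(\<Sum>k<n. r k) \<le> enn2real (?H A + ?H A)" for n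
      using sum_le[of n] A by (cases "?H A") (auto simp: r r0 sum_nonneg simp flip: ennreal_plus)
  qed (rule r0)
  have tail: "?H (A \<inter> F) + ?H (A - F) \<le> ?H A + ennreal (\<Sum>k. r (k + n))" for n
  proof -
    \<comment> \<open>Since \<open>F\<close> is closed, a point outside it has positive distance to
      \<open>F\<close>, hence a least index \<open>j\<close> with the point in \<open>E j\<close>.
      Unless \<open>j \<le> n\<close>, it lies in the shell \<open>R (j - 1)\<close>.\<close>
    have "A - F \<subseteq> E n \<union> (\<Union>k. R (k + n))"
    proof
      fix x assume x: "x \<in> A - F"
      then have "infdist x F > 0" using F ne in_closed_iff_infdist_zero[of F x] infdist_nonneg[of x F] by auto
      then obtain m where "1 / (real m + 1) < infdist x F"
        using reals_Archimedean[of "infdist x F"] by (auto simp: inverse_eq_divide add.commute)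
      then have xm: "x \<in> E m" using x by (auto simp: E_def)
      show "x \<in> E n \<union> (\<Union>k. R (k + n))"
      proof (cases "x \<in> E n")
        case False
        define j where "j = (LEAST j. x \<in> E j)"
        have j: "x \<in> E j" unfolding j_def using xm by (rule LeastI)
        have "n < j" using j False E_mono[of j n] by (cases "j \<le> n") auto
        then obtain i where i: "j = Suc (i + n)" by (metis add.commute less_iff_Suc_add)
        then have "x \<notin> E (i + n)" unfolding j_def by (metis lessI not_less_Least)
        then have "x \<in> R (i + n)" using j i by (auto simp: R_def)
        then show ?thesis by blast
      qed simp
    qed
    then have "?H (A - F) \<le> ?H (E n \<union> (\<Union>k. R (k + n)))" by (rule codim1_hausdorff_mono)
    also have "\<dots> \<le> ?H (E n) + ?H (\<Union>k. R (k + n))" by (rule codim1_hausdorff_Un_le)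
    also have "?H (\<Union>k. R (k + n)) \<le> (\<Sum>k. ?H (R (k + n)))" by (rule codim1_hausdorff_UN_le)
    also have "\<dots> = ennreal (\<Sum>k. r (k + n))"
      unfolding r using \<open>summable r\<close> r0 by (intro suminf_ennreal2) auto
    finally have "?H (A \<inter> F) + ?H (A - F) \<le> ?H (A \<inter> F) + ?H (E n) + ennreal (\<Sum>k. r (k + n))"
      by (simp add: add.assoc add_left_mono)
    also have "?H (A \<inter> F) + ?H (E n) \<le> ?H (A \<inter> F \<union> E n)"
    proof (rule codim1_hausdorff_separated[of "1 / (real n + 1)"])
      fix x y assume "x \<in> A \<inter> F" "y \<in> E n"
      then show "1 / (real n + 1) \<le> dist x y"
        using infdist_le[of x F y] by (auto simp: E_def dist_commute)
    qed simp
    also have "\<dots> \<le> ?H A" by (intro codim1_hausdorff_mono) (auto simp: E_def)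
    finally show ?thesis by (simp add: add_right_mono)
  qed
  show ?thesis
  proof (rule ennreal_le_epsilon)
    fix e :: real assume "0 < e"
    then obtain n where "norm (\<Sum>k. r (k + n)) < e"
      using suminf_exist_split[OF _ \<open>summable r\<close>] by blast
    then have "ennreal (\<Sum>k. r (k + n)) \<le> ennreal e" by (intro ennreal_leI) auto
    then show "?H (A \<inter> F) + ?H (A - F) \<le> ?H A + ennreal e"
      using tail[of n] by (meson add_left_mono order_trans)
  qed
qed

section \<open>Borel sets in the sigma-algebra of the boundary measure\<close>

lemma closed_Int_in_sets_codim1_measure:
  assumes "closed F"
  shows "F \<inter> S \<in> sets (codim1_measure M S)"
  unfolding sets_codim1_measure lambda_system_def
proof (intro CollectI conjI ballI)
  fix A assume "A \<in> Pow S"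
  then have *: "F \<inter> S \<inter> A = A \<inter> F" "(S - F \<inter> S) \<inter> A = A - F" by auto
  have "codim1_hausdorff M (A \<inter> F) + codim1_hausdorff M (A - F) = codim1_hausdorff M A"
  proof (rule antisym)
    show "codim1_hausdorff M (A \<inter> F) + codim1_hausdorff M (A - F) \<le> codim1_hausdorff M A"
      using codim1_hausdorff_closed_split[OF assms, of M A]
      by (cases "codim1_hausdorff M A = \<infinity>") (auto simp: less_top)
    show "codim1_hausdorff M A \<le> codim1_hausdorff M (A \<inter> F) + codim1_hausdorff M (A - F)"
      using codim1_hausdorff_Un_le[of M "A \<inter> F" "A - F"] by (simp add: Int_Diff_Un)
  qed
  then show "codim1_hausdorff M (F \<inter> S \<inter> A) + codim1_hausdorff M ((S - F \<inter> S) \<inter> A) = codim1_hausdorff M A"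
    unfolding * .
qed simp

text \<open>Stated for the inclusion map, because composing with it makes every Borel set and every
  Borel function on the space measurable for the boundary measure.\<close>

lemma measurable_ident_codim1_measure [measurable]:
  "(\<lambda>x. x) \<in> borel_measurable (codim1_measure M S)"
proof (rule borel_measurableI)
  fix U :: "'a set" assume "open U"
  then have "- U \<inter> S \<in> sets (codim1_measure M S)"
    by (intro closed_Int_in_sets_codim1_measure) auto
  then have "space (codim1_measure M S) - (- U \<inter> S) \<in> sets (codim1_measure M S)"
    by (rule sets.compl_sets)
  moreover have "space (codim1_measure M S) - (- U \<inter> S) = (\<lambda>x. x) -` U \<inter> space (codim1_measure M S)"
    by (auto simp: space_codim1_measure)
  ultimately show "(\<lambda>x. x) -` U \<inter> space (codim1_measure M S) \<in> sets (codim1_measure M S)"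
    by simp
qed

lemma borel_Int_in_sets_codim1_measure:
  assumes "B \<in> sets borel"
  shows "B \<inter> S \<in> sets (codim1_measure M S)"
  using measurable_sets[OF measurable_ident_codim1_measure assms, of M S]
  by (simp add: space_codim1_measure)

text \<open>Almost optimal covers at scales tending to zero have open unions. Each of them still
  covers the intersection of all these unions, so the intersection has no larger measure.\<close>

lemma codim1_hausdorff_borel_hull:
  assumes A: "codim1_hausdorff M A < \<infinity>"
  shows "\<exists>B\<in>sets borel. A \<subseteq> B \<and> codim1_hausdorff M B = codim1_hausdorff M A"
proof -
  let ?f = "\<lambda>(x, r). emeasure M (ball x r) / ennreal r"
  have ex: "\<forall>n::nat. \<exists>C. C \<in> ball_covers (1 / (real n + 1)) A \<and> infsum ?f C < codim1_hausdorff M A + ennreal (1 / (real n + 1))"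
  proof
    fix n :: nat
    have le: "codim1_content M (1 / (real n + 1)) A \<le> codim1_hausdorff M A"
      unfolding codim1_hausdorff_eq_SUP by (intro SUP_upper) auto
    have "codim1_hausdorff M A < codim1_hausdorff M A + ennreal (1 / (real n + 1))"
      using A ennreal_add_left_cancel_less[of "codim1_hausdorff M A" 0 "ennreal (1 / (real n + 1))"] by auto
    with le have "codim1_content M (1 / (real n + 1)) A < codim1_hausdorff M A + ennreal (1 / (real n + 1))"
      by (rule le_less_trans)
    then show "\<exists>C. C \<in> ball_covers (1 / (real n + 1)) A \<and> infsum ?f C < codim1_hausdorff M A + ennreal (1 / (real n + 1))"
      unfolding codim1_content_def INF_less_iff by blast
  qed
  from choice[OF ex] obtain C where C: "\<And>n. C n \<in> ball_covers (1 / (real n + 1)) A"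
    "\<And>n. infsum ?f (C n) < codim1_hausdorff M A + ennreal (1 / (real n + 1))" by blast
  define G where "G n = (\<Union>(x, r)\<in>C n. ball x r)" for n
  have "open (G n)" for n by (auto simp: G_def)
  then have "(\<Inter>n. G n) \<in> sets borel" by (intro sets.countable_INT) auto
  moreover have "A \<subseteq> (\<Inter>n. G n)"
    using C(1) unfolding ball_covers_def G_def by blast
  moreover have "codim1_hausdorff M (\<Inter>n. G n) \<le> codim1_hausdorff M A"
    unfolding codim1_hausdorff_eq_SUP[of M "\<Inter>n. G n"]
  proof (rule SUP_least, rule ennreal_le_epsilon)
    fix \<delta> e :: real assume "\<delta> \<in> {0<..}" "0 < e"
    then obtain n where n: "1 / (real n + 1) < min \<delta> e"
      using reals_Archimedean[of "min \<delta> e"] by (auto simp: inverse_eq_divide add.commute)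
    have "C n \<in> ball_covers \<delta> (\<Inter>n. G n)"
      using C(1)[of n] n unfolding ball_covers_def G_def by fastforce
    then have "codim1_content M \<delta> (\<Inter>n. G n) \<le> infsum ?f (C n)"
      unfolding codim1_content_def by (rule INF_lower)
    also have "\<dots> \<le> codim1_hausdorff M A + ennreal (1 / (real n + 1))"
      using C(2)[of n] by (rule less_imp_le)
    also have "\<dots> \<le> codim1_hausdorff M A + ennreal e"
      using n by (intro add_left_mono ennreal_leI) auto
    finally show "codim1_content M \<delta> (\<Inter>n. G n) \<le> codim1_hausdorff M A + ennreal e" .
  qed
  ultimately show ?thesis
    using codim1_hausdorff_mono[of A "\<Inter>n. G n" M] by (blast intro: antisym)
qed

section \<open>Density of Lipschitz functions\<close>

text \<open>The functions live on the whole space, so that the same one can be integrated over the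
  boundary and over the domain; boundedness gives products and integrability for finite
  measures.\<close>

definition bounded_lipschitz :: "('a::metric_space \<Rightarrow> real) \<Rightarrow> bool" where
  "bounded_lipschitz f \<longleftrightarrow> (\<exists>L. L-lipschitz_on UNIV f) \<and> (\<exists>C. \<forall>x. \<bar>f x\<bar> \<le> C)"

section \<open>Sums, products and cutoffs of bounded Lipschitz functions\<close>

lemma bounded_lipschitz_const: "bounded_lipschitz (\<lambda>x. c)"
  by (auto simp: bounded_lipschitz_def lipschitz_on_def)

lemma bounded_lipschitz_add:
  assumes "bounded_lipschitz f" "bounded_lipschitz g"
  shows "bounded_lipschitz (\<lambda>x. f x + g x)"
proof -
  obtain L K C D where "L-lipschitz_on UNIV f" "K-lipschitz_on UNIV g"
    and b: "\<And>x. \<bar>f x\<bar> \<le> C" "\<And>x. \<bar>g x\<bar> \<le> D"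
    using assms by (auto simp: bounded_lipschitz_def)
  then have "(L + K)-lipschitz_on UNIV (\<lambda>x. f x + g x)" by (intro lipschitz_on_add)
  moreover have "\<bar>f x + g x\<bar> \<le> C + D" for x using b[of x] by linarith
  ultimately show ?thesis unfolding bounded_lipschitz_def by blast
qed

lemma bounded_lipschitz_cmult:
  assumes "bounded_lipschitz f"
  shows "bounded_lipschitz (\<lambda>x. c * f x)"
proof -
  obtain L C where "L-lipschitz_on UNIV f" and b: "\<And>x. \<bar>f x\<bar> \<le> C"
    using assms by (auto simp: bounded_lipschitz_def)
  then have "(\<bar>c\<bar> * L)-lipschitz_on UNIV (\<lambda>x. c * f x)" by (intro lipschitz_on_cmult_real)
  moreover have "\<bar>c * f x\<bar> \<le> \<bar>c\<bar> * C" for x using b[of x] by (simp add: abs_mult mult_left_mono)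
  ultimately show ?thesis unfolding bounded_lipschitz_def by blast
qed

lemma bounded_lipschitz_diff:
  assumes "bounded_lipschitz f" "bounded_lipschitz g"
  shows "bounded_lipschitz (\<lambda>x. f x - g x)"
  using bounded_lipschitz_add[OF assms(1) bounded_lipschitz_cmult[OF assms(2), of "-1"]] by simp

lemma bounded_lipschitz_mult:
  assumes "bounded_lipschitz f" "bounded_lipschitz g"
  shows "bounded_lipschitz (\<lambda>x. f x * g x)"
proof -
  obtain L K C D where L: "L-lipschitz_on UNIV f" "K-lipschitz_on UNIV g"
    and b: "\<And>x. \<bar>f x\<bar> \<le> C" "\<And>x. \<bar>g x\<bar> \<le> D"
    using assms by (auto simp: bounded_lipschitz_def)
  have nn: "0 \<le> L" "0 \<le> K" "0 \<le> C" "0 \<le> D"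
    using L lipschitz_on_nonneg b order_trans[OF abs_ge_zero] by blast+
  have "(C * K + D * L)-lipschitz_on UNIV (\<lambda>x. f x * g x)"
  proof (rule lipschitz_onI)
    fix x y
    have d: "\<bar>f x - f y\<bar> \<le> L * dist x y" "\<bar>g x - g y\<bar> \<le> K * dist x y"
      using lipschitz_onD[OF L(1), of x y] lipschitz_onD[OF L(2), of x y] by (auto simp: dist_real_def)
    have "\<bar>f x * g x - f y * g y\<bar> = \<bar>f x * (g x - g y) + g y * (f x - f y)\<bar>"
      by (simp add: algebra_simps)
    also have "\<dots> \<le> \<bar>f x\<bar> * \<bar>g x - g y\<bar> + \<bar>g y\<bar> * \<bar>f x - f y\<bar>"
      by (metis abs_mult abs_triangle_ineq)
    also have "\<dots> \<le> C * (K * dist x y) + D * (L * dist x y)"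
      using b d nn by (intro add_mono mult_mono) auto
    finally show "dist (f x * g x) (f y * g y) \<le> (C * K + D * L) * dist x y"
      by (simp add: dist_real_def algebra_simps)
  qed (use nn in simp)
  moreover have "\<bar>f x * g x\<bar> \<le> C * D" for x
    using b[of x] nn by (auto simp: abs_mult intro: mult_mono)
  ultimately show ?thesis unfolding bounded_lipschitz_def by blast
qed

lemma bounded_lipschitz_continuous: "bounded_lipschitz f \<Longrightarrow> continuous_on UNIV f"
  by (auto simp: bounded_lipschitz_def intro: lipschitz_on_continuous_on)

text \<open>Used with \<open>a = 1\<close> and \<open>c\<close> tending to infinity to approximate
  the indicator of a closed set, and with \<open>a = 2\<close> and \<open>c = 2 / \<rho>\<close> to
  cut off a layer.\<close>

lemma bounded_lipschitz_cutoff: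
  assumes "0 \<le> c"
  shows "c-lipschitz_on UNIV (\<lambda>x. max 0 (min 1 (a - c * infdist x F)))"
    and "bounded_lipschitz (\<lambda>x. max 0 (min 1 (a - c * infdist x F)))"
proof -
  show L: "c-lipschitz_on UNIV (\<lambda>x. max 0 (min 1 (a - c * infdist x F)))"
  proof (rule lipschitz_onI[OF _ assms])
    fix x y :: 'a
    have "\<bar>infdist x F - infdist y F\<bar> \<le> dist x y"
      using infdist_triangle[of x F y] infdist_triangle[of y F x] by (auto simp: dist_commute)
    then have "\<bar>(a - c * infdist x F) - (a - c * infdist y F)\<bar> \<le> c * dist x y"
      using mult_left_mono[OF _ assms, of "\<bar>infdist y F - infdist x F\<bar>" "dist x y"]
      by (simp add: abs_mult assms abs_minus_commute flip: right_diff_distrib)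
    moreover have "\<bar>max 0 (min 1 s) - max 0 (min 1 t)\<bar> \<le> \<bar>s - t\<bar>" for s t :: real
      by (auto simp: max_def min_def)
    ultimately show "dist (max 0 (min 1 (a - c * infdist x F))) (max 0 (min 1 (a - c * infdist y F))) \<le> c * dist x y"
      unfolding dist_real_def by (meson order_trans)
  qed
  have "\<bar>max 0 (min 1 (a - c * infdist x F))\<bar> \<le> 1" for x by (auto simp: max_def min_def)
  with L show "bounded_lipschitz (\<lambda>x. max 0 (min 1 (a - c * infdist x F)))"
    unfolding bounded_lipschitz_def by blast
qed

text \<open>The product is split so that the factors in front of the differences are
  \<open>\<psi> y\<close>, which is bounded by 1, and \<open>h x\<close> at the fixed point. Hence
  the slope contains \<open>\<bar>h x\<bar>\<close> and not a supremum of \<open>h\<close>, and its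
  integral can be compared with the L1 norm of \<open>h\<close>.\<close>

lemma lipschitz_product_slope:
  fixes \<psi> h :: "'a::metric_space \<Rightarrow> real"
  assumes \<psi>: "c-lipschitz_on UNIV \<psi>" "\<And>x. \<bar>\<psi> x\<bar> \<le> 1" and h: "L-lipschitz_on UNIV h"
  shows "\<bar>\<psi> y * h y - \<psi> x * h x\<bar> \<le> (L + c * \<bar>h x\<bar>) * dist y x"
proof -
  have "\<bar>\<psi> y * h y - \<psi> x * h x\<bar> = \<bar>\<psi> y * (h y - h x) + h x * (\<psi> y - \<psi> x)\<bar>"
    by (simp add: algebra_simps)
  also have "\<dots> \<le> \<bar>\<psi> y\<bar> * \<bar>h y - h x\<bar> + \<bar>h x\<bar> * \<bar>\<psi> y - \<psi> x\<bar>"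
    by (metis abs_mult abs_triangle_ineq)
  also have "\<dots> \<le> 1 * (L * dist y x) + \<bar>h x\<bar> * (c * dist y x)"
    using lipschitz_onD[OF \<psi>(1), of y x] lipschitz_onD[OF h, of y x] \<psi>(2)[of y]
    by (intro add_mono mult_mono) (simp_all add: dist_real_def)
  finally show ?thesis by (simp add: algebra_simps)
qed

text \<open>The space of \<open>N\<close> may be a subset of the type and its sigma-algebra may
  exceed the Borel sets, as for the boundary measure, which lives on the Caratheodory measurable
  subsets of the boundary.\<close>

locale metric_finite_measure = finite_measure N
  for N :: "'a::metric_space measure" +
  assumes ident_measurable [measurable]: "(\<lambda>x. x) \<in> borel_measurable N"
begin

section \<open>Lipschitz approximation in L1 of a finite measure\<close>

lemma continuous_measurable: "continuous_on UNIV f \<Longrightarrow> f \<in> borel_measurable N"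
  for f :: "'a \<Rightarrow> real"
  using measurable_compose[OF ident_measurable borel_measurable_continuous_onI] by blast

lemma bounded_lipschitz_integrable:
  assumes "bounded_lipschitz f" shows "integrable N f"
proof -
  obtain C where "\<And>x. \<bar>f x\<bar> \<le> C" using assms by (auto simp: bounded_lipschitz_def)
  then show ?thesis
    using assms bounded_lipschitz_continuous continuous_measurable
    by (intro integrable_const_bound[of _ C]) auto
qed

definition lipschitz_approximable :: "('a \<Rightarrow> real) \<Rightarrow> bool" where
  "lipschitz_approximable f \<longleftrightarrow> integrable N f \<and>
     (\<forall>e>0. \<exists>\<phi>. bounded_lipschitz \<phi> \<and> (\<integral>x. \<bar>f x - \<phi> x\<bar> \<partial>N) < e)"

lemma lipschitz_approximable_bounded_lipschitz:
  "bounded_lipschitz f \<Longrightarrow> lipschitz_approximable f"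
  by (auto simp: lipschitz_approximable_def bounded_lipschitz_integrable intro!: exI[of _ f])

lemma lipschitz_approximable_close:
  assumes f: "integrable N f"
    and close: "\<And>e. 0 < e \<Longrightarrow> \<exists>g. lipschitz_approximable g \<and> (\<integral>x. \<bar>f x - g x\<bar> \<partial>N) < e"
  shows "lipschitz_approximable f"
  unfolding lipschitz_approximable_def
proof (intro conjI allI impI f)
  fix e :: real assume "0 < e"
  then obtain g where g: "lipschitz_approximable g" "(\<integral>x. \<bar>f x - g x\<bar> \<partial>N) < e / 2"
    using close[of "e / 2"] by auto
  then obtain \<phi> where \<phi>: "bounded_lipschitz \<phi>" "(\<integral>x. \<bar>g x - \<phi> x\<bar> \<partial>N) < e / 2"
    using \<open>0 < e\<close> by (auto simp: lipschitz_approximable_def dest: spec[of _ "e / 2"])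
  have i: "integrable N g" "integrable N \<phi>"
    using g \<phi> by (auto simp: lipschitz_approximable_def bounded_lipschitz_integrable)
  have "(\<integral>x. \<bar>f x - \<phi> x\<bar> \<partial>N) \<le> (\<integral>x. \<bar>f x - g x\<bar> + \<bar>g x - \<phi> x\<bar> \<partial>N)"
    using f i by (intro integral_mono) auto
  also have "\<dots> < e" using g \<phi> f i by simp
  finally show "\<exists>\<phi>. bounded_lipschitz \<phi> \<and> (\<integral>x. \<bar>f x - \<phi> x\<bar> \<partial>N) < e"
    using \<phi>(1) by blast
qed

lemma lipschitz_approximable_add:
  assumes "lipschitz_approximable f" "lipschitz_approximable g"
  shows "lipschitz_approximable (\<lambda>x. f x + g x)"
  unfolding lipschitz_approximable_def
proof (intro conjI allI impI)
  have i: "integrable N f" "integrable N g" using assms by (auto simp: lipschitz_approximable_def)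
  then show "integrable N (\<lambda>x. f x + g x)" by simp
  fix e :: real assume "0 < e"
  then have "0 < e / 2" by simp
  then obtain \<phi> \<psi> where \<phi>: "bounded_lipschitz \<phi>" "(\<integral>x. \<bar>f x - \<phi> x\<bar> \<partial>N) < e / 2"
    and \<psi>: "bounded_lipschitz \<psi>" "(\<integral>x. \<bar>g x - \<psi> x\<bar> \<partial>N) < e / 2"
    using assms unfolding lipschitz_approximable_def by meson
  have j: "integrable N \<phi>" "integrable N \<psi>"
    using \<phi> \<psi> by (auto simp: bounded_lipschitz_integrable)
  have "(\<integral>x. \<bar>(f x + g x) - (\<phi> x + \<psi> x)\<bar> \<partial>N) \<le> (\<integral>x. \<bar>f x - \<phi> x\<bar> + \<bar>g x - \<psi> x\<bar> \<partial>N)"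
    using i j by (intro integral_mono) auto
  also have "\<dots> < e" using \<phi> \<psi> i j by simp
  finally show "\<exists>\<phi>. bounded_lipschitz \<phi> \<and> (\<integral>x. \<bar>f x + g x - \<phi> x\<bar> \<partial>N) < e"
    using bounded_lipschitz_add[OF \<phi>(1) \<psi>(1)] by blast
qed

lemma lipschitz_approximable_cmult:
  assumes "lipschitz_approximable f"
  shows "lipschitz_approximable (\<lambda>x. c * f x)"
  unfolding lipschitz_approximable_def
proof (intro conjI allI impI)
  have i: "integrable N f" using assms by (auto simp: lipschitz_approximable_def)
  then show "integrable N (\<lambda>x. c * f x)" by simp
  fix e :: real assume e: "0 < e"
  then have "0 < e / (\<bar>c\<bar> + 1)" by simp
  then obtain \<phi> where \<phi>: "bounded_lipschitz \<phi>" "(\<integral>x. \<bar>f x - \<phi> x\<bar> \<partial>N) < e / (\<bar>c\<bar> + 1)"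
    using assms unfolding lipschitz_approximable_def by meson
  have "(\<integral>x. \<bar>c * f x - c * \<phi> x\<bar> \<partial>N) = \<bar>c\<bar> * (\<integral>x. \<bar>f x - \<phi> x\<bar> \<partial>N)"
    by (simp add: abs_mult flip: right_diff_distrib)
  also have "\<dots> \<le> \<bar>c\<bar> * (e / (\<bar>c\<bar> + 1))"
    using \<phi>(2) by (intro mult_left_mono) auto
  also have "\<dots> < e" using e by (simp add: field_simps)
  finally show "\<exists>\<phi>. bounded_lipschitz \<phi> \<and> (\<integral>x. \<bar>c * f x - \<phi> x\<bar> \<partial>N) < e"
    using bounded_lipschitz_cmult[OF \<phi>(1)] by blast
qed

text \<open>Serves three limits: cutoffs tending to the indicator of a closed set, countable
  disjoint unions, and the limit case of the induction over integrable functions.\<close>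

lemma lipschitz_approximable_dominated_limit:
  fixes w :: "'a \<Rightarrow> real"
  assumes s: "\<And>i. lipschitz_approximable (s i)" and w: "integrable N w"
    and f: "f \<in> borel_measurable N"
    and lim: "\<And>x. x \<in> space N \<Longrightarrow> (\<lambda>i. s i x) \<longlonglongrightarrow> f x"
    and bound: "\<And>i x. x \<in> space N \<Longrightarrow> \<bar>s i x\<bar> \<le> w x"
  shows "lipschitz_approximable f"
proof -
  have si[measurable]: "integrable N (s i)" for i using s by (auto simp: lipschitz_approximable_def)
  have fw: "\<bar>f x\<bar> \<le> w x" if "x \<in> space N" for x
    using tendsto_rabs[OF lim[OF that]] bound[OF that] by (intro LIMSEQ_le_const2) auto
  have fi: "integrable N f"
    by (rule Bochner_Integration.integrable_bound[OF w f]) (use fw in \<open>auto intro!: AE_I2 order_trans[OF _ abs_ge_self]\<close>)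
  have "(\<lambda>i. \<integral>x. \<bar>f x - s i x\<bar> \<partial>N) \<longlonglongrightarrow> (\<integral>x. 0 \<partial>N)"
  proof (rule integral_dominated_convergence[where w="\<lambda>x. 2 * w x"])
    show "AE x in N. (\<lambda>i. \<bar>f x - s i x\<bar>) \<longlonglongrightarrow> 0"
    proof (rule AE_I2)
      fix x assume "x \<in> space N"
      from tendsto_rabs[OF tendsto_diff[OF tendsto_const lim[OF this], of "f x"]]
      show "(\<lambda>i. \<bar>f x - s i x\<bar>) \<longlonglongrightarrow> 0" by simp
    qed
    show "AE x in N. norm \<bar>f x - s i x\<bar> \<le> 2 * w x" for i
    proof (rule AE_I2)
      fix x assume "x \<in> space N"
      then show "norm \<bar>f x - s i x\<bar> \<le> 2 * w x"
        using fw[of x] bound[of x i] by simp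
    qed
  qed (use f si w in auto)
  then have to0: "(\<lambda>i. \<integral>x. \<bar>f x - s i x\<bar> \<partial>N) \<longlonglongrightarrow> 0" by simp
  show ?thesis
  proof (rule lipschitz_approximable_close[OF fi])
    fix e :: real assume "0 < e"
    then obtain i where "(\<integral>x. \<bar>f x - s i x\<bar> \<partial>N) < e"
      using order_tendstoD(2)[OF to0] by (auto simp: eventually_sequentially)
    with s show "\<exists>g. lipschitz_approximable g \<and> (\<integral>x. \<bar>f x - g x\<bar> \<partial>N) < e" by blast
  qed
qed

lemma borel_indicator_measurable:
  "B \<in> sets borel \<Longrightarrow> (indicator B :: 'a \<Rightarrow> real) \<in> borel_measurable N"
  using measurable_compose[OF ident_measurable borel_measurable_indicator] by blast

lemma lipschitz_approximable_closed:
  assumes "closed F" shows "lipschitz_approximable (indicator F)"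
\<comment> \<open>\<open>infdist x {}\<close> is 0 by convention, so the cutoffs below would tend to
  1 instead of the indicator.\<close>
proof (cases "F = {}")
  case True
  then show ?thesis
    using lipschitz_approximable_bounded_lipschitz[OF bounded_lipschitz_const[of 0]]
    by (simp add: indicator_def[abs_def])
next
  case False
  show ?thesis
  proof (rule lipschitz_approximable_dominated_limit[where w="\<lambda>_. 1"])
    show "lipschitz_approximable (\<lambda>x. max 0 (min 1 (1 - real n * infdist x F)))" for n
      by (intro lipschitz_approximable_bounded_lipschitz bounded_lipschitz_cutoff) auto
    show "(\<lambda>n. max 0 (min 1 (1 - real n * infdist x F))) \<longlonglongrightarrow> indicator F x" for x
    proof (cases "x \<in> F")
      case True
      then show ?thesis by (simp add: infdist_zero)
    next
      case x: False
      then have pos: "infdist x F > 0"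
        using in_closed_iff_infdist_zero[OF assms False] infdist_nonneg[of x F] by (metis less_eq_real_def)
      obtain k where k: "1 < real k * infdist x F"
        using reals_Archimedean3[OF pos] by blast
      have "\<forall>\<^sub>F n in sequentially. max 0 (min 1 (1 - real n * infdist x F)) = indicator F x"
        using eventually_ge_at_top[of k]
      proof eventually_elim
        case (elim n)
        then have "real k * infdist x F \<le> real n * infdist x F" using pos by (intro mult_right_mono) auto
        then show ?case using k x by auto
      qed
      then show ?thesis by (rule tendsto_eventually)
    qed
  qed (use assms in \<open>auto intro: borel_indicator_measurable\<close>)
qed

text \<open>Closed sets are stable under intersection, so an induction over complements and disjoint
  unions reaches all Borel sets.\<close>

lemma lipschitz_approximable_borel:
  assumes "B \<in> sets borel" shows "lipschitz_approximable (indicator B)"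
proof -
  have stable: "Int_stable (Collect closed :: 'a set set)" by (auto simp: Int_stable_def)
  have B: "B \<in> sigma_sets UNIV (Collect closed)"
    using assms by (simp add: borel_eq_closed)
  have borel: "A \<in> sets borel" if "A \<in> sigma_sets UNIV (Collect closed)" for A :: "'a set"
    using that by (simp add: borel_eq_closed)
  have "Collect closed \<subseteq> Pow (UNIV :: 'a set)" by simp
  from stable this B show ?thesis
  proof (induction rule: sigma_sets_induct_disjoint)
    case (compl A)
    have "lipschitz_approximable (\<lambda>x. 1 + (-1) * indicator A x)"
      by (intro lipschitz_approximable_add lipschitz_approximable_cmult compl
        lipschitz_approximable_bounded_lipschitz bounded_lipschitz_const)
    moreover have "(\<lambda>x. 1 + (-1) * indicator A x) = (indicator (UNIV - A) :: 'a \<Rightarrow> real)"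
      by (auto simp: indicator_def)
    ultimately show ?case by simp
  next
    case (union A)
    show ?case
    proof (rule lipschitz_approximable_dominated_limit[where w="\<lambda>_. 1"])
      show "lipschitz_approximable (\<lambda>x. \<Sum>i<n. indicator (A i) x)" for n
      proof (induction n)
        case (Suc n)
        then show ?case using lipschitz_approximable_add[OF Suc union(3)[of n]] by simp
      qed (simp add: lipschitz_approximable_bounded_lipschitz bounded_lipschitz_const)
      have eq: "(\<Sum>i<n. indicator (A i) x :: real) = indicator (\<Union>i<n. A i) x" for n x
        using union(1) by (subst indicator_UN_disjoint) (auto simp: disjoint_family_on_def)
      show "(\<lambda>n. \<Sum>i<n. indicator (A i) x :: real) \<longlonglongrightarrow> indicator (\<Union>i. A i) x" for x
        unfolding eq by (rule LIMSEQ_indicator_UN)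
      show "\<bar>\<Sum>i<n. indicator (A i) x :: real\<bar> \<le> 1" for n x
        unfolding eq by (simp add: indicator_def)
      show "(indicator (\<Union> (range A)) :: 'a \<Rightarrow> real) \<in> borel_measurable N"
        using union(2) borel by (intro borel_indicator_measurable sets.countable_UN) auto
    qed auto
  qed (auto intro: lipschitz_approximable_closed lipschitz_approximable_bounded_lipschitz bounded_lipschitz_const)
qed

lemma lipschitz_approximable_AE_cong:
  assumes g: "lipschitz_approximable g" and f: "f \<in> borel_measurable N"
    and ae: "AE x in N. f x = g x"
  shows "lipschitz_approximable f"
proof (rule lipschitz_approximable_close)
  have gi: "integrable N g" using g by (simp add: lipschitz_approximable_def)
  then show "integrable N f"
    using integrable_cong_AE[OF f _ ae] by auto
  fix e :: real assume "0 < e"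
  moreover have "(\<integral>x. \<bar>f x - g x\<bar> \<partial>N) = (\<integral>x. 0 \<partial>N)"
    using f gi ae by (intro integral_cong_AE) auto
  ultimately show "\<exists>g. lipschitz_approximable g \<and> (\<integral>x. \<bar>f x - g x\<bar> \<partial>N) < e" using g by auto
qed

text \<open>Because \<open>N\<close> is finite, the set provided by \<open>hull\<close> differs from
  the given one by a null set; this reduces indicators to those of Borel sets.\<close>

theorem bounded_lipschitz_dense:
  assumes hull: "\<And>A. A \<in> sets N \<Longrightarrow> \<exists>B\<in>sets borel. A \<subseteq> B \<and> emeasure N (B \<inter> space N) = emeasure N A"
    and f: "integrable N f"
  shows "lipschitz_approximable f"
  using f
proof (induction rule: integrable_induct)
  case (base A c)
  then obtain B where B: "B \<in> sets borel" "A \<subseteq> B" "emeasure N (B \<inter> space N) = emeasure N A"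
    using hull by blast
  have BN: "B \<inter> space N \<in> sets N"
    using measurable_sets[OF ident_measurable B(1)] by simp
  have sub: "A \<subseteq> B \<inter> space N" using B(2) base(1) sets.sets_into_space by blast
  have "emeasure N (B \<inter> space N - A) = 0"
    using emeasure_Diff[OF _ BN base(1) sub] B(3) BN base by (simp add: emeasure_eq_measure)
  then have "AE x in N. x \<notin> B \<inter> space N - A"
    using BN base(1) by (intro AE_not_in) (auto simp: null_sets_def)
  then have "AE x in N. indicator A x *\<^sub>R c = c * indicator B x"
    using AE_space by eventually_elim (use sub in \<open>auto simp: indicator_def\<close>)
  then show ?case
    by (rule lipschitz_approximable_AE_cong[rotated 2])
      (use B(1) base(1) in \<open>auto intro: lipschitz_approximable_cmult lipschitz_approximable_borel\<close>)
next
  case (add f g)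
  then show ?case by (intro lipschitz_approximable_add)
next
  case (lim f s)
  show ?case
    \<comment> \<open>The bound \<open>2 * \<bar>f x\<bar>\<close> is the one that the induction
      rule provides.\<close>
    by (rule lipschitz_approximable_dominated_limit[of s "\<lambda>x. 2 * \<bar>f x\<bar>"])
      (use lim in auto)
qed

text \<open>Telescoping of approximants with errors below \<open>(1/2) ^ k\<close> times the norm of
  \<open>f\<close>; a positive norm makes these tolerances positive. The first layer has at most 2
  times, a later one at most \<open>3 * (1/2) ^ k\<close> times the norm of \<open>f\<close>, whence
  the factor 4.\<close>

lemma lipschitz_decomposition:
  assumes f: "lipschitz_approximable f" and pos: "0 < (\<integral>x. \<bar>f x\<bar> \<partial>N)"
  obtains h :: "nat \<Rightarrow> 'a \<Rightarrow> real" where "\<And>k. bounded_lipschitz (h k)"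
    "\<And>k. (\<integral>x. \<bar>h k x\<bar> \<partial>N) \<le> 4 * (1/2) ^ k * (\<integral>x. \<bar>f x\<bar> \<partial>N)"
    "AE x in N. (\<lambda>n. \<Sum>k<n. h k x) \<longlonglongrightarrow> f x"
proof -
  let ?F = "\<integral>x. \<bar>f x\<bar> \<partial>N"
  have fi[simp]: "integrable N f" using f by (simp add: lipschitz_approximable_def)
  have "\<forall>k. \<exists>\<phi>. bounded_lipschitz \<phi> \<and> (\<integral>x. \<bar>f x - \<phi> x\<bar> \<partial>N) < (1/2) ^ k * ?F"
    using f pos unfolding lipschitz_approximable_def by simp
  from choice[OF this] obtain \<phi> where \<phi>: "\<And>k. bounded_lipschitz (\<phi> k)"
    "\<And>k. (\<integral>x. \<bar>f x - \<phi> k x\<bar> \<partial>N) < (1/2) ^ k * ?F" by blast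
  have \<phi>i[simp]: "integrable N (\<phi> k)" for k by (intro bounded_lipschitz_integrable \<phi>)
  have [measurable]: "f \<in> borel_measurable N" "\<phi> k \<in> borel_measurable N" for k
    by (intro borel_measurable_integrable fi \<phi>i)+
  define h where "h k x = (if k = 0 then \<phi> 0 x else \<phi> k x - \<phi> (k - 1) x)" for k x
  have sum_h: "(\<Sum>k<Suc n. h k x) = \<phi> n x" for n x
    by (induction n) (auto simp: h_def)
  show ?thesis
  proof
    show "bounded_lipschitz (h k)" for k
      using \<phi>(1) bounded_lipschitz_diff[OF \<phi>(1) \<phi>(1)] by (cases k) (auto simp: h_def[abs_def])
    show "(\<integral>x. \<bar>h k x\<bar> \<partial>N) \<le> 4 * (1/2) ^ k * ?F" for k
    proof (cases k)
      case 0
      have "(\<integral>x. \<bar>h k x\<bar> \<partial>N) \<le> (\<integral>x. \<bar>f x\<bar> + \<bar>f x - \<phi> 0 x\<bar> \<partial>N)"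
        by (intro integral_mono) (auto simp: h_def 0)
      also have "\<dots> \<le> ?F + ?F" using \<phi>(2)[of 0] by simp
      finally show ?thesis using pos by (simp add: 0)
    next
      case (Suc j)
      have "(\<integral>x. \<bar>h k x\<bar> \<partial>N) \<le> (\<integral>x. \<bar>f x - \<phi> (Suc j) x\<bar> + \<bar>f x - \<phi> j x\<bar> \<partial>N)"
        by (intro integral_mono) (auto simp: h_def Suc)
      also have "\<dots> \<le> (1/2) ^ Suc j * ?F + (1/2) ^ j * ?F"
        using add_mono[OF less_imp_le[OF \<phi>(2)[of "Suc j"]] less_imp_le[OF \<phi>(2)[of j]]] by simp
      also have "\<dots> \<le> 4 * (1/2) ^ k * ?F" using pos by (simp add: Suc)
      finally show ?thesis .
    qed
    \<comment> \<open>The errors have summable norms, so their sum is finite almost everywhere. The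
      approximants therefore converge almost everywhere without passing to a subsequence.\<close>
    have "(\<integral>\<^sup>+x. (\<Sum>k. ennreal \<bar>f x - \<phi> k x\<bar>) \<partial>N) = (\<Sum>k. \<integral>\<^sup>+x. ennreal \<bar>f x - \<phi> k x\<bar> \<partial>N)"
      by (rule nn_integral_suminf) auto
    also have "\<dots> \<le> (\<Sum>k. ennreal ((1/2) ^ k * ?F))"
    proof (rule suminf_le)
      fix k
      have "(\<integral>\<^sup>+x. ennreal \<bar>f x - \<phi> k x\<bar> \<partial>N) = ennreal (\<integral>x. \<bar>f x - \<phi> k x\<bar> \<partial>N)"
        by (rule nn_integral_eq_integral) auto
      then show "(\<integral>\<^sup>+x. ennreal \<bar>f x - \<phi> k x\<bar> \<partial>N) \<le> ennreal ((1/2) ^ k * ?F)"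
        using \<phi>(2)[of k] by (simp add: ennreal_leI)
    qed auto
    also have "\<dots> = ennreal (\<Sum>k. (1/2) ^ k * ?F)"
      using pos by (intro suminf_ennreal2 summable_mult2 summable_geometric) auto
    also have "\<dots> < \<infinity>" by simp
    finally have "AE x in N. (\<Sum>k. ennreal \<bar>f x - \<phi> k x\<bar>) \<noteq> \<infinity>"
      by (intro nn_integral_noteq_infinite) (auto simp: less_top)
    then show "AE x in N. (\<lambda>n. \<Sum>k<n. h k x) \<longlonglongrightarrow> f x"
    proof eventually_elim
      case (elim x)
      then have "summable (\<lambda>k. \<bar>f x - \<phi> k x\<bar>)"
        by (intro summable_suminf_not_top) (auto simp: top_ennreal_def)
      then have "(\<lambda>k. \<bar>f x - \<phi> k x\<bar>) \<longlonglongrightarrow> 0" by (rule summable_LIMSEQ_zero)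
      then have "(\<lambda>k. \<phi> k x) \<longlonglongrightarrow> f x"
        by (simp add: tendsto_rabs_zero_iff LIM_zero_iff abs_minus_commute[of "f x"])
      then have "(\<lambda>n. \<Sum>k<Suc n. h k x) \<longlonglongrightarrow> f x" unfolding sum_h .
      then show ?case by (rule LIMSEQ_imp_Suc)
    qed
  qed
qed

end

section \<open>The boundary strip\<close>

locale codim1_domain =
  fixes M :: "'a::metric_space measure" and \<Omega> :: "'a set"
  assumes regular: "borel_regular M" and doubling: "doubling M"
    and open_domain: "open \<Omega>" and bounded_domain: "bounded \<Omega>"
    and ahlfors: "codim1_ahlfors_regular_boundary M \<Omega>"
begin

abbreviation "S \<equiv> frontier \<Omega>"
abbreviation "N \<equiv> codim1_measure M (frontier \<Omega>)"

section \<open>Doubling and total boundedness\<close>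

lemma borel_in_sets: "B \<in> sets borel \<Longrightarrow> B \<in> sets M"
  using regular by (auto simp: borel_regular_def)

lemma space_M [simp]: "space M = UNIV"
  using sets.sets_into_space[OF borel_in_sets[of UNIV]] by auto

lemma borel_measurable_M: "f \<in> borel_measurable borel \<Longrightarrow> f \<in> borel_measurable M"
  using borel_in_sets by (auto simp: measurable_def)

lemma continuous_measurable_M: "continuous_on UNIV f \<Longrightarrow> f \<in> borel_measurable M"
  for f :: "'a \<Rightarrow> real"
  by (intro borel_measurable_M borel_measurable_continuous_onI)

lemma open_in_sets: "open U \<Longrightarrow> U \<in> sets M"
  by (simp add: borel_in_sets)

lemma ball_in_sets [simp]: "ball x r \<in> sets M"
  by (simp add: open_in_sets)

lemma emeasure_ball_finite: "emeasure M (ball x r) < \<infinity>"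
proof (cases "0 < r")
  case True
  obtain C :: real where "emeasure M (ball x (2 * (r / 2))) \<le> ennreal C * emeasure M (ball x (r / 2))"
    "ennreal C * emeasure M (ball x (r / 2)) < \<infinity>"
    using doubling True unfolding doubling_def by (meson half_gt_zero)
  then show ?thesis by (auto intro: le_less_trans)
qed (auto simp: ball_empty)

lemma emeasure_ball: "emeasure M (ball x r) = ennreal (measure M (ball x r))"
  using emeasure_ball_finite[of x r] by (intro emeasure_eq_ennreal_measure) auto

lemma ball_fmeasurable: "ball x r \<in> fmeasurable M"
  using emeasure_ball_finite by (intro fmeasurableI open_in_sets) auto

lemma ball_Int_domain_fmeasurable: "ball x r \<inter> \<Omega> \<in> fmeasurable M"
  by (rule fmeasurableI2[OF ball_fmeasurable]) (auto intro: open_in_sets open_domain)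

lemma measure_ball_pos: "0 < r \<Longrightarrow> 0 < measure M (ball x r)"
proof -
  assume "0 < r"
  then have "0 < emeasure M (ball x (2 * (r / 2)))"
    using doubling unfolding doubling_def by (meson half_gt_zero)
  then show ?thesis by (simp add: emeasure_ball)
qed

lemma measure_ball_mono: "A \<subseteq> ball x r \<Longrightarrow> A \<in> sets M \<Longrightarrow> measure M A \<le> measure M (ball x r)"
  by (intro measure_mono_fmeasurable ball_fmeasurable)

lemma doubling_measure:
  obtains C where "1 \<le> C" "\<And>x r. 0 < r \<Longrightarrow> measure M (ball x (2 * r)) \<le> C * measure M (ball x r)"
proof -
  obtain C :: real where C: "\<And>x r. 0 < r \<Longrightarrow> emeasure M (ball x (2 * r)) \<le> ennreal C * emeasure M (ball x r)"
    using doubling unfolding doubling_def by blast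
  have "measure M (ball x (2 * r)) \<le> max C 1 * measure M (ball x r)" if "0 < r" for x r
  proof -
    have "ennreal (measure M (ball x (2 * r))) \<le> ennreal C * ennreal (measure M (ball x r))"
      using C[OF that, of x] by (simp add: emeasure_ball)
    also have "\<dots> \<le> ennreal (max C 1) * ennreal (measure M (ball x r))"
      by (intro mult_right_mono ennreal_leI) auto
    finally show ?thesis by (simp flip: ennreal_mult)
  qed
  then show ?thesis using that[of "max C 1"] by simp
qed

lemma measure_ball_le_pow2:
  assumes C: "1 \<le> C" "\<And>x r. 0 < r \<Longrightarrow> measure M (ball x (2 * r)) \<le> C * measure M (ball x r)"
    and "0 < r"
  shows "measure M (ball x (2 ^ n * r)) \<le> C ^ n * measure M (ball x r)"
proof (induction n)
  case (Suc n)
  have "measure M (ball x (2 ^ Suc n * r)) \<le> C * measure M (ball x (2 ^ n * r))"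
    using C(2)[of "2 ^ n * r" x] assms(3) by (simp add: mult.assoc)
  also have "\<dots> \<le> C * (C ^ n * measure M (ball x r))"
    using Suc C(1) by (intro mult_left_mono) auto
  finally show ?case by (simp add: mult.assoc)
qed simp

text \<open>The constant does not depend on the centre, as the counting of net points
  requires.\<close>

lemma measure_ball_comparable:
  assumes "0 < r"
  obtains c where "0 < c" "\<And>x. measure M (ball x R) \<le> c * measure M (ball x r)"
proof -
  obtain C where C: "1 \<le> C" "\<And>x r. 0 < r \<Longrightarrow> measure M (ball x (2 * r)) \<le> C * measure M (ball x r)"
    using doubling_measure by blast
  obtain n where "R / r < 2 ^ n" using real_arch_pow[of 2 "R / r"] by auto
  then have "R \<le> 2 ^ n * r" using assms by (simp add: field_simps)
  then have "measure M (ball x R) \<le> C ^ n * measure M (ball x r)" for x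
    by (intro order_trans[OF measure_ball_mono measure_ball_le_pow2[OF C assms]]) auto
  then show ?thesis using that[of "C ^ n"] C(1) by simp
qed

text \<open>Balls of radius \<open>r / 2\<close> about separated points are disjoint, lie in one
  fixed ball and carry at least a fixed fraction of its measure, so their number is bounded. A
  separated set of greatest cardinality is then a net, since an uncovered point could be added to
  it.\<close>

lemma finite_net:
  fixes A :: "'a set"
  assumes "bounded A" "0 < r"
  obtains T where "finite T" "T \<subseteq> A" "\<And>x y. x \<in> T \<Longrightarrow> y \<in> T \<Longrightarrow> x \<noteq> y \<Longrightarrow> r \<le> dist x y"
    "A \<subseteq> (\<Union>z\<in>T. ball z r)"
proof -
  define P where "P T \<longleftrightarrow> finite T \<and> T \<subseteq> A \<and> (\<forall>x\<in>T. \<forall>y\<in>T. x \<noteq> y \<longrightarrow> r \<le> dist x y)" for T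
  obtain x0 R where R: "A \<subseteq> ball x0 R"
    using bounded_subset_ballD[OF assms(1)] by blast
  \<comment> \<open>A ball of radius \<open>2 * R + r\<close> about any point of \<open>A\<close>
    contains \<open>ball x0 (R + r)\<close>.\<close>
  obtain c where c: "0 < c" "\<And>x. measure M (ball x (2 * R + r)) \<le> c * measure M (ball x (r / 2))"
    using measure_ball_comparable[of "r / 2"] assms(2) by auto
  let ?m = "measure M (ball x0 (R + r))"
  have card_le: "card T \<le> nat \<lceil>c\<rceil>" if T: "P T" for T
  proof (cases "T = {}")
    case False
    then obtain t where "t \<in> T" by blast
    then have "dist x0 t < R" using T R by (auto simp: P_def)
    then have "0 < R" using zero_le_dist[of x0 t] by linarith
    then have m: "0 < ?m" using assms(2) by (intro measure_ball_pos) auto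
    have "real (card T) * ?m = (\<Sum>z\<in>T. ?m)" by simp
    also have "\<dots> \<le> (\<Sum>z\<in>T. c * measure M (ball z (r / 2)))"
    proof (rule sum_mono)
      fix z assume "z \<in> T"
      then have z: "dist x0 z < R" using T R by (auto simp: P_def)
      have "ball x0 (R + r) \<subseteq> ball z (2 * R + r)"
      proof
        fix y assume "y \<in> ball x0 (R + r)"
        with z dist_triangle3[of z y x0] show "y \<in> ball z (2 * R + r)" by (auto)
      qed
      then show "?m \<le> c * measure M (ball z (r / 2))"
        by (intro order_trans[OF measure_ball_mono c(2)]) auto
    qed
    also have "\<dots> = c * measure M (\<Union>z\<in>T. ball z (r / 2))"
    proof -
      have "disjoint_family_on (\<lambda>z. ball z (r / 2)) T"
        unfolding disjoint_family_on_def
      proof (intro ballI impI)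
        fix x y assume "x \<in> T" "y \<in> T" "x \<noteq> y"
        then have "r \<le> dist x y" using T by (auto simp: P_def)
        then show "ball x (r / 2) \<inter> ball y (r / 2) = {}" by (intro disjoint_ballI) auto
      qed
      then have "measure M (\<Union>z\<in>T. ball z (r / 2)) = (\<Sum>z\<in>T. measure M (ball z (r / 2)))"
        using T emeasure_ball_finite by (intro measure_finite_Union) (auto simp: P_def less_top)
      then show ?thesis by (simp add: sum_distrib_left)
    qed
    also have "\<dots> \<le> c * ?m"
    proof (intro mult_left_mono measure_ball_mono)
      show "(\<Union>z\<in>T. ball z (r / 2)) \<subseteq> ball x0 (R + r)"
      proof clarify
        fix y z assume "z \<in> T" "y \<in> ball z (r / 2)"
        moreover from this have "dist x0 z < R" using T R by (auto simp: P_def)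
        ultimately show "y \<in> ball x0 (R + r)"
          using dist_triangle[of x0 y z] assms(2) by auto
      qed
    qed (use c(1) in \<open>auto intro: open_in_sets\<close>)
    finally have "real (card T) \<le> c" using m by simp
    then show ?thesis by linarith
  qed simp
  have "P {}" by (simp add: P_def)
  then have "\<exists>T. P T \<and> (\<forall>T'. P T' \<longrightarrow> card T' \<le> card T)"
    by (rule ex_has_greatest_nat[of _ _ _ "Suc (nat \<lceil>c\<rceil>)"]) (simp add: card_le less_Suc_eq_le)
  then obtain T where T: "P T" "\<And>T'. P T' \<Longrightarrow> card T' \<le> card T" by blast
  have "A \<subseteq> (\<Union>z\<in>T. ball z r)"
  proof (rule ccontr)
    assume "\<not> A \<subseteq> (\<Union>z\<in>T. ball z r)"
    then obtain y where yA: "y \<in> A" "y \<notin> (\<Union>z\<in>T. ball z r)" by blast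
    have y: "r \<le> dist z y" "r \<le> dist y z" if "z \<in> T" for z
      using yA(2) that by (auto simp: not_less dist_commute)
    have "P (insert y T)" using T(1) yA(1) y unfolding P_def by blast
    moreover have "y \<notin> T" using y(2)[of y] assms(2) by auto
    moreover have "finite T" using T(1) by (simp add: P_def)
    ultimately show False using T(2)[of "insert y T"] by simp
  qed
  with T(1) that[of T] show ?thesis unfolding P_def by blast
qed

section \<open>The boundary and the measure of the domain near it\<close>

lemma bounded_boundary: "bounded S"
  using bounded_domain by (simp add: bounded_closure frontier_def bounded_diff)

lemma boundary_disjoint: "z \<in> S \<Longrightarrow> z \<notin> \<Omega>"
  using open_domain by (auto simp: frontier_def interior_open)

lemma domain_meets_ball:
  assumes "z \<in> S" "0 < r"
  shows "\<exists>y\<in>\<Omega>. dist y z < r"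
  using assms by (auto simp: frontier_def closure_approachable)

text \<open>Provides admissible radii for the regularity condition, which only concerns those up to
  the diameter.\<close>

lemma diameter_pos:
  assumes "z \<in> S" shows "0 < diameter \<Omega>"
proof -
  obtain y where y: "y \<in> \<Omega>" using domain_meets_ball[OF assms, of 1] by auto
  with boundary_disjoint[OF assms] have "0 < dist y z" by auto
  then obtain y' where y': "y' \<in> \<Omega>" "dist y' z < dist y z"
    using domain_meets_ball[OF assms] by blast
  then have "0 < dist y y'" by auto
  also have "\<dots> \<le> diameter \<Omega>"
    using bounded_domain y y' by (intro diameter_bounded_bound)
  finally show ?thesis .
qed

text \<open>The bound depends on \<open>r\<close> in an uncontrolled way. It is uniform in
  \<open>z\<close> because every ball of radius \<open>r\<close> about a boundary point contains one
  of finitely many balls of half the radius.\<close>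

lemma domain_measure_lower_bound:
  assumes "0 < r"
  shows "\<exists>m>0. \<forall>z\<in>S. m \<le> measure M (ball z r \<inter> \<Omega>)"
proof -
  obtain T where T: "finite T" "T \<subseteq> S" "S \<subseteq> (\<Union>z\<in>T. ball z (r / 2))"
    using finite_net[OF bounded_boundary half_gt_zero[OF assms]] by metis
  have pos: "0 < measure M (ball z (r / 2) \<inter> \<Omega>)" if z: "z \<in> T" for z
  proof -
    obtain y where y: "y \<in> \<Omega>" "dist y z < r / 2"
      using domain_meets_ball[OF subsetD[OF T(2) z] half_gt_zero[OF assms]] by blast
    have "open (ball z (r / 2) \<inter> \<Omega>)" using open_domain by (intro open_Int open_ball)
    moreover have "y \<in> ball z (r / 2) \<inter> \<Omega>" using y by (simp add: dist_commute)
    ultimately obtain e where e: "0 < e" "ball y e \<subseteq> ball z (r / 2) \<inter> \<Omega>"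
      by (meson open_contains_ball)
    have "0 < measure M (ball y e)" using e(1) by (rule measure_ball_pos)
    also have "\<dots> \<le> measure M (ball z (r / 2) \<inter> \<Omega>)"
      using e(2) by (intro measure_mono_fmeasurable ball_Int_domain_fmeasurable open_in_sets open_ball) simp
    finally show ?thesis .
  qed
  \<comment> \<open>\<open>insert 1\<close> keeps the minimum meaningful when the boundary, and with
    it the net, is empty.\<close>
  let ?m = "Min (insert 1 ((\<lambda>z. measure M (ball z (r / 2) \<inter> \<Omega>)) ` T))"
  have "0 < ?m" using T(1) pos by simp
  moreover have "?m \<le> measure M (ball z r \<inter> \<Omega>)" if z: "z \<in> S" for z
  proof -
    obtain t where t: "t \<in> T" "dist t z < r / 2" using subsetD[OF T(3) z] by auto
    have "?m \<le> measure M (ball t (r / 2) \<inter> \<Omega>)" using T(1) t(1) by simp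
    also have "\<dots> \<le> measure M (ball z r \<inter> \<Omega>)"
    proof (rule measure_mono_fmeasurable)
      show "ball t (r / 2) \<inter> \<Omega> \<subseteq> ball z r \<inter> \<Omega>"
      proof
        fix y assume "y \<in> ball t (r / 2) \<inter> \<Omega>"
        with t dist_triangle3[of z y t] show "y \<in> ball z r \<inter> \<Omega>" by auto
      qed
    qed (intro open_in_sets open_Int open_ball open_domain ball_Int_domain_fmeasurable)+
    finally show ?thesis .
  qed
  ultimately show ?thesis by blast
qed

section \<open>Finiteness of the boundary measure and density of Lipschitz functions\<close>

lemma emeasure_N: "B \<in> sets borel \<Longrightarrow> emeasure N (B \<inter> S) = codim1_hausdorff M (B \<inter> S)"
  using borel_Int_in_sets_codim1_measure[of B S M]
  by (simp add: emeasure_codim1_measure sets_codim1_measure)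

text \<open>The upper half of the regularity condition enters here, at the single radius
  \<open>diameter \<Omega>\<close> and for a finite net at that scale.\<close>

lemma emeasure_N_space_finite: "emeasure N S < \<infinity>"
proof (cases "S = {}")
  case False
  then have D: "0 < diameter \<Omega>" using diameter_pos by blast
  obtain C :: real where C: "\<And>x r. x \<in> S \<Longrightarrow> 0 < r \<Longrightarrow> r \<le> diameter \<Omega> \<Longrightarrow>
      codim1_hausdorff M (ball x r \<inter> S) \<le> ennreal C * (emeasure M (ball x r) / ennreal r)"
    using ahlfors unfolding codim1_ahlfors_regular_boundary_def by blast
  obtain T where T: "finite T" "T \<subseteq> S" "S \<subseteq> (\<Union>z\<in>T. ball z (diameter \<Omega>))"
    using finite_net[OF bounded_boundary D] by metis
  have sets: "ball z r \<inter> S \<in> sets N" for z r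
    by (rule borel_Int_in_sets_codim1_measure) simp
  have "emeasure N S \<le> emeasure N (\<Union>z\<in>T. ball z (diameter \<Omega>) \<inter> S)"
    using T(1,3) sets by (intro emeasure_mono sets.finite_UN) auto
  also have "\<dots> \<le> (\<Sum>z\<in>T. emeasure N (ball z (diameter \<Omega>) \<inter> S))"
    using T(1) sets by (intro emeasure_subadditive_finite) auto
  also have "\<dots> < \<infinity>"
  proof -
    have "emeasure N (ball z (diameter \<Omega>) \<inter> S) < top" if "z \<in> T" for z
    proof -
      have "emeasure N (ball z (diameter \<Omega>) \<inter> S)
          \<le> ennreal C * (emeasure M (ball z (diameter \<Omega>)) / ennreal (diameter \<Omega>))"
        using C[of z "diameter \<Omega>"] that T(2) D by (simp add: emeasure_N subsetD)
      also have "\<dots> < top"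
        using D by (simp add: emeasure_ball divide_ennreal ennreal_mult_less_top)
      finally show ?thesis .
    qed
    then show ?thesis using T(1) by (simp add: infinity_ennreal_def)
  qed
  finally show ?thesis .
qed (simp add: space_codim1_measure[symmetric])

sublocale N: metric_finite_measure N
proof (intro metric_finite_measure.intro finite_measureI metric_finite_measure_axioms.intro)
  show "emeasure N (space N) \<noteq> \<infinity>"
    using emeasure_N_space_finite by (simp add: space_codim1_measure less_top)
qed (rule measurable_ident_codim1_measure)

lemma integrable_imp_approximable:
  assumes "integrable N f" shows "N.lipschitz_approximable f"
proof (rule N.bounded_lipschitz_dense[OF _ assms])
  fix A assume A: "A \<in> sets N"
  then have AS: "A \<subseteq> S" using sets.sets_into_space by (fastforce simp: space_codim1_measure)
  have eA: "emeasure N A = codim1_hausdorff M A"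
    using A by (simp add: emeasure_codim1_measure sets_codim1_measure)
  have "emeasure N A < \<infinity>" using N.emeasure_finite[of A] by (simp add: less_top[symmetric])
  with eA obtain B where B: "B \<in> sets borel" "A \<subseteq> B" "codim1_hausdorff M B = codim1_hausdorff M A"
    using codim1_hausdorff_borel_hull[of M A] by auto
  \<comment> \<open>The Borel hull lives in the whole space; cut down to \<open>S\<close> it still
    contains \<open>A\<close>, so its measure is unchanged.\<close>
  have "codim1_hausdorff M (B \<inter> S) = codim1_hausdorff M A"
    using B(3) codim1_hausdorff_mono[of "B \<inter> S" B M] codim1_hausdorff_mono[of A "B \<inter> S" M] B(2) AS
    by (intro antisym) auto
  with B eA show "\<exists>B\<in>sets borel. A \<subseteq> B \<and> emeasure N (B \<inter> space N) = emeasure N A"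
    by (intro bexI[of _ B]) (auto simp: space_codim1_measure emeasure_N)
qed

lemma ahlfors_lower:
  obtains C where "1 \<le> C" "\<And>z r. z \<in> S \<Longrightarrow> 0 < r \<Longrightarrow> r \<le> diameter \<Omega> \<Longrightarrow>
    measure M (ball z r) \<le> C * r * measure N (ball z r \<inter> S)"
proof -
  obtain C :: real where C: "1 \<le> C" "\<And>x r. x \<in> S \<Longrightarrow> 0 < r \<Longrightarrow> r \<le> diameter \<Omega> \<Longrightarrow>
      ennreal (1 / C) * (emeasure M (ball x r) / ennreal r) \<le> codim1_hausdorff M (ball x r \<inter> S)"
    using ahlfors unfolding codim1_ahlfors_regular_boundary_def by blast
  have "measure M (ball z r) \<le> C * r * measure N (ball z r \<inter> S)"
    if *: "z \<in> S" "0 < r" "r \<le> diameter \<Omega>" for z r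
  proof -
    have "ennreal (1 / C * (measure M (ball z r) / r)) \<le> emeasure N (ball z r \<inter> S)"
      using C(2)[OF *] *(2) C(1)
      by (simp add: emeasure_N emeasure_ball divide_ennreal flip: ennreal_mult)
    then have "1 / C * (measure M (ball z r) / r) \<le> measure N (ball z r \<inter> S)"
      by (simp add: N.emeasure_eq_measure)
    then show ?thesis using C(1) *(2) by (simp add: field_simps)
  qed
  with C(1) that show ?thesis by blast
qed

text \<open>
  Every point of the strip lies within \<open>3 * \<rho>\<close> of a \<open>\<rho>\<close>-net of the boundary, and the balls of radius
  \<open>\<rho> / 2\<close> about the net are disjoint; so no bounded overlap argument is needed.
\<close>

lemma strip_estimate:
  obtains K where "0 < K"
    "\<And>h L \<rho>. bounded_lipschitz h \<Longrightarrow> L-lipschitz_on UNIV h \<Longrightarrow> 0 < \<rho> \<Longrightarrow> \<rho> \<le> diameter \<Omega> \<Longrightarrow> S \<noteq> {} \<Longrightarrow>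
      (\<integral>\<^sup>+x\<in>{x. infdist x S < 2 * \<rho>}. ennreal \<bar>h x\<bar> \<partial>M)
        \<le> ennreal (K * \<rho> * ((\<integral>x. \<bar>h x\<bar> \<partial>N) + \<rho> * L * measure N S))"
proof -
  obtain D where D: "1 \<le> D" "\<And>x r. 0 < r \<Longrightarrow> measure M (ball x (2 * r)) \<le> D * measure M (ball x r)"
    using doubling_measure by blast
  obtain C where C: "1 \<le> C" "\<And>z r. z \<in> S \<Longrightarrow> 0 < r \<Longrightarrow> r \<le> diameter \<Omega> \<Longrightarrow>
      measure M (ball z r) \<le> C * r * measure N (ball z r \<inter> S)"
    using ahlfors_lower by blast
  \<comment> \<open>\<open>D ^ 3\<close> pays for enlarging the radius \<open>\<rho> / 2\<close> to
    \<open>4 * \<rho>\<close>, which exceeds \<open>3 * \<rho>\<close>; regularity at radius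
    \<open>\<rho> / 2\<close> gives \<open>C * (\<rho> / 2)\<close>; a factor 4 comes from the
    oscillation \<open>4 * \<rho> * L\<close> of \<open>h\<close>.\<close>
  let ?K = "2 * D ^ 3 * C"
  have "(\<integral>\<^sup>+x\<in>{x. infdist x S < 2 * \<rho>}. ennreal \<bar>h x\<bar> \<partial>M)
        \<le> ennreal (?K * \<rho> * ((\<integral>x. \<bar>h x\<bar> \<partial>N) + \<rho> * L * measure N S))"
    if h: "bounded_lipschitz h" and L: "L-lipschitz_on UNIV h" and \<rho>: "0 < \<rho>" "\<rho> \<le> diameter \<Omega>" and ne: "S \<noteq> {}"
    for h L \<rho>
  proof -
    obtain T where T: "finite T" "T \<subseteq> S" "\<And>x y. x \<in> T \<Longrightarrow> y \<in> T \<Longrightarrow> x \<noteq> y \<Longrightarrow> \<rho> \<le> dist x y"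
      "S \<subseteq> (\<Union>z\<in>T. ball z \<rho>)"
      using finite_net[OF bounded_boundary \<rho>(1)] by metis
    have L0: "0 \<le> L" using L by (rule lipschitz_on_nonneg)
    have [measurable]: "h \<in> borel_measurable M"
      using h by (intro continuous_measurable_M bounded_lipschitz_continuous)
    have hi[simp]: "integrable N h" using h by (rule N.bounded_lipschitz_integrable)
    define \<beta> where "\<beta> z = measure N (ball z (\<rho> / 2) \<inter> S)" for z
    \<comment> \<open>Points of \<open>ball z (3 * \<rho>)\<close> and
      \<open>ball z (\<rho> / 2)\<close> are less than \<open>4 * \<rho>\<close> apart, so the
      boundary average \<open>J z / \<beta> z\<close> bounds \<open>\<bar>h x\<bar>\<close> on the
      large ball.\<close>
    define J where "J z = (\<integral>w. indicator (ball z (\<rho> / 2)) w * (\<bar>h w\<bar> + 4 * \<rho> * L) \<partial>N)" for z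
    have ind: "(indicator (ball z (\<rho> / 2)) :: 'a \<Rightarrow> real) \<in> borel_measurable N" for z
      by (intro N.borel_indicator_measurable) simp
    have int: "integrable N (\<lambda>w. indicator (ball z (\<rho> / 2)) w * q w)" if "integrable N q" for q :: "'a \<Rightarrow> real" and z
      by (rule Bochner_Integration.integrable_bound[OF that
            borel_measurable_times[OF ind borel_measurable_integrable[OF that]]])
        (simp add: indicator_def)
    have \<beta>: "\<beta> z = (\<integral>w. indicator (ball z (\<rho> / 2)) w \<partial>N)" for z
      by (simp add: \<beta>_def space_codim1_measure)
    have ball: "(\<integral>\<^sup>+x\<in>ball z (3 * \<rho>). ennreal \<bar>h x\<bar> \<partial>M) \<le> ennreal (D ^ 3 * C * (\<rho> / 2) * J z)"
      if z: "z \<in> T" for z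
    proof -
      have zS: "z \<in> S" using z T by auto
      have m0: "0 < measure M (ball z (\<rho> / 2))" using \<rho> by (intro measure_ball_pos) auto
      have m: "measure M (ball z (\<rho> / 2)) \<le> C * (\<rho> / 2) * \<beta> z"
        unfolding \<beta>_def using zS \<rho> by (intro C(2)) auto
      \<comment> \<open>Regularity passes the positive measure of the ball on to the boundary, which
        permits division by \<open>\<beta> z\<close>.\<close>
      then have \<beta>0: "0 < \<beta> z"
        using m0 C(1) \<rho> by (smt (verit, best) mult_nonneg_nonpos mult_pos_pos half_gt_zero)
      have "measure M (ball z (3 * \<rho>)) \<le> measure M (ball z (2 ^ 3 * (\<rho> / 2)))"
        using \<rho> by (intro measure_ball_mono) auto
      also have "\<dots> \<le> D ^ 3 * measure M (ball z (\<rho> / 2))"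
        using \<rho> by (intro measure_ball_le_pow2 D) auto
      also have "\<dots> \<le> D ^ 3 * (C * (\<rho> / 2) * \<beta> z)"
        using D(1) m by (intro mult_left_mono) auto
      finally have m3: "measure M (ball z (3 * \<rho>)) \<le> D ^ 3 * (C * (\<rho> / 2) * \<beta> z)" .
      have hx: "\<bar>h x\<bar> \<le> J z / \<beta> z" if x: "x \<in> ball z (3 * \<rho>)" for x
      proof -
        have "\<beta> z * \<bar>h x\<bar> = (\<integral>w. indicator (ball z (\<rho> / 2)) w * \<bar>h x\<bar> \<partial>N)"
          by (simp add: \<beta>)
        also have "\<dots> \<le> J z"
          unfolding J_def
        proof (intro integral_mono int)
          fix w
          have "\<bar>h x\<bar> \<le> \<bar>h w\<bar> + 4 * \<rho> * L" if w: "w \<in> ball z (\<rho> / 2)"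
          proof -
            have "dist x w \<le> 4 * \<rho>" using x w dist_triangle3[of x w z] \<rho> by auto
            then have "\<bar>h x - h w\<bar> \<le> L * (4 * \<rho>)"
              using lipschitz_onD[OF L, of x w] L0 mult_left_mono[of "dist x w" "4 * \<rho>" L]
              by (auto simp: dist_real_def)
            then show ?thesis by (simp add: mult.commute)
          qed
          then show "indicator (ball z (\<rho> / 2)) w * \<bar>h x\<bar> \<le> indicator (ball z (\<rho> / 2)) w * (\<bar>h w\<bar> + 4 * \<rho> * L)"
            by (auto simp: indicator_def)
        qed auto
        finally show ?thesis using \<beta>0 by (simp add: field_simps)
      qed
      have J0: "0 \<le> J z / \<beta> z" using hx[of z] \<rho> by (auto intro: order_trans[OF abs_ge_zero])
      have "(\<integral>\<^sup>+x\<in>ball z (3 * \<rho>). ennreal \<bar>h x\<bar> \<partial>M) \<le> (\<integral>\<^sup>+x\<in>ball z (3 * \<rho>). ennreal (J z / \<beta> z) \<partial>M)"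
        using hx by (intro nn_integral_mono) (auto simp: indicator_def intro!: ennreal_leI)
      also have "\<dots> = ennreal (J z / \<beta> z * measure M (ball z (3 * \<rho>)))"
        using ennreal_mult[OF J0 measure_nonneg, of M "ball z (3 * \<rho>)"]
        by (simp only: nn_integral_cmult_indicator[OF open_in_sets[OF open_ball]] emeasure_ball)
      also have "\<dots> \<le> ennreal (J z / \<beta> z * (D ^ 3 * (C * (\<rho> / 2) * \<beta> z)))"
        using J0 m3 by (intro ennreal_leI mult_left_mono) auto
      also have "J z / \<beta> z * (D ^ 3 * (C * (\<rho> / 2) * \<beta> z)) = D ^ 3 * C * (\<rho> / 2) * J z"
        using \<beta>0 by (simp add: field_simps)
      finally show ?thesis .
    qed
    have J0: "0 \<le> J z" for z
      unfolding J_def using L0 \<rho> by (intro integral_nonneg_AE) auto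
    have "(\<Sum>z\<in>T. J z) = (\<integral>w. (\<Sum>z\<in>T. indicator (ball z (\<rho> / 2)) w * (\<bar>h w\<bar> + 4 * \<rho> * L)) \<partial>N)"
      unfolding J_def by (intro Bochner_Integration.integral_sum[symmetric] int) auto
    also have "\<dots> \<le> (\<integral>w. \<bar>h w\<bar> + 4 * \<rho> * L \<partial>N)"
    proof (rule integral_mono)
      fix w
      have "(\<Sum>z\<in>T. indicator (ball z (\<rho> / 2)) w :: real) \<le> 1"
      proof -
        have disj: "disjoint_family_on (\<lambda>z. ball z (\<rho> / 2)) T"
          unfolding disjoint_family_on_def
          using T(3) by (intro ballI impI disjoint_ballI) auto
        then have "(\<Sum>z\<in>T. indicator (ball z (\<rho> / 2)) w :: real) = indicator (\<Union>z\<in>T. ball z (\<rho> / 2)) w"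
          using T(1) by (simp add: indicator_UN_disjoint)
        then show ?thesis by (simp add: indicator_def)
      qed
      then show "(\<Sum>z\<in>T. indicator (ball z (\<rho> / 2)) w * (\<bar>h w\<bar> + 4 * \<rho> * L)) \<le> \<bar>h w\<bar> + 4 * \<rho> * L"
        using L0 \<rho> by (simp add: mult_left_le_one_le sum_nonneg flip: sum_distrib_right)
    qed (auto intro!: int Bochner_Integration.integrable_sum)
    also have "\<dots> = (\<integral>w. \<bar>h w\<bar> \<partial>N) + 4 * \<rho> * L * measure N S"
      by (simp add: space_codim1_measure)
    finally have sumJ: "(\<Sum>z\<in>T. J z) \<le> (\<integral>w. \<bar>h w\<bar> \<partial>N) + 4 * \<rho> * L * measure N S" .
    have "(\<integral>\<^sup>+x\<in>{x. infdist x S < 2 * \<rho>}. ennreal \<bar>h x\<bar> \<partial>M)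
        \<le> (\<integral>\<^sup>+x. (\<Sum>z\<in>T. ennreal \<bar>h x\<bar> * indicator (ball z (3 * \<rho>)) x) \<partial>M)"
    proof (rule nn_integral_mono)
      fix x
      show "ennreal \<bar>h x\<bar> * indicator {x. infdist x S < 2 * \<rho>} x \<le> (\<Sum>z\<in>T. ennreal \<bar>h x\<bar> * indicator (ball z (3 * \<rho>)) x)"
      proof (cases "infdist x S < 2 * \<rho>")
        case True
        then obtain w where w: "w \<in> S" "dist x w < 2 * \<rho>"
          using ne infdist_notempty[OF ne, of x] by (auto simp: cINF_less_iff)
        then obtain z where z: "z \<in> T" "dist z w < \<rho>" using T(4) by auto
        have "dist z x < 3 * \<rho>" using dist_triangle[of z x w] w z by (simp add: dist_commute)
        then have "ennreal \<bar>h x\<bar> \<le> ennreal \<bar>h x\<bar> * indicator (ball z (3 * \<rho>)) x" by simp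
        also have "\<dots> \<le> (\<Sum>z\<in>T. ennreal \<bar>h x\<bar> * indicator (ball z (3 * \<rho>)) x)"
          using z(1) T(1) by (intro member_le_sum) auto
        finally show ?thesis using True by simp
      qed simp
    qed
    also have "\<dots> = (\<Sum>z\<in>T. \<integral>\<^sup>+x\<in>ball z (3 * \<rho>). ennreal \<bar>h x\<bar> \<partial>M)"
      by (intro nn_integral_sum borel_measurable_times_ennreal borel_measurable_indicator open_in_sets) auto
    also have "\<dots> \<le> (\<Sum>z\<in>T. ennreal (D ^ 3 * C * (\<rho> / 2) * J z))"
      by (intro sum_mono ball)
    also have "\<dots> = ennreal (D ^ 3 * C * (\<rho> / 2) * (\<Sum>z\<in>T. J z))"
      using D(1) C(1) \<rho> J0 by (subst sum_ennreal) (auto simp: sum_distrib_left)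
    also have "\<dots> \<le> ennreal (D ^ 3 * C * (\<rho> / 2) * ((\<integral>w. \<bar>h w\<bar> \<partial>N) + 4 * \<rho> * L * measure N S))"
      using D(1) C(1) \<rho> sumJ by (intro ennreal_leI mult_left_mono) auto
    also have "\<dots> \<le> ennreal (D ^ 3 * C * (\<rho> / 2) * (4 * ((\<integral>w. \<bar>h w\<bar> \<partial>N) + \<rho> * L * measure N S)))"
      using D(1) C(1) \<rho> by (intro ennreal_leI mult_left_mono) auto
    also have "D ^ 3 * C * (\<rho> / 2) * (4 * ((\<integral>w. \<bar>h w\<bar> \<partial>N) + \<rho> * L * measure N S))
        = ?K * \<rho> * ((\<integral>w. \<bar>h w\<bar> \<partial>N) + \<rho> * L * measure N S)" by simp
    finally show ?thesis .
  qed
  moreover have "0 < ?K" using C(1) D(1) by simp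
  ultimately show ?thesis using that by blast
qed

end

section \<open>The extension\<close>

text \<open>The last condition forces a dependent choice: the smallness asked of a radius involves
  \<open>m\<close> at half the previous one. The sequence \<open>c\<close> gathers all other
  quantities that a radius has to absorb.\<close>

lemma exists_layer_radii:
  fixes c :: "nat \<Rightarrow> real" and m :: "real \<Rightarrow> real"
  assumes "0 < D" "0 < b" and c: "\<And>k. 0 < c k" and m: "\<And>r. 0 < r \<Longrightarrow> 0 < m r"
  obtains \<rho> :: "nat \<Rightarrow> real" where "\<And>k. 0 < \<rho> k" "\<And>k. \<rho> k \<le> D" "\<And>k. \<rho> k * c k \<le> (1/2) ^ k * b"
    "\<And>k. \<rho> (Suc k) \<le> \<rho> k" "\<And>k. \<rho> (Suc k) * c (Suc k) \<le> (1/2) ^ Suc k * m (\<rho> k / 2)"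
proof -
  define P where "P k r \<longleftrightarrow> 0 < r \<and> r \<le> D \<and> r * c k \<le> (1/2) ^ k * b" for k and r :: real
  define Q where "Q k r s \<longleftrightarrow> s \<le> r \<and> s * c (Suc k) \<le> (1/2) ^ Suc k * m (r / 2)" for k and r s :: real
  have "\<exists>\<rho>. \<forall>k. P k (\<rho> k) \<and> Q k (\<rho> k) (\<rho> (Suc k))"
  proof (rule dependent_nat_choice)
    show "\<exists>r. P 0 r"
      using assms by (intro exI[of _ "min D (b / c 0)"]) (auto simp: P_def min_def field_simps)
    fix r k assume "P k r"
    then have "0 < r" "r \<le> D" by (auto simp: P_def)
    define s where "s = min r (min ((1/2) ^ Suc k * b / c (Suc k)) ((1/2) ^ Suc k * m (r / 2) / c (Suc k)))"
    have "s \<le> (1/2) ^ Suc k * b / c (Suc k)" "s \<le> (1/2) ^ Suc k * m (r / 2) / c (Suc k)" "s \<le> r"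
      by (auto simp: s_def)
    then have "s * c (Suc k) \<le> (1/2) ^ Suc k * b" "s * c (Suc k) \<le> (1/2) ^ Suc k * m (r / 2)" "s \<le> r"
      using c[of "Suc k"] by (simp_all only: pos_le_divide_eq)
    moreover have "0 < s"
      using \<open>0 < r\<close> m[of "r / 2"] c[of "Suc k"] assms(2) by (simp add: s_def)
    ultimately show "\<exists>s. P (Suc k) s \<and> Q k r s"
      using \<open>r \<le> D\<close> by (intro exI[of _ s]) (auto simp: P_def Q_def)
  qed
  then show ?thesis using that by (auto simp: P_def Q_def)
qed

text \<open>Two profiles of the distance \<open>d\<close>: the cutoff of a layer, which falls from 1
  to 0 between \<open>r / 2\<close> and \<open>r\<close>, and a wider weight, which falls between
  \<open>r\<close> and \<open>2 * r\<close>. The weight is 1 wherever the cutoff is nonzero, so it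
  can localise the slope and still be continuous.\<close>

lemma cutoff_values:
  fixes d r :: real
  assumes "0 < r"
  shows "d \<le> r / 2 \<Longrightarrow> max 0 (min 1 (2 - 2 / r * d)) = 1"
    and "r \<le> d \<Longrightarrow> max 0 (min 1 (2 - 2 / r * d)) = 0"
    and "d \<le> r \<Longrightarrow> max 0 (min 1 (2 - 1 / r * d)) = 1"
    and "2 * r \<le> d \<Longrightarrow> max 0 (min 1 (2 - 1 / r * d)) = 0"
proof -
  show "max 0 (min 1 (2 - 2 / r * d)) = 1" if "d \<le> r / 2"
  proof -
    have "2 / r * d \<le> 1" using that assms by (simp add: divide_simps)
    then show ?thesis by linarith
  qed
  show "max 0 (min 1 (2 - 2 / r * d)) = 0" if "r \<le> d"
  proof -
    have "2 \<le> 2 / r * d" using that assms by (simp add: divide_simps)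
    then show ?thesis by linarith
  qed
  show "max 0 (min 1 (2 - 1 / r * d)) = 1" if "d \<le> r"
  proof -
    have "1 / r * d \<le> 1" using that assms by (simp add: divide_simps)
    then show ?thesis by linarith
  qed
  show "max 0 (min 1 (2 - 1 / r * d)) = 0" if "2 * r \<le> d"
  proof -
    have "2 \<le> 1 / r * d" using that assms by (simp add: divide_simps)
    then show ?thesis by linarith
  qed
qed

context codim1_domain
begin

section \<open>Series of Lipschitz functions in BV\<close>

lemma bounded_lipschitz_measurable_M: "bounded_lipschitz f \<Longrightarrow> f \<in> borel_measurable M"
  by (intro continuous_measurable_M bounded_lipschitz_continuous)

lemma domain_in_sets [measurable]: "\<Omega> \<in> sets M"
  using open_domain by (rule open_in_sets)

lemma bounded_lipschitz_set_integrable: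
  assumes "bounded_lipschitz f" shows "set_integrable M \<Omega> f"
proof -
  obtain C where C: "\<And>x. \<bar>f x\<bar> \<le> C" using assms by (auto simp: bounded_lipschitz_def)
  obtain x R where "\<Omega> \<subseteq> ball x R" using bounded_subset_ballD[OF bounded_domain] by blast
  then have "emeasure M \<Omega> \<le> emeasure M (ball x R)" by (intro emeasure_mono open_in_sets open_ball)
  then have "emeasure M \<Omega> < \<infinity>" using emeasure_ball_finite by (rule le_less_trans)
  then show ?thesis
    unfolding set_integrable_def using C bounded_lipschitz_measurable_M[OF assms]
    by (intro integrableI_bounded_set_indicator[where B=C]) auto
qed

text \<open>Pointwise summability identifies the real series with the series in
  \<open>ennreal\<close>, for which sum and integral may be exchanged.\<close>

lemma nn_integral_abs_series_le:
  fixes v :: "nat \<Rightarrow> 'a \<Rightarrow> real"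
  assumes E: "E \<in> sets M" and v: "\<And>k. v k \<in> borel_measurable M"
    and summable: "\<And>x. x \<in> E \<Longrightarrow> summable (\<lambda>k. \<bar>v k x\<bar>)"
    and bound: "\<And>k. (\<integral>\<^sup>+x\<in>E. ennreal \<bar>v k x\<bar> \<partial>M) \<le> ennreal (a k)"
    and a: "summable a" "\<And>k. 0 \<le> a k"
  shows "(\<integral>\<^sup>+x\<in>E. ennreal (\<Sum>k. \<bar>v k x\<bar>) \<partial>M) \<le> ennreal (\<Sum>k. a k)"
proof -
  have "(\<integral>\<^sup>+x\<in>E. ennreal (\<Sum>k. \<bar>v k x\<bar>) \<partial>M) = (\<integral>\<^sup>+x. (\<Sum>k. ennreal \<bar>v k x\<bar> * indicator E x) \<partial>M)"
  proof (rule nn_integral_cong)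
    fix x
    show "ennreal (\<Sum>k. \<bar>v k x\<bar>) * indicator E x = (\<Sum>k. ennreal \<bar>v k x\<bar> * indicator E x)"
    proof (cases "x \<in> E")
      case True
      then show ?thesis using suminf_ennreal2[OF abs_ge_zero summable[OF True]] by simp
    qed simp
  qed
  also have "\<dots> = (\<Sum>k. \<integral>\<^sup>+x\<in>E. ennreal \<bar>v k x\<bar> \<partial>M)"
    using E v
    by (intro nn_integral_suminf borel_measurable_times_ennreal borel_measurable_indicator
        measurable_compose[OF _ measurable_ennreal] borel_measurable_abs)
  also have "\<dots> \<le> (\<Sum>k. ennreal (a k))"
    by (intro suminf_le bound) auto
  also have "\<dots> = ennreal (\<Sum>k. a k)"
    using a by (intro suminf_ennreal2)
  finally show ?thesis .
qed

text \<open>The partial sums are themselves competitors in the definition of the total variation, so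
  a uniform bound on their energies suffices and no limit of upper gradients has to be
  taken.\<close>

lemma BV_series:
  fixes v g :: "nat \<Rightarrow> 'a \<Rightarrow> real"
  assumes v: "\<And>k. bounded_lipschitz (v k)"
    and g: "\<And>k. continuous_on UNIV (g k)" "\<And>k x. 0 \<le> g k x"
    and slope: "\<And>k x. eventually (\<lambda>y. \<bar>v k y - v k x\<bar> \<le> g k x * dist y x) (nhds x)"
    and summable: "\<And>x. x \<in> \<Omega> \<Longrightarrow> summable (\<lambda>k. \<bar>v k x\<bar>)"
    and u: "\<And>x. u x = (\<Sum>k. v k x)"
    and a: "\<And>k. (\<integral>\<^sup>+x\<in>\<Omega>. ennreal \<bar>v k x\<bar> \<partial>M) \<le> ennreal (a k)" "summable a" "\<And>k. 0 \<le> a k"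
    and b: "\<And>k. (\<integral>\<^sup>+x\<in>\<Omega>. ennreal (g k x) \<partial>M) \<le> ennreal (b k)" "summable b" "\<And>k. 0 \<le> b k"
  shows "set_integrable M \<Omega> u" and "BV_norm M \<Omega> u \<le> ennreal ((\<Sum>k. a k) + (\<Sum>k. b k))"
proof -
  define s where "s n x = (\<Sum>k<n. v k x)" for n x
  have vm[measurable]: "v k \<in> borel_measurable M" for k
    by (intro bounded_lipschitz_measurable_M v)
  have [measurable]: "g k \<in> borel_measurable M" for k
    by (intro continuous_measurable_M g)
  have s_bl: "bounded_lipschitz (s n)" for n
  proof (induction n)
    case (Suc n)
    then show ?case using bounded_lipschitz_add[OF Suc v[of n]] by (simp add: s_def[abs_def])
  qed (simp add: s_def[abs_def] bounded_lipschitz_const)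
  \<comment> \<open>The case \<open>n = 0\<close> bounds the norm of \<open>u\<close>; letting
    \<open>n\<close> tend to infinity gives the convergence of the partial sums.\<close>
  have tail: "L1_norm_on M \<Omega> (\<lambda>x. s n x - u x) \<le> ennreal (\<Sum>k. a (k + n))" for n
  proof -
    have "L1_norm_on M \<Omega> (\<lambda>x. s n x - u x) \<le> (\<integral>\<^sup>+x\<in>\<Omega>. ennreal (\<Sum>k. \<bar>v (k + n) x\<bar>) \<partial>M)"
      unfolding L1_norm_on_def
    proof (rule nn_integral_mono)
      fix x
      show "ennreal \<bar>s n x - u x\<bar> * indicator \<Omega> x \<le> ennreal (\<Sum>k. \<bar>v (k + n) x\<bar>) * indicator \<Omega> x"
      proof (cases "x \<in> \<Omega>")
        case True
        then have "summable (\<lambda>k. \<bar>v (k + n) x\<bar>)" by (intro summable_ignore_initial_segment summable)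
        moreover have "u x - s n x = (\<Sum>k. v (k + n) x)"
          using suminf_split_initial_segment[OF summable_rabs_cancel[OF summable[OF True]], of n]
          by (simp add: u s_def)
        ultimately have "\<bar>s n x - u x\<bar> \<le> (\<Sum>k. \<bar>v (k + n) x\<bar>)"
          using summable_rabs[of "\<lambda>k. v (k + n) x"] by (metis abs_minus_commute)
        then show ?thesis using True by (simp add: ennreal_leI)
      qed simp
    qed
    also have "\<dots> \<le> ennreal (\<Sum>k. a (k + n))"
      by (intro nn_integral_abs_series_le domain_in_sets vm summable_ignore_initial_segment summable a)
    finally show ?thesis .
  qed
  have L1: "L1_norm_on M \<Omega> u \<le> ennreal (\<Sum>k. a k)"
    using tail[of 0] by (simp add: s_def L1_norm_on_def)
  have um: "u \<in> borel_measurable M"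
    unfolding u[abs_def] by measurable
  have eq: "ennreal (norm (indicator \<Omega> x *\<^sub>R u x)) = ennreal \<bar>u x\<bar> * indicator \<Omega> x" for x
    by (simp add: indicator_def)
  show "set_integrable M \<Omega> u"
    unfolding set_integrable_def
  proof (rule integrableI_bounded)
    have "(\<integral>\<^sup>+x. ennreal (norm (indicator \<Omega> x *\<^sub>R u x)) \<partial>M) = L1_norm_on M \<Omega> u"
      unfolding eq L1_norm_on_def ..
    then show "(\<integral>\<^sup>+x. ennreal (norm (indicator \<Omega> x *\<^sub>R u x)) \<partial>M) < \<infinity>"
      using L1 by (simp add: le_less_trans)
  qed (use um in measurable)
  have energy: "upper_gradient_energy M \<Omega> (\<lambda>x. ereal (s n x)) \<le> ennreal (\<Sum>k. b k)" for n
  proof -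
    have "upper_gradient \<Omega> (\<lambda>x. ennreal (\<Sum>k<n. g k x)) (\<lambda>x. ereal (s n x))"
    proof (rule upper_gradient_continuousI)
      fix x
      have "eventually (\<lambda>y. \<forall>k\<in>{..<n}. \<bar>v k y - v k x\<bar> \<le> g k x * dist y x) (nhds x)"
        using slope by (intro eventually_ball_finite) auto
      then show "eventually (\<lambda>y. \<bar>s n y - s n x\<bar> \<le> (\<Sum>k<n. g k x) * dist y x) (nhds x)"
      proof eventually_elim
        case (elim y)
        have "\<bar>s n y - s n x\<bar> \<le> (\<Sum>k<n. \<bar>v k y - v k x\<bar>)"
          unfolding s_def sum_subtractf[symmetric] by (rule sum_abs)
        also have "\<dots> \<le> (\<Sum>k<n. g k x * dist y x)" using elim by (intro sum_mono) auto
        finally show ?case by (simp add: sum_distrib_right)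
      qed
    qed (use g in \<open>auto intro!: continuous_on_sum sum_nonneg\<close>)
    then have "upper_gradient_energy M \<Omega> (\<lambda>x. ereal (s n x)) \<le> (\<integral>\<^sup>+x\<in>\<Omega>. ennreal (\<Sum>k<n. g k x) \<partial>M)"
      unfolding upper_gradient_energy_def by (intro INF_lower) simp
    also have "\<dots> = (\<integral>\<^sup>+x. (\<Sum>k<n. ennreal (g k x) * indicator \<Omega> x) \<partial>M)"
      using g(2) by (intro nn_integral_cong) (simp add: sum_distrib_right flip: sum_ennreal)
    also have "\<dots> = (\<Sum>k<n. \<integral>\<^sup>+x\<in>\<Omega>. ennreal (g k x) \<partial>M)"
      by (intro nn_integral_sum) measurable
    also have "\<dots> \<le> (\<Sum>k<n. ennreal (b k))" by (intro sum_mono b)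
    also have "\<dots> \<le> ennreal (\<Sum>k. b k)"
      using b by (simp add: sum_ennreal ennreal_leI sum_le_suminf)
    finally show ?thesis .
  qed
  have "total_variation M \<Omega> u \<le> liminf (\<lambda>n. upper_gradient_energy M \<Omega> (\<lambda>x. ereal (s n x)))"
    unfolding total_variation_def
  proof (rule INF_lower2[of s _ "\<lambda>v. liminf (\<lambda>n. upper_gradient_energy M \<Omega> (\<lambda>x. ereal (v n x)))", OF _ order_refl],
      intro CollectI conjI allI)
    fix n
    obtain L where "L-lipschitz_on UNIV (s n)" using s_bl by (auto simp: bounded_lipschitz_def)
    from lipschitz_on_subset[OF this subset_UNIV] show "locally_lipschitz_on \<Omega> (s n)"
      unfolding locally_lipschitz_on_def by (blast intro: zero_less_one)
    show "set_integrable M \<Omega> (s n)" by (intro bounded_lipschitz_set_integrable s_bl)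
  next
    have "(\<lambda>n. (\<Sum>k. a k) - (\<Sum>k<n. a k)) \<longlonglongrightarrow> (\<Sum>k. a k) - (\<Sum>k. a k)"
      by (rule tendsto_diff[OF tendsto_const summable_LIMSEQ[OF a(2)]])
    then have "(\<lambda>n. \<Sum>k. a (k + n)) \<longlonglongrightarrow> 0"
      by (simp add: suminf_minus_initial_segment[OF a(2)])
    from tendsto_ennrealI[OF this] have "(\<lambda>n. ennreal (\<Sum>k. a (k + n))) \<longlonglongrightarrow> 0" by simp
    then show "(\<lambda>n. L1_norm_on M \<Omega> (\<lambda>x. s n x - u x)) \<longlonglongrightarrow> 0"
      by (rule tendsto_sandwich[OF _ _ tendsto_const, rotated 2]) (simp_all add: tail)
  qed
  also have "\<dots> \<le> ennreal (\<Sum>k. b k)"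
    using energy by (intro Liminf_le always_eventually) auto
  finally show "BV_norm M \<Omega> u \<le> ennreal ((\<Sum>k. a k) + (\<Sum>k. b k))"
    unfolding BV_norm_def ennreal_plus[OF suminf_nonneg[OF a(2,3)] suminf_nonneg[OF b(2,3)]]
    by (rule add_mono[OF L1])
qed

text \<open>Reduces the limit over all radii to windows between consecutive values of
  \<open>\<rho> k / 2\<close>, on each of which a single error \<open>\<epsilon> k\<close> is
  enough.\<close>

lemma has_traceI:
  assumes z: "z \<in> S" and \<rho>: "\<And>k. 0 < \<rho> k" "\<rho> \<longlonglongrightarrow> 0" and \<epsilon>: "\<epsilon> \<longlonglongrightarrow> 0"
    and est: "\<And>k r. \<rho> (Suc k) / 2 \<le> r \<Longrightarrow> r < \<rho> k / 2 \<Longrightarrow>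
      L1_norm_on M (ball z r \<inter> \<Omega>) (\<lambda>y. u y - c) \<le> ennreal (\<epsilon> k * measure M (ball z r \<inter> \<Omega>))"
  shows "has_trace M \<Omega> u z c"
  unfolding has_trace_def
proof -
  let ?q = "\<lambda>r. L1_norm_on M (ball z r \<inter> \<Omega>) (\<lambda>y. u y - c) / emeasure M (ball z r \<inter> \<Omega>)"
  have "Limsup (at_right 0) ?q \<le> 0"
  proof (rule ennreal_le_epsilon)
    fix e :: real assume e: "0 < e"
    obtain K where K: "\<And>k. K \<le> k \<Longrightarrow> \<epsilon> k < e"
      using order_tendstoD(2)[OF \<epsilon> e] by (auto simp: eventually_sequentially)
    have "?q r \<le> ennreal e" if r: "0 < r" "r < \<rho> K / 2" for r
    proof -
      have "eventually (\<lambda>n. \<rho> n < 2 * r) sequentially" using order_tendstoD(2)[OF \<rho>(2)] r by simp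
      then obtain n0 where n0: "\<And>n. n0 \<le> n \<Longrightarrow> \<rho> n < 2 * r" by (auto simp: eventually_sequentially)
      \<comment> \<open>The window is found by minimality, since no monotonicity of \<rho> is at
        hand: \<open>n\<close> is not \<open>K\<close> because \<open>r < \<rho> K / 2\<close>, and
        its predecessor violates the condition.\<close>
      define n where "n = (LEAST n. K \<le> n \<and> \<rho> n / 2 \<le> r)"
      have n: "K \<le> n" "\<rho> n / 2 \<le> r"
        using LeastI[of "\<lambda>n. K \<le> n \<and> \<rho> n / 2 \<le> r" "max K n0"] n0[of "max K n0"]
        unfolding n_def by auto
      have "n \<noteq> K" using n r by auto
      with n obtain k where k: "n = Suc k" "K \<le> k" by (cases n) auto
      have "\<not> (K \<le> k \<and> \<rho> k / 2 \<le> r)"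
        using not_less_Least[of k "\<lambda>n. K \<le> n \<and> \<rho> n / 2 \<le> r"] k(1) unfolding n_def by auto
      then have "r < \<rho> k / 2" using k(2) by auto
      with n(2) k(1) have "L1_norm_on M (ball z r \<inter> \<Omega>) (\<lambda>y. u y - c) \<le> ennreal (\<epsilon> k * measure M (ball z r \<inter> \<Omega>))"
        by (intro est) auto
      also have "\<dots> \<le> ennreal (measure M (ball z r \<inter> \<Omega>) * e)"
        by (subst mult.commute) (intro ennreal_leI mult_left_mono less_imp_le[OF K[OF k(2)]] measure_nonneg)
      also have "\<dots> = emeasure M (ball z r \<inter> \<Omega>) * ennreal e"
        using ball_Int_domain_fmeasurable[of z r] e by (simp add: emeasure_eq_measure2 ennreal_mult)
      finally have le: "L1_norm_on M (ball z r \<inter> \<Omega>) (\<lambda>y. u y - c) \<le> emeasure M (ball z r \<inter> \<Omega>) * ennreal e" .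
      obtain m where "0 < m" "m \<le> measure M (ball z r \<inter> \<Omega>)"
        using domain_measure_lower_bound[OF r(1)] z by blast
      then have "0 < emeasure M (ball z r \<inter> \<Omega>)"
        using ball_Int_domain_fmeasurable[of z r] by (simp add: emeasure_eq_measure2)
      then show ?thesis using le by (rule divide_le_posI_ennreal)
    qed
    then have "eventually (\<lambda>r. ?q r \<le> ennreal e) (at_right 0)"
      using \<rho>(1)[of K] by (auto simp: eventually_at_right_field intro!: exI[of _ "\<rho> K / 2"])
    then show "Limsup (at_right 0) ?q \<le> 0 + ennreal e" by (simp add: Limsup_bounded)
  qed
  then show "Limsup (at_right 0) ?q = 0" by simp
qed

text \<open>Where the distance is at most \<open>r\<close> the weight is 1 and the product estimate
  applies. Beyond \<open>r\<close> the layer vanishes in a whole neighbourhood of \<open>x\<close>;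
  this is why the bound is asked only for \<open>y\<close> near \<open>x\<close>.\<close>

lemma layer_slope:
  fixes h :: "'a \<Rightarrow> real"
  assumes L: "L-lipschitz_on UNIV h" and r: "0 < r"
  shows "eventually (\<lambda>y. \<bar>max 0 (min 1 (2 - 2 / r * infdist y S)) * h y
            - max 0 (min 1 (2 - 2 / r * infdist x S)) * h x\<bar>
          \<le> (L + 2 / r * \<bar>h x\<bar>) * max 0 (min 1 (2 - 1 / r * infdist x S)) * dist y x) (nhds x)"
proof (cases "infdist x S \<le> r")
  case True
  define \<psi> where "\<psi> y = max 0 (min 1 (2 - 2 / r * infdist y S))" for y
  have lip: "(2 / r)-lipschitz_on UNIV \<psi>"
    unfolding \<psi>_def using r by (intro bounded_lipschitz_cutoff) simp
  have "\<bar>\<psi> y\<bar> \<le> 1" for y by (simp add: \<psi>_def)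
  then have "\<bar>\<psi> y * h y - \<psi> x * h x\<bar> \<le> (L + 2 / r * \<bar>h x\<bar>) * 1 * dist y x" for y
    using lipschitz_product_slope[OF lip _ L, of y x] by simp
  then show ?thesis
    unfolding cutoff_values(3)[OF r True] \<psi>_def by (rule always_eventually[OF allI])
next
  case False
  have "open {y. r < infdist y S}"
    by (intro open_Collect_less continuous_on_const continuous_on_infdist continuous_on_id)
  then have "eventually (\<lambda>y. y \<in> {y. r < infdist y S}) (nhds x)"
    using False by (intro eventually_nhds_in_open) auto
  then show ?thesis
  proof eventually_elim
    case (elim y)
    have "0 \<le> (L + 2 / r * \<bar>h x\<bar>) * max 0 (min 1 (2 - 1 / r * infdist x S)) * dist y x"
      using lipschitz_on_nonneg[OF L] r by (intro mult_nonneg_nonneg add_nonneg_nonneg) auto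
    then show ?case
      using elim False cutoff_values(2)[OF r, of "infdist y S"] cutoff_values(2)[OF r, of "infdist x S"] by simp
  qed
qed

text \<open>The constant comes before \<open>f\<close>, since \<open>32 * K\<close> depends only on
  the strip estimate. The choice of one \<open>u\<close> for each \<open>f\<close> is left to the
  end, where it has to respect equality almost everywhere.\<close>

lemma extension_exists:
  "\<exists>C\<ge>0. \<forall>f. integrable N f \<longrightarrow> (\<exists>u. set_integrable M \<Omega> u \<and>
     BV_norm M \<Omega> u \<le> ennreal (C * (\<integral>z. \<bar>f z\<bar> \<partial>N)) \<and> (AE z in N. has_trace M \<Omega> u z (f z)))"
proof -
  obtain K where K: "0 < K"
    and strip: "\<And>h L \<rho>. bounded_lipschitz h \<Longrightarrow> L-lipschitz_on UNIV h \<Longrightarrow> 0 < \<rho> \<Longrightarrow> \<rho> \<le> diameter \<Omega> \<Longrightarrow> S \<noteq> {} \<Longrightarrow>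
      (\<integral>\<^sup>+x\<in>{x. infdist x S < 2 * \<rho>}. ennreal \<bar>h x\<bar> \<partial>M)
        \<le> ennreal (K * \<rho> * ((\<integral>x. \<bar>h x\<bar> \<partial>N) + \<rho> * L * measure N S))"
    using strip_estimate by blast
  have "\<exists>u. set_integrable M \<Omega> u \<and> BV_norm M \<Omega> u \<le> ennreal (32 * K * (\<integral>z. \<bar>f z\<bar> \<partial>N)) \<and>
      (AE z in N. has_trace M \<Omega> u z (f z))"
    if f: "integrable N f" for f
  \<comment> \<open>A datum of norm zero leaves no positive tolerances for the decomposition, and
    its extension must have norm zero; the zero function is taken.\<close>
  proof (cases "(\<integral>z. \<bar>f z\<bar> \<partial>N) = 0")
    case True
    note zero = BV_series[where v="\<lambda>_ _. 0" and g="\<lambda>_ _. 0" and u="\<lambda>_. 0" and a="\<lambda>_. 0" and b="\<lambda>_. 0"]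
    have "set_integrable M \<Omega> (\<lambda>_. 0 :: real)"
      by (rule zero(1)) (simp_all add: bounded_lipschitz_const)
    moreover have "BV_norm M \<Omega> (\<lambda>_. 0) \<le> ennreal ((\<Sum>k. 0) + (\<Sum>k. 0))"
      by (rule zero(2)) (simp_all add: bounded_lipschitz_const)
    moreover have "AE z in N. f z = 0"
      using True f integral_nonneg_eq_0_iff_AE[of N "\<lambda>z. \<bar>f z\<bar>"] by simp
    then have "AE z in N. has_trace M \<Omega> (\<lambda>_. 0) z (f z)"
      by eventually_elim (simp add: has_trace_def L1_norm_on_def Limsup_const)
    ultimately show ?thesis using True by (intro exI[of _ "\<lambda>_. 0"]) simp
  next
    case False
    define F where "F = (\<integral>z. \<bar>f z\<bar> \<partial>N)"
    have "0 \<le> F" unfolding F_def by (rule integral_nonneg_AE) simp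
    moreover have "F \<noteq> 0" using False by (simp add: F_def)
    ultimately have F: "0 < F" by linarith
    have ne: "S \<noteq> {}"
    proof
      assume "S = {}"
      then have "F = (\<integral>z. 0 \<partial>N)"
        unfolding F_def by (intro Bochner_Integration.integral_cong) (simp_all add: space_codim1_measure)
      with F show False by simp
    qed
    then have diam: "0 < diameter \<Omega>" using diameter_pos by blast
    obtain h where h: "\<And>k. bounded_lipschitz (h k)"
      and h_int: "\<And>k. (\<integral>z. \<bar>h k z\<bar> \<partial>N) \<le> 4 * (1/2) ^ k * F"
      and h_lim: "AE z in N. (\<lambda>n. \<Sum>k<n. h k z) \<longlonglongrightarrow> f z"
      by (rule N.lipschitz_decomposition[OF integrable_imp_approximable[OF f] F[unfolded F_def], folded F_def])
        (rule that)
    have "\<forall>k. \<exists>L. L-lipschitz_on UNIV (h k)" using h by (auto simp: bounded_lipschitz_def)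
    from choice[OF this] obtain L where L: "\<And>k. (L k)-lipschitz_on UNIV (h k)" by blast
    have L0: "0 \<le> L k" for k using L by (rule lipschitz_on_nonneg)
    have "\<forall>r. \<exists>m. 0 < r \<longrightarrow> 0 < m \<and> (\<forall>z\<in>S. m \<le> measure M (ball z r \<inter> \<Omega>))"
      using domain_measure_lower_bound by blast
    from choice[OF this] obtain m where m: "\<And>r. 0 < r \<Longrightarrow> 0 < m r"
      "\<And>r z. 0 < r \<Longrightarrow> z \<in> S \<Longrightarrow> m r \<le> measure M (ball z r \<inter> \<Omega>)" by blast
    define H where "H = measure N S"
    define A where "A k = (\<integral>z. \<bar>h k z\<bar> \<partial>N)" for k
    have HA: "0 \<le> H" "0 \<le> A k" for k by (auto simp: H_def A_def)
    (* The summands of c bound, in turn, \<rho> k itself, the boundary error of the k-th strip, the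
       oscillation at scale \<rho> k of the first k + 2 layers, and the mass of the k-th layer. *)
    define c where "c k = 1 + L k * H + (\<Sum>j\<le>Suc k. L j) + K * (A k + F)" for k
    have c_ge: "1 \<le> c k" "L k * H \<le> c k" "(\<Sum>j\<le>Suc k. L j) \<le> c k" "K * (A k + F) \<le> c k" for k
      using HA L0 K F unfolding c_def
      by (auto intro!: add_nonneg_nonneg mult_nonneg_nonneg sum_nonneg add_increasing add_increasing2)
    \<comment> \<open>In \<open>min 1 F\<close>, the 1 serves estimates that only have to vanish as
      \<open>k\<close> grows, such as the oscillation in the trace, and \<open>F\<close> those that
      have to be proportional to the norm of \<open>f\<close>.\<close>
    obtain \<rho> where \<rho>: "\<And>k. 0 < \<rho> k" "\<And>k. \<rho> k \<le> diameter \<Omega>"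
      and \<rho>_c: "\<And>k. \<rho> k * c k \<le> (1/2) ^ k * min 1 F"
      and \<rho>_Suc: "\<And>k. \<rho> (Suc k) \<le> \<rho> k"
      and \<rho>_m: "\<And>k. \<rho> (Suc k) * c (Suc k) \<le> (1/2) ^ Suc k * m (\<rho> k / 2)"
      by (rule exists_layer_radii[of "diameter \<Omega>" "min 1 F" c m])
        (use diam F m c_ge(1) in \<open>auto intro: less_le_trans[OF zero_less_one]\<close>)
    have half: "(1/2) ^ k * min 1 F \<le> (1/2) ^ k" "(1/2) ^ k * min 1 F \<le> (1/2) ^ k * F" for k :: nat
      by (auto simp: mult_left_le)
    have \<rho>_mult: "\<rho> k * t \<le> (1/2) ^ k * min 1 F" if "t \<le> c k" for k t
      using mult_left_mono[OF that less_imp_le[OF \<rho>(1)]] \<rho>_c by (rule order_trans)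
    have \<rho>_half: "\<rho> k \<le> (1/2) ^ k" for k
      using order_trans[OF \<rho>_mult[OF c_ge(1)] half(1), of k] by simp
    have \<rho>_LH: "\<rho> k * L k * H \<le> (1/2) ^ k * F" for k
      using order_trans[OF \<rho>_mult[OF c_ge(2)] half(2), of k] by (simp add: mult.assoc)
    have \<rho>_sum: "(\<Sum>j\<le>Suc k. L j) * \<rho> k \<le> (1/2) ^ k" for k
      using order_trans[OF \<rho>_mult[OF c_ge(3)] half(1), of k] by (simp add: mult.commute)
    have \<rho>_le1: "\<rho> k \<le> 1" for k
      using \<rho>_half[of k] by (rule order_trans) (simp add: power_le_one)
    have \<rho>_anti: "\<rho> j \<le> \<rho> i" if "i \<le> j" for i j
      using \<rho>_Suc that by (rule lift_Suc_antimono_le)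
    have \<rho>_lim: "\<rho> \<longlonglongrightarrow> 0"
      by (rule tendsto_sandwich[OF _ _ tendsto_const LIMSEQ_power_zero[of "1/2 :: real"]])
        (simp_all add: \<rho>_half less_imp_le[OF \<rho>(1)])
    let ?strip = "\<lambda>k. {x. infdist x S < 2 * \<rho> k}"
    have strip_h: "(\<integral>\<^sup>+x\<in>?strip k. ennreal \<bar>h k x\<bar> \<partial>M) \<le> ennreal (K * \<rho> k * (A k + \<rho> k * L k * H))" for k
      unfolding A_def H_def by (intro strip h L \<rho> ne)
    \<comment> \<open>The constant function 1, with Lipschitz constant 0, bounds the measure of the
      strip.\<close>
    have strip_1: "(\<integral>\<^sup>+x\<in>?strip k. 1 \<partial>M) \<le> ennreal (K * \<rho> k * H)" for k
      using strip[OF bounded_lipschitz_const[of 1] lipschitz_on_constant[of _ 1] \<rho>[of k] ne]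
      by (simp add: H_def space_codim1_measure)
    define v where "v k x = max 0 (min 1 (2 - 2 / \<rho> k * infdist x S)) * h k x" for k x
    define g where "g k x = (L k + 2 / \<rho> k * \<bar>h k x\<bar>) * max 0 (min 1 (2 - 1 / \<rho> k * infdist x S))" for k x
    define u where "u x = (\<Sum>k. v k x)" for x
    have v_bl: "bounded_lipschitz (v k)" for k
      unfolding v_def using \<rho>(1)[of k]
      by (intro bounded_lipschitz_mult bounded_lipschitz_cutoff h) simp
    have v_le: "\<bar>v k x\<bar> \<le> \<bar>h k x\<bar>" for k x
      unfolding v_def abs_mult by (intro mult_left_le_one_le) auto
    have v_0: "v k x = 0" if "\<rho> k \<le> infdist x S" for k x
      using cutoff_values(2)[OF \<rho>(1) that] by (simp add: v_def)
    have v_1: "v k x = h k x" if "infdist x S \<le> \<rho> k / 2" for k x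
      using cutoff_values(1)[OF \<rho>(1) that] by (simp add: v_def)
    \<comment> \<open>\<open>E\<close> is arbitrary because the bound serves the whole domain for
      the norm and small balls for the trace.\<close>
    have v_strip: "(\<integral>\<^sup>+x\<in>E. ennreal \<bar>v k x\<bar> \<partial>M) \<le> ennreal (K * \<rho> k * (A k + \<rho> k * L k * H))" for k E
    proof -
      have "(\<integral>\<^sup>+x\<in>E. ennreal \<bar>v k x\<bar> \<partial>M) \<le> (\<integral>\<^sup>+x\<in>?strip k. ennreal \<bar>h k x\<bar> \<partial>M)"
      proof (rule nn_integral_mono)
        fix x
        show "ennreal \<bar>v k x\<bar> * indicator E x \<le> ennreal \<bar>h k x\<bar> * indicator (?strip k) x"
          using v_0[of k x] v_le[of k x] \<rho>(1)[of k]
          by (cases "infdist x S < 2 * \<rho> k") (auto simp: indicator_def ennreal_leI)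
      qed
      then show ?thesis using strip_h by (rule order_trans)
    qed
    \<comment> \<open>The 5 is 4 from the decomposition of \<open>f\<close> plus 1 from the boundary
      error of the strip.\<close>
    have layer_mass: "A k + \<rho> k * L k * H \<le> 5 * (1/2) ^ k * F" for k
      using h_int[of k] \<rho>_LH[of k] by (simp add: A_def)
    \<comment> \<open>The radii tend to zero, so at positive distance from the boundary only
      finitely many layers are nonzero.\<close>
    have summable_v: "summable (\<lambda>k. \<bar>v k x\<bar>)" if "x \<in> \<Omega>" for x
    proof -
      have "x \<notin> S" using boundary_disjoint that by blast
      then have "0 < infdist x S"
        using in_closed_iff_infdist_zero[OF frontier_closed ne, of x] infdist_nonneg[of x S] by linarith
      then obtain n where "\<And>k. n \<le> k \<Longrightarrow> \<rho> k < infdist x S"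
        using order_tendstoD(2)[OF \<rho>_lim] by (auto simp: eventually_sequentially)
      then show ?thesis
        by (intro summable_finite[of "{..<n}"]) (auto intro!: v_0 less_imp_le)
    qed
    have geometric: "summable (\<lambda>k. q * (1/2) ^ k :: real)" "(\<Sum>k. q * (1/2) ^ k :: real) = 2 * q" for q
      by (auto intro: summable_mult summable_geometric simp: suminf_mult suminf_geometric)
    have g_cont: "continuous_on UNIV (g k)" for k
      unfolding g_def
      by (intro continuous_intros bounded_lipschitz_continuous h continuous_on_infdist)
    have g_nonneg: "0 \<le> g k x" for k x
      unfolding g_def using L0[of k] \<rho>(1)[of k] by (intro mult_nonneg_nonneg add_nonneg_nonneg) auto
    have slope: "eventually (\<lambda>y. \<bar>v k y - v k x\<bar> \<le> g k x * dist y x) (nhds x)" for k x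
      unfolding v_def g_def by (rule layer_slope[OF L \<rho>(1)])
    have v_int: "(\<integral>\<^sup>+x\<in>\<Omega>. ennreal \<bar>v k x\<bar> \<partial>M) \<le> ennreal (5 * K * F * (1/2) ^ k)" for k
    proof -
      have "K * \<rho> k * (A k + \<rho> k * L k * H) \<le> K * 1 * (5 * (1/2) ^ k * F)"
        using K \<rho>(1)[of k] \<rho>_le1[of k] layer_mass[of k] HA L0[of k] by (intro mult_mono) auto
      then show ?thesis using v_strip[of k \<Omega>] by (auto intro: order_trans ennreal_leI simp: mult_ac)
    qed
    \<comment> \<open>The factor \<open>\<rho> k\<close> of the strip cancels
      \<open>1 / \<rho> k\<close> from the cutoff and makes the \<open>L k\<close> term small. The
      11 is 1 for that term plus twice the 5 of \<open>layer_mass\<close>.\<close>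
    have g_int: "(\<integral>\<^sup>+x\<in>\<Omega>. ennreal (g k x) \<partial>M) \<le> ennreal (11 * K * F * (1/2) ^ k)" for k
    proof -
      have meas: "h k \<in> borel_measurable M" "?strip k \<in> sets M"
        by (intro bounded_lipschitz_measurable_M h,
            intro open_in_sets open_Collect_less continuous_intros continuous_on_infdist)
      have nn: "0 \<le> L k" "0 \<le> K * \<rho> k * H" "0 \<le> 2 / \<rho> k" "0 \<le> K * \<rho> k * (A k + \<rho> k * L k * H)"
        using L0[of k] HA(1) HA(2)[of k] K \<rho>(1)[of k] by simp_all
      have "(\<integral>\<^sup>+x\<in>\<Omega>. ennreal (g k x) \<partial>M)
        \<le> (\<integral>\<^sup>+x. ennreal (L k) * (1 * indicator (?strip k) x)
            + ennreal (2 / \<rho> k) * (ennreal \<bar>h k x\<bar> * indicator (?strip k) x) \<partial>M)"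
      proof (rule nn_integral_mono)
        fix x
        show "ennreal (g k x) * indicator \<Omega> x \<le> ennreal (L k) * (1 * indicator (?strip k) x)
            + ennreal (2 / \<rho> k) * (ennreal \<bar>h k x\<bar> * indicator (?strip k) x)"
        proof (cases "infdist x S < 2 * \<rho> k")
          case True
          have "g k x \<le> L k + 2 / \<rho> k * \<bar>h k x\<bar>"
            unfolding g_def using L0[of k] \<rho>(1)[of k] by (intro mult_right_le_one_le) auto
          then have "ennreal (g k x) \<le> ennreal (L k) + ennreal (2 / \<rho> k) * ennreal \<bar>h k x\<bar>"
            using L0[of k] \<rho>(1)[of k] by (simp add: ennreal_leI flip: ennreal_mult ennreal_plus)
          then show ?thesis using True by (auto simp: indicator_def)
        next
          case False
          then have "g k x = 0" using cutoff_values(4)[OF \<rho>(1), of k "infdist x S"] by (simp add: g_def)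
          then show ?thesis by simp
        qed
      qed
      also have "\<dots> = ennreal (L k) * (\<integral>\<^sup>+x\<in>?strip k. 1 \<partial>M) + ennreal (2 / \<rho> k) * (\<integral>\<^sup>+x\<in>?strip k. ennreal \<bar>h k x\<bar> \<partial>M)"
        using meas by (subst nn_integral_add) (simp_all add: nn_integral_cmult)
      also have "\<dots> \<le> ennreal (L k) * ennreal (K * \<rho> k * H) + ennreal (2 / \<rho> k) * ennreal (K * \<rho> k * (A k + \<rho> k * L k * H))"
        by (intro add_mono mult_left_mono strip_1 strip_h) auto
      also have "\<dots> = ennreal (L k * (K * \<rho> k * H) + 2 / \<rho> k * (K * \<rho> k * (A k + \<rho> k * L k * H)))"
        by (simp only: ennreal_plus[OF mult_nonneg_nonneg[OF nn(1,2)] mult_nonneg_nonneg[OF nn(3,4)]]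
            ennreal_mult[OF nn(1,2)] ennreal_mult[OF nn(3,4)])
      also have "L k * (K * \<rho> k * H) + 2 / \<rho> k * (K * \<rho> k * (A k + \<rho> k * L k * H))
          = K * (\<rho> k * L k * H + 2 * (A k + \<rho> k * L k * H))"
        using \<rho>(1)[of k] by (simp add: field_simps)
      also have "\<dots> \<le> K * ((1/2) ^ k * F + 2 * (5 * (1/2) ^ k * F))"
        using K by (intro mult_left_mono add_mono \<rho>_LH layer_mass) auto
      also have "\<dots> = 11 * K * F * (1/2) ^ k" by (simp add: algebra_simps)
      finally show ?thesis by (simp add: ennreal_leI)
    qed
    have nonneg: "0 \<le> 5 * K * F * (1/2) ^ k" "0 \<le> 11 * K * F * (1/2) ^ k" for k
      using K F by simp_all
    note BV = BV_series[OF v_bl g_cont g_nonneg slope summable_v u_def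
        v_int geometric(1) nonneg(1) g_int geometric(1) nonneg(2)]
    \<comment> \<open>Each geometric series doubles its first term, and twice \<open>5 + 11\<close>
      is 32.\<close>
    have "(\<Sum>k. 5 * K * F * (1/2) ^ k) + (\<Sum>k. 11 * K * F * (1/2) ^ k) = 32 * K * F"
      unfolding geometric by simp
    with BV(2) have norm: "BV_norm M \<Omega> u \<le> ennreal (32 * K * F)" by simp
    have "AE z in N. has_trace M \<Omega> u z (f z)"
      using h_lim AE_space
    proof eventually_elim
      case (elim z)
      then have z: "z \<in> S" by (simp add: space_codim1_measure)
      \<comment> \<open>The pointwise error at \<open>z\<close>: the remainder of the series and the
        layer \<open>k + 1\<close>, which may be partly cut off at the scales considered.\<close>
      define a where "a k = \<bar>(\<Sum>j<Suc k. h j z) - f z\<bar> + \<bar>h (Suc k) z\<bar>" for k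
      have "(\<lambda>k. (\<Sum>j<Suc (Suc k). h j z) - (\<Sum>j<Suc k. h j z)) \<longlonglongrightarrow> f z - f z"
        by (intro tendsto_diff LIMSEQ_Suc elim)
      then have "(\<lambda>k. h (Suc k) z) \<longlonglongrightarrow> 0" by simp
      then have "(\<lambda>k. a k) \<longlonglongrightarrow> \<bar>f z - f z\<bar> + \<bar>0\<bar>"
        unfolding a_def by (intro tendsto_add tendsto_rabs tendsto_diff LIMSEQ_Suc[OF elim(1)] tendsto_const)
      then have a_lim: "a \<longlonglongrightarrow> 0" by simp
      have "(\<lambda>k. (1/2) ^ k + a k + (1/2) ^ Suc k) \<longlonglongrightarrow> 0 + 0 + 0"
        by (intro tendsto_add a_lim LIMSEQ_power_zero LIMSEQ_Suc) auto
      then have \<epsilon>_lim: "(\<lambda>k. (1/2) ^ k + a k + (1/2) ^ Suc k) \<longlonglongrightarrow> 0" by simp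
      show ?case
      proof (rule has_traceI[OF z \<rho>(1) \<rho>_lim \<epsilon>_lim])
        fix k r assume r: "\<rho> (Suc k) / 2 \<le> r" "r < \<rho> k / 2"
        let ?E = "ball z r \<inter> \<Omega>"
        have E: "?E \<in> sets M" by (intro sets.Int) (simp_all add: domain_in_sets)
        have r0: "0 < r" using r(1) \<rho>(1)[of "Suc k"] by linarith
        \<comment> \<open>Layer \<open>i + 1\<close> is small relative to balls of radius
          \<open>\<rho> i / 2\<close>, which must not exceed \<open>r\<close>. This is guaranteed
          from \<open>i = k + 1\<close> on, whence the shift by 2.\<close>
        have tail: "(\<integral>\<^sup>+x\<in>?E. ennreal \<bar>v (j + (k + 2)) x\<bar> \<partial>M) \<le> ennreal (measure M ?E * (1/2) ^ (j + (k + 2)))" for j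
        proof -
          define i where "i = j + (k + 1)"
          have i: "j + (k + 2) = Suc i" by (simp add: i_def)
          have "A (Suc i) + \<rho> (Suc i) * L (Suc i) * H \<le> A (Suc i) + F"
          proof -
            have "(1/2) ^ Suc i * F \<le> 1 * F" using F by (intro mult_right_mono power_le_one) auto
            then show ?thesis using \<rho>_LH[of "Suc i"] by linarith
          qed
          then have "K * \<rho> (Suc i) * (A (Suc i) + \<rho> (Suc i) * L (Suc i) * H) \<le> K * \<rho> (Suc i) * (A (Suc i) + F)"
            using K \<rho>(1)[of "Suc i"] by (intro mult_left_mono) auto
          also have "\<dots> = \<rho> (Suc i) * (K * (A (Suc i) + F))" by simp
          also have "\<dots> \<le> \<rho> (Suc i) * c (Suc i)"
            using \<rho>(1)[of "Suc i"] by (intro mult_left_mono c_ge) auto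
          also have "\<dots> \<le> (1/2) ^ Suc i * m (\<rho> i / 2)" by (rule \<rho>_m)
          also have "\<dots> \<le> (1/2) ^ Suc i * measure M ?E"
          proof (rule mult_left_mono)
            have "m (\<rho> i / 2) \<le> measure M (ball z (\<rho> i / 2) \<inter> \<Omega>)"
              using \<rho>(1)[of i] z by (intro m(2)) auto
            also have "\<dots> \<le> measure M ?E"
            proof (rule measure_mono_fmeasurable)
              have "\<rho> i / 2 \<le> r" using \<rho>_anti[of "Suc k" i] r(1) by (simp add: i_def)
              then show "ball z (\<rho> i / 2) \<inter> \<Omega> \<subseteq> ?E" by auto
            qed (auto intro: ball_Int_domain_fmeasurable domain_in_sets)
            finally show "m (\<rho> i / 2) \<le> measure M ?E" .
          qed simp
          finally have "K * \<rho> (Suc i) * (A (Suc i) + \<rho> (Suc i) * L (Suc i) * H) \<le> measure M ?E * (1/2) ^ Suc i"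
            by (simp add: mult.commute)
          then show ?thesis unfolding i by (intro order_trans[OF v_strip] ennreal_leI)
        qed
        have "L1_norm_on M ?E (\<lambda>y. u y - f z)
          \<le> (\<integral>\<^sup>+x. ennreal ((1/2) ^ k + a k) * indicator ?E x + ennreal (\<Sum>j. \<bar>v (j + (k + 2)) x\<bar>) * indicator ?E x \<partial>M)"
          unfolding L1_norm_on_def
        proof (rule nn_integral_mono)
          fix x
          show "ennreal \<bar>u x - f z\<bar> * indicator ?E x
            \<le> ennreal ((1/2) ^ k + a k) * indicator ?E x + ennreal (\<Sum>j. \<bar>v (j + (k + 2)) x\<bar>) * indicator ?E x"
          proof (cases "x \<in> ?E")
            case True
            then have x: "x \<in> \<Omega>" "dist x z < r" by (auto simp: dist_commute)
            have shift: "summable (\<lambda>j. \<bar>v (j + (k + 2)) x\<bar>)"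
              by (intro summable_ignore_initial_segment summable_v x)
            \<comment> \<open>In a ball of radius below \<open>\<rho> k / 2\<close> about
              \<open>z\<close> the layers up to \<open>k\<close> are not cut off.\<close>
            have "infdist x S \<le> \<rho> j / 2" if "j < Suc k" for j
              using infdist_le[OF z, of x] x(2) r(2) \<rho>_anti[of j k] that by simp
            then have "(\<Sum>j<Suc k. v j x) = (\<Sum>j<Suc k. h j x)"
              by (intro sum.cong v_1) auto
            then have "(\<Sum>j<k + 2. v j x) = (\<Sum>j<Suc k. h j x) + v (Suc k) x" by simp
            then have u_eq: "u x = (\<Sum>j<Suc k. h j x) + v (Suc k) x + (\<Sum>j. v (j + (k + 2)) x)"
              using suminf_split_initial_segment[OF summable_rabs_cancel[OF summable_v[OF x(1)]], of "k + 2"]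
              by (simp add: u_def)
            have diff: "\<bar>h j x - h j z\<bar> \<le> L j * \<rho> k" for j
            proof -
              have "\<bar>h j x - h j z\<bar> \<le> L j * dist x z"
                using lipschitz_onD[OF L, of x z j] by (simp add: dist_real_def)
              also have "\<dots> \<le> L j * \<rho> k"
                using x(2) r(2) \<rho>(1)[of k] L0 by (intro mult_left_mono) auto
              finally show ?thesis .
            qed
            have "\<bar>(\<Sum>j<Suc k. h j x) - (\<Sum>j<Suc k. h j z)\<bar> \<le> (\<Sum>j<Suc k. L j * \<rho> k)"
              unfolding sum_subtractf[symmetric] by (intro order_trans[OF sum_abs] sum_mono diff)
            moreover have "\<bar>v (Suc k) x\<bar> \<le> \<bar>h (Suc k) z\<bar> + L (Suc k) * \<rho> k"
              using v_le[of "Suc k" x] diff[of "Suc k"] by linarith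
            \<comment> \<open>Here the sum in \<open>c\<close> has to run up to
              \<open>Suc k\<close>: the transitional layer also oscillates at scale
              \<open>\<rho> k\<close>.\<close>
            moreover have "(\<Sum>j<Suc k. L j * \<rho> k) + L (Suc k) * \<rho> k \<le> (1/2) ^ k"
              using \<rho>_sum[of k] by (simp add: lessThan_Suc_atMost sum_distrib_right distrib_right)
            moreover have "\<bar>\<Sum>j. v (j + (k + 2)) x\<bar> \<le> (\<Sum>j. \<bar>v (j + (k + 2)) x\<bar>)"
              by (rule summable_rabs[OF shift])
            ultimately have "\<bar>u x - f z\<bar> \<le> (1/2) ^ k + a k + (\<Sum>j. \<bar>v (j + (k + 2)) x\<bar>)"
              unfolding u_eq a_def by linarith
            moreover have "0 \<le> (1/2) ^ k + a k" by (simp add: a_def)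
            moreover have "0 \<le> (\<Sum>j. \<bar>v (j + (k + 2)) x\<bar>)" by (intro suminf_nonneg shift) simp
            ultimately show ?thesis
              using True by (simp add: ennreal_leI flip: ennreal_plus)
          qed simp
        qed
        also have "\<dots> = (\<integral>\<^sup>+x\<in>?E. ennreal ((1/2) ^ k + a k) \<partial>M) + (\<integral>\<^sup>+x\<in>?E. ennreal (\<Sum>j. \<bar>v (j + (k + 2)) x\<bar>) \<partial>M)"
        proof (rule nn_integral_add)
          have "(\<lambda>x. \<Sum>j. \<bar>v (j + (k + 2)) x\<bar>) \<in> borel_measurable M"
            by (intro borel_measurable_suminf borel_measurable_abs bounded_lipschitz_measurable_M v_bl)
          then show "(\<lambda>x. ennreal (\<Sum>j. \<bar>v (j + (k + 2)) x\<bar>) * indicator ?E x) \<in> borel_measurable M"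
            using E by simp
        qed (use E in simp)
        also have "\<dots> \<le> ennreal (((1/2) ^ k + a k) * measure M ?E) + ennreal (\<Sum>j. measure M ?E * (1/2) ^ (j + (k + 2)))"
        proof (rule add_mono)
          show "(\<integral>\<^sup>+x\<in>?E. ennreal ((1/2) ^ k + a k) \<partial>M) \<le> ennreal (((1/2) ^ k + a k) * measure M ?E)"
            using E ball_Int_domain_fmeasurable[of z r]
            by (simp add: nn_integral_cmult_indicator emeasure_eq_measure2 ennreal_mult a_def)
          show "(\<integral>\<^sup>+x\<in>?E. ennreal (\<Sum>j. \<bar>v (j + (k + 2)) x\<bar>) \<partial>M) \<le> ennreal (\<Sum>j. measure M ?E * (1/2) ^ (j + (k + 2)))"
          proof (rule nn_integral_abs_series_le[OF E bounded_lipschitz_measurable_M[OF v_bl] _ tail])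
            show "summable (\<lambda>j. \<bar>v (j + (k + 2)) x\<bar>)" if "x \<in> ?E" for x
              using that by (intro summable_ignore_initial_segment summable_v) blast
          qed (intro summable_ignore_initial_segment geometric, simp)
        qed
        also have "(\<Sum>j. measure M ?E * (1/2) ^ (j + (k + 2))) = (1/2) ^ Suc k * measure M ?E"
          using geometric(2)[of "measure M ?E * (1/2) ^ (k + 2)"] by (simp add: power_add mult_ac)
        also have "ennreal (((1/2) ^ k + a k) * measure M ?E) + ennreal ((1/2) ^ Suc k * measure M ?E)
            = ennreal (((1/2) ^ k + a k + (1/2) ^ Suc k) * measure M ?E)"
          by (simp add: a_def distrib_right flip: ennreal_plus)
        finally show "L1_norm_on M ?E (\<lambda>y. u y - f z) \<le> ennreal (((1/2) ^ k + a k + (1/2) ^ Suc k) * measure M ?E)" .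
      qed
    qed
    with BV(1) norm show ?thesis by (auto simp: F_def)
  qed
  with K show ?thesis by (intro exI[of _ "32 * K"]) auto
qed

end

theorem theorem1p2:
  fixes M :: "'a::complete_space measure" and \<Omega> :: "'a set"
  assumes "borel_regular M" and "doubling M"
    and "open \<Omega>" and "connected \<Omega>" and "\<Omega> \<noteq> {}" and "bounded \<Omega>"
    and "codim1_ahlfors_regular_boundary M \<Omega>"
  shows "\<exists>Ext. bounded_extension_operator M \<Omega> Ext \<and>
           (\<forall>f. integrable (codim1_measure M (frontier \<Omega>)) f \<longrightarrow>
              (AE z in codim1_measure M (frontier \<Omega>). has_trace M \<Omega> (Ext f) z (f z)))"
proof -
  interpret codim1_domain M \<Omega>
    using assms by unfold_locales
  obtain C where C: "0 \<le> C" "\<And>f. integrable N f \<Longrightarrow> \<exists>u. set_integrable M \<Omega> u \<and>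
     BV_norm M \<Omega> u \<le> ennreal (C * (\<integral>z. \<bar>f z\<bar> \<partial>N)) \<and> (AE z in N. has_trace M \<Omega> u z (f z))"
    using extension_exists by blast
  \<comment> \<open>\<open>good f\<close> depends on \<open>f\<close> only through its norm and a
    condition almost everywhere. Equivalent functions therefore have the same predicate, and
    \<open>SOME\<close> picks the same extension for both; separate choices for each representative
    need not give an operator on classes.\<close>
  define good where "good f u \<longleftrightarrow> set_integrable M \<Omega> u \<and>
     BV_norm M \<Omega> u \<le> ennreal (C * (\<integral>z. \<bar>f z\<bar> \<partial>N)) \<and> (AE z in N. has_trace M \<Omega> u z (f z))" for f u
  define Ext where "Ext f = (SOME u. good f u)" for f
  have Ext: "good f (Ext f)" if "integrable N f" for f
  proof -
    have "\<exists>u. good f u" using C(2)[OF that] by (simp add: good_def)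
    then show ?thesis unfolding Ext_def by (rule someI_ex)
  qed
  have Ext_cong: "Ext f = Ext g"
    if "integrable N f" "integrable N g" "AE z in N. f z = g z" for f g
  proof -
    have int: "(\<integral>z. \<bar>f z\<bar> \<partial>N) = (\<integral>z. \<bar>g z\<bar> \<partial>N)"
      using that(3)
      by (intro integral_cong_AE borel_measurable_abs borel_measurable_integrable that(1,2)) (auto elim: eventually_mono)
    have trace: "(AE z in N. has_trace M \<Omega> u z (f z)) \<longleftrightarrow> (AE z in N. has_trace M \<Omega> u z (g z))" for u
    proof (rule eventually_subst)
      show "AE z in N. has_trace M \<Omega> u z (f z) \<longleftrightarrow> has_trace M \<Omega> u z (g z)"
        using that(3) by eventually_elim simp
    qed
    have "good f = good g"
      by (rule ext) (simp only: good_def int trace)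
    then show ?thesis by (simp only: Ext_def)
  qed
  have L1: "ennreal (\<integral>z. \<bar>f z\<bar> \<partial>N) = L1_norm_on N S f" if "integrable N f" for f
  proof -
    have "L1_norm_on N S f = (\<integral>\<^sup>+z. ennreal \<bar>f z\<bar> \<partial>N)"
      unfolding L1_norm_on_def by (intro nn_integral_cong) (simp add: space_codim1_measure)
    then show ?thesis using that by (simp add: nn_integral_eq_integral)
  qed
  have "bounded_extension_operator M \<Omega> Ext"
    unfolding bounded_extension_operator_def
  proof (intro conjI allI impI exI[of _ C])
    fix f :: "'a \<Rightarrow> real" assume f: "integrable N f"
    show "Ext f \<in> BV M \<Omega>"
      unfolding BV_def mem_Collect_eq infinity_ennreal_def
      using Ext[OF f] unfolding good_def by (blast intro: le_less_trans[OF _ ennreal_less_top])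
    show "BV_norm M \<Omega> (Ext f) \<le> ennreal C * L1_norm_on N S f"
      using Ext[OF f] unfolding good_def L1[OF f, symmetric] by (simp add: ennreal_mult'[OF C(1)])
  next
    fix f g :: "'a \<Rightarrow> real" assume "integrable N f" "integrable N g" "AE z in N. f z = g z"
    then have "Ext f = Ext g" by (rule Ext_cong)
    then show "AE y in M. y \<in> \<Omega> \<longrightarrow> Ext f y = Ext g y" by simp
  qed
  moreover have "AE z in N. has_trace M \<Omega> (Ext f) z (f z)" if "integrable N f" for f
    using Ext[OF that] by (simp add: good_def)
  ultimately show ?thesis by blast
qed

end
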